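(* Let $|v_1\rangle=\frac{1}{\sqrt2}(|01\rangle-|10\rangle)$ and $|v_2\rangle=\frac{1}{\sqrt2}(|02\rangle-|20\rangle)$ in $\mathbb{C}^3\otimes\mathbb{C}^3$ (with $\{|0\rangle,|1\rangle,|2\rangle\}$ the standard orthonormal basis of $\mathbb{C}^3$), and let $\rho_v=\frac12(|v_1\rangle\langle v_1|+|v_2\rangle\langle v_2|)$. Then $$E_D(\rho_v)=R^\infty(\rho_v)<E_R^\infty(\rho_v)=E_C(\rho_v).$$ Here $E_D$ and $E_C$ are the distillable entanglement and the entanglement cost under PPT operations, $R^\infty$ is the regularized Rains' bound, and $E_R^\infty$ is the asymptotic PPT-relative entropy of entanglement.
   Context: All Hilbert spaces are finite-dimensional and $\log=\log_2$. A state on $A\otimes B$ is a positive semidefinite operator of trace one. $T_B$ denotes partial transpose on the second (Bob's) system: $(|i_Aj_B\rangle\langle k_Al_B|)^{T_B}=|i_Al_B\rangle\langle k_Aj_B|$. For tensor powers $\rho^{\otimes n}$, the bipartition is all of Alice's systems versus all of Bob's systems. $\|\cdot\|_1$ is the trace norm. PPT operations: a completely positive trace-preserving (CPTP) map $\Lambda:\mathcal{L}(A\otimes B)\to\mathcal{L}(A'\otimes B')$ is a PPT operation if $T_{B'}\circ\Lambda\circ T_B$ is completely positive (equivalently, its Choi matrix has positive partial transpose across $AA':BB'$). Let $\Phi=|\phi\rangle\langle\phi|$ with $|\phi\rangle=\frac1{\sqrt2}(|00\rangle+|11\rangle)$ (a Bell pair, one ebit). The distillable entanglement under PPT operations is $$E_D(\rho)=\sup\Big\{r\ge0:\lim_{n\to\infty}\inf_{\Lambda\text{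 PPT operation}}\|\Lambda(\rho^{\otimes n})-\Phi^{\otimes\lfloor rn\rfloor}\|_1=0\Big\},$$ and the entanglement cost under PPT operations is $$E_C(\rho)=\inf\Big\{r\ge0:\lim_{n\to\infty}\inf_{\Lambda\text{ PPT operation}}\|\rho^{\otimes n}-\Lambda(\Phi^{\otimes\lfloor rn\rfloor})\|_1=0\Big\}.$$ Quantum relative entropy: $S(\rho\|\sigma)=\mathrm{Tr}(\rho\log\rho-\rho\log\sigma)$ (equal to $+\infty$ if $\mathrm{supp}(\rho)\not\subseteq\mathrm{supp}(\sigma)$). Rains' bound: $R(\rho)=\min\{S(\rho\|\sigma):\sigma\ge0,\ \|\sigma^{T_B}\|_1\le1\}$, with regularization $R^\infty(\rho)=\inf_{n\ge1}R(\rho^{\otimes n})/n$. PPT-relative entropy of entanglement: $E_R(\rho)=\min\{S(\rho\|\sigma):\sigma\ge0,\ \sigma^{T_B}\ge0,\ \mathrm{Tr}\,\sigma=1\}$, with $E_R^\infty(\rho)=\inf_{n\ge1}E_R(\rho^{\otimes n})/n$. *)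

theory Defs
  imports
    Complex_Main
    "HOL-Library.Extended_Real"
    "Jordan_Normal_Form.Matrix_Kernel"
    "Jordan_Normal_Form.Schur_Decomposition"
begin

text \<open>
  Operators on a \<open>D\<close>-dimensional Hilbert space are matrices in \<open>carrier_mat D D\<close>.  For a bipartite
  space with local dimensions \<open>dA\<close> (Alice) and \<open>dB\<close> (Bob), the product basis vector
  \<open>|a b>\<close> carries the index \<open>a * dB + b\<close>.
\<close>

section \<open>Finite-dimensional operators\<close>

definition mat_trace :: "complex mat \<Rightarrow> complex" where
  "mat_trace A = (\<Sum>i<dim_row A. A $$ (i, i))"

text \<open>The order on \<^typ>\<open>complex\<close> is \<open>0 \<le> z \<longleftrightarrow> Im z = 0 \<and> 0 \<le> Re z\<close>, so that
  \<open>psd_mat\<close> entails Hermiticity.\<close>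

definition psd_mat :: "nat \<Rightarrow> complex mat \<Rightarrow> bool" where
  "psd_mat D A \<longleftrightarrow> A \<in> carrier_mat D D \<and> (\<forall>v \<in> carrier_vec D. 0 \<le> (A *\<^sub>v v) \<bullet>c v)"

definition unitary_mat :: "nat \<Rightarrow> complex mat \<Rightarrow> bool" where
  "unitary_mat D U \<longleftrightarrow> U \<in> carrier_mat D D \<and>
     U * mat_adjoint U = 1\<^sub>m D \<and> mat_adjoint U * U = 1\<^sub>m D"

text \<open>Functional calculus, meaningful for Hermitian \<open>A\<close>: by the spectral theorem a diagonalisation
  exists, and the resulting matrix does not depend on its choice.\<close>

definition hermitian_fun :: "(real \<Rightarrow> real) \<Rightarrow> complex mat \<Rightarrow> complex mat" where
  "hermitian_fun f A = (THE B. \<exists>U d. unitary_mat (dim_row A) U \<and>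
     A = U * mat_diag (dim_row A) (\<lambda>i. complex_of_real (d i)) * mat_adjoint U \<and>
     B = U * mat_diag (dim_row A) (\<lambda>i. complex_of_real (f (d i))) * mat_adjoint U)"

definition trace_norm :: "complex mat \<Rightarrow> real" where
  "trace_norm A = Re (mat_trace (hermitian_fun sqrt (mat_adjoint A * A)))"

text \<open>Logarithm to base 2 on the support, with the convention \<open>0\<close> on the kernel.\<close>

definition mat_log2 :: "complex mat \<Rightarrow> complex mat" where
  "mat_log2 A = hermitian_fun (\<lambda>x. if x > 0 then log 2 x else 0) A"

definition mat_supp :: "complex mat \<Rightarrow> complex vec set" where
  "mat_supp A = {v \<in> carrier_vec (dim_col A). \<forall>w \<in> mat_kernel A. v \<bullet>c w = 0}"

definition rel_entropy :: "complex mat \<Rightarrow> complex mat \<Rightarrow> ereal" where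
  "rel_entropy \<rho> \<sigma> =
     (if mat_supp \<rho> \<subseteq> mat_supp \<sigma>
      then ereal (Re (mat_trace (\<rho> * mat_log2 \<rho> - \<rho> * mat_log2 \<sigma>)))
      else \<infinity>)"

section \<open>Vectors and rank-one operators\<close>

definition tensor_vec :: "complex vec \<Rightarrow> complex vec \<Rightarrow> complex vec" where
  "tensor_vec v w =
     vec (dim_vec v * dim_vec w) (\<lambda>i. v $ (i div dim_vec w) * w $ (i mod dim_vec w))"

definition ket2 :: "nat \<Rightarrow> nat \<Rightarrow> nat \<Rightarrow> complex vec" where
  "ket2 d i j = tensor_vec (unit_vec d i) (unit_vec d j)"

definition ket_bra :: "complex vec \<Rightarrow> complex mat" where
  "ket_bra v = mat (dim_vec v) (dim_vec v) (\<lambda>(i, j). v $ i * cnj (v $ j))"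

section \<open>Bipartite structure\<close>

definition partial_transpose :: "nat \<Rightarrow> nat \<Rightarrow> complex mat \<Rightarrow> complex mat" where
  "partial_transpose dA dB X = mat (dA * dB) (dA * dB)
     (\<lambda>(i, j). X $$ ((i div dB) * dB + j mod dB, (j div dB) * dB + i mod dB))"

text \<open>
  The tensor product of an operator \<open>M\<close> on \<open>A1 \<otimes> B1\<close> with an operator \<open>N\<close> on \<open>A2 \<otimes> B2\<close>,
  regarded as an operator on \<open>(A1 \<otimes> A2) \<otimes> (B1 \<otimes> B2)\<close>.  In the regrouped space
  \<open>|a1 a2 b1 b2>\<close> has index \<open>(a1 * dA2 + a2) * (dB1 * dB2) + (b1 * dB2 + b2)\<close>; the functions
  \<open>fst_index\<close> and \<open>snd_index\<close> recover \<open>a1 * dB1 + b1\<close> and \<open>a2 * dB2 + b2\<close> from it.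
\<close>

definition fst_index :: "nat \<Rightarrow> nat \<Rightarrow> nat \<Rightarrow> nat \<Rightarrow> nat" where
  "fst_index dB1 dA2 dB2 i =
     ((i div (dB1 * dB2)) div dA2) * dB1 + (i mod (dB1 * dB2)) div dB2"

definition snd_index :: "nat \<Rightarrow> nat \<Rightarrow> nat \<Rightarrow> nat \<Rightarrow> nat" where
  "snd_index dB1 dA2 dB2 i =
     ((i div (dB1 * dB2)) mod dA2) * dB2 + (i mod (dB1 * dB2)) mod dB2"

definition bip_tensor ::
  "nat \<Rightarrow> nat \<Rightarrow> nat \<Rightarrow> nat \<Rightarrow> complex mat \<Rightarrow> complex mat \<Rightarrow> complex mat" where
  "bip_tensor dA1 dB1 dA2 dB2 M N =
     mat ((dA1 * dA2) * (dB1 * dB2)) ((dA1 * dA2) * (dB1 * dB2))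
       (\<lambda>(i, j). M $$ (fst_index dB1 dA2 dB2 i, fst_index dB1 dA2 dB2 j) *
                 N $$ (snd_index dB1 dA2 dB2 i, snd_index dB1 dA2 dB2 j))"

text \<open>\<open>bip_power dA dB M n\<close> has local dimensions \<open>dA ^ n\<close> and \<open>dB ^ n\<close>.\<close>

primrec bip_power :: "nat \<Rightarrow> nat \<Rightarrow> complex mat \<Rightarrow> nat \<Rightarrow> complex mat" where
  "bip_power dA dB M 0 = 1\<^sub>m 1"
| "bip_power dA dB M (Suc n) = bip_tensor dA dB (dA ^ n) (dB ^ n) M (bip_power dA dB M n)"

section \<open>Quantum operations\<close>

definition linear_op :: "nat \<Rightarrow> nat \<Rightarrow> (complex mat \<Rightarrow> complex mat) \<Rightarrow> bool" where
  "linear_op D D' \<Lambda> \<longleftrightarrow>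
     (\<forall>X \<in> carrier_mat D D. \<Lambda> X \<in> carrier_mat D' D') \<and>
     (\<forall>X \<in> carrier_mat D D. \<forall>Y \<in> carrier_mat D D. \<Lambda> (X + Y) = \<Lambda> X + \<Lambda> Y) \<and>
     (\<forall>c. \<forall>X \<in> carrier_mat D D. \<Lambda> (c \<cdot>\<^sub>m X) = c \<cdot>\<^sub>m \<Lambda> X)"

text \<open>\<open>id \<otimes> \<Lambda>\<close> with a \<open>k\<close>-dimensional ancilla: \<open>\<Lambda>\<close> is applied to each \<open>D \<times> D\<close> block of \<open>X\<close>.\<close>

definition ampliation ::
  "nat \<Rightarrow> nat \<Rightarrow> nat \<Rightarrow> (complex mat \<Rightarrow> complex mat) \<Rightarrow> complex mat \<Rightarrow> complex mat" where
  "ampliation k D D' \<Lambda> X = mat (k * D') (k * D')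
     (\<lambda>(i, j). \<Lambda> (mat D D (\<lambda>(p, q). X $$ ((i div D') * D + p, (j div D') * D + q)))
                 $$ (i mod D', j mod D'))"

definition completely_positive :: "nat \<Rightarrow> nat \<Rightarrow> (complex mat \<Rightarrow> complex mat) \<Rightarrow> bool" where
  "completely_positive D D' \<Lambda> \<longleftrightarrow> linear_op D D' \<Lambda> \<and>
     (\<forall>k X. psd_mat (k * D) X \<longrightarrow> psd_mat (k * D') (ampliation k D D' \<Lambda> X))"

definition cptp :: "nat \<Rightarrow> nat \<Rightarrow> (complex mat \<Rightarrow> complex mat) \<Rightarrow> bool" where
  "cptp D D' \<Lambda> \<longleftrightarrow> completely_positive D D' \<Lambda> \<and>
     (\<forall>X \<in> carrier_mat D D. mat_trace (\<Lambda> X) = mat_trace X)"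

definition ppt_operations ::
  "nat \<Rightarrow> nat \<Rightarrow> nat \<Rightarrow> nat \<Rightarrow> (complex mat \<Rightarrow> complex mat) set" where
  "ppt_operations dA dB dA' dB' =
     {\<Lambda>. cptp (dA * dB) (dA' * dB') \<Lambda> \<and>
          completely_positive (dA * dB) (dA' * dB')
            (partial_transpose dA' dB' \<circ> \<Lambda> \<circ> partial_transpose dA dB)}"

section \<open>Distillable entanglement and entanglement cost\<close>

definition bell_vec :: "complex vec" where
  "bell_vec = complex_of_real (1 / sqrt 2) \<cdot>\<^sub>v (ket2 2 0 0 + ket2 2 1 1)"

definition ebits :: "nat \<Rightarrow> complex mat" where
  "ebits k = bip_power 2 2 (ket_bra bell_vec) k"

text \<open>Both quantities take values in \<^typ>\<open>ereal\<close>, so that suprema and infima need no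
  boundedness or non-emptiness side conditions.\<close>

definition distillable_entanglement :: "nat \<Rightarrow> nat \<Rightarrow> complex mat \<Rightarrow> ereal" where
  "distillable_entanglement dA dB \<rho> = Sup {ereal r | r. r \<ge> 0 \<and>
     (\<lambda>n. INF \<Lambda> \<in> ppt_operations (dA ^ n) (dB ^ n)
                   (2 ^ nat \<lfloor>r * real n\<rfloor>) (2 ^ nat \<lfloor>r * real n\<rfloor>).
            trace_norm (\<Lambda> (bip_power dA dB \<rho> n) - ebits (nat \<lfloor>r * real n\<rfloor>)))
     \<longlonglongrightarrow> 0}"

definition entanglement_cost :: "nat \<Rightarrow> nat \<Rightarrow> complex mat \<Rightarrow> ereal" where
  "entanglement_cost dA dB \<rho> = Inf {ereal r | r. r \<ge> 0 \<and>
     (\<lambda>n. INF \<Lambda> \<in> ppt_operations (2 ^ nat \<lfloor>r * real n\<rfloor>) (2 ^ nat \<lfloor>r * real n\<rfloor>)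
                   (dA ^ n) (dB ^ n).
            trace_norm (bip_power dA dB \<rho> n - \<Lambda> (ebits (nat \<lfloor>r * real n\<rfloor>))))
     \<longlonglongrightarrow> 0}"

section \<open>Rains' bound and the PPT-relative entropy of entanglement\<close>

definition rains_bound :: "nat \<Rightarrow> nat \<Rightarrow> complex mat \<Rightarrow> ereal" where
  "rains_bound dA dB \<rho> =
     (INF \<sigma> \<in> {\<sigma>. psd_mat (dA * dB) \<sigma> \<and> trace_norm (partial_transpose dA dB \<sigma>) \<le> 1}.
        rel_entropy \<rho> \<sigma>)"

definition ppt_rel_entropy :: "nat \<Rightarrow> nat \<Rightarrow> complex mat \<Rightarrow> ereal" where
  "ppt_rel_entropy dA dB \<rho> =
     (INF \<sigma> \<in> {\<sigma>. psd_mat (dA * dB) \<sigma> \<and> psd_mat (dA * dB) (partial_transpose dA dB \<sigma>) \<and>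
                 mat_trace \<sigma> = 1}.
        rel_entropy \<rho> \<sigma>)"

definition regularized_rains :: "nat \<Rightarrow> nat \<Rightarrow> complex mat \<Rightarrow> ereal" where
  "regularized_rains dA dB \<rho> =
     (INF n \<in> {1..}. rains_bound (dA ^ n) (dB ^ n) (bip_power dA dB \<rho> n) / ereal (real n))"

definition regularized_ppt_rel_entropy :: "nat \<Rightarrow> nat \<Rightarrow> complex mat \<Rightarrow> ereal" where
  "regularized_ppt_rel_entropy dA dB \<rho> =
     (INF n \<in> {1..}. ppt_rel_entropy (dA ^ n) (dB ^ n) (bip_power dA dB \<rho> n) / ereal (real n))"

section \<open>The state\<close>

definition v1 :: "complex vec" where
  "v1 = complex_of_real (1 / sqrt 2) \<cdot>\<^sub>v (ket2 3 0 1 - ket2 3 1 0)"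

definition v2 :: "complex vec" where
  "v2 = complex_of_real (1 / sqrt 2) \<cdot>\<^sub>v (ket2 3 0 2 - ket2 3 2 0)"

definition rho_v :: "complex mat" where
  "rho_v = (1 / 2) \<cdot>\<^sub>m (ket_bra v1 + ket_bra v2)"

end

theory Submission
  imports Defs
begin

text \<open>
  Call \<open>A\<close> a dominator of \<open>X\<close> if \<open>- A \<le> X \<le> A\<close>.  Domination is stable under tensor products and
  completely positive maps, and dominators \<open>A\<close> of \<open>X\<close> and \<open>B\<close> of \<open>Z\<close> satisfy \<open>\<bar>tr (X Z)\<bar> \<le> tr (A B)\<close>.
  With \<open>\<Gamma>\<close> the partial transpose and \<open>\<tau> = 1 + 1/\<surd>2 = \<parallel>rho_v\<^sup>\<Gamma>\<parallel>\<^sub>1\<close>, everything follows from a few \<open>9 \<times> 9\<close>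
  witnesses and their tensor powers.

  Distillation and Rains' bound have the common rate \<open>log \<tau>\<close>.  A test \<open>R\<close> with \<open>rho_v \<le> R/2 \<le> 1/2\<close>
  such that \<open>1/\<tau>\<close> dominates \<open>R\<^sup>\<Gamma>\<close> yields PPT operations that distil
  exactly at this rate, and it bounds \<open>tr (rho_v \<sigma>)\<close> for every Rains operator \<open>\<sigma>\<close>; conversely the log-negativity \<open>log \<tau>\<close> bounds both quantities from above.

  Cost and PPT-relative entropy have the common rate \<open>1\<close>.  A dominator \<open>Y\<close> of \<open>rho_v\<^sup>\<Gamma>\<close> such that
  \<open>1/4\<close> dominates \<open>Y\<^sup>\<Gamma>\<close> bounds the overlap with PPT states and with states prepared from few ebits, while
  \<open>rho_v\<close>, a mixture of two Bell pairs, is diluted exactly from one ebit per copy.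

  Overlap bounds become entropy bounds because the tensor powers of \<open>rho_v\<close> have flat spectrum, so that
  \<open>S(\<rho>\<parallel>\<sigma>) \<ge> - log (tr (P \<sigma>))\<close> for the support projection \<open>P\<close> by Jensen's inequality.
\<close>

section \<open>Hermitian matrices and the spectral theorem\<close>

text \<open>The gap between the rates comes from \<open>|0>\<close> being shared by the Bell pairs
  \<open>v1\<close> and \<open>v2\<close>. In \<open>rho_v\<^sup>\<Gamma>\<close> the coherences of
  00 with 11 and with 22 merge into one block with eigenvalues \<plusminus>1/(2\<surd>2) and 0,
  where two locally distinguishable pairs would give \<plusminus>1/4 twice; so \<tau> = 4/4 +
  2/(2\<surd>2) < 2, while preparation still costs a whole ebit. A Rains operator is controlled
  after \<Gamma> only through the trace norm of \<open>\<sigma>\<^sup>\<Gamma>\<close>, so \<Gamma>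
  is used once, as the last move. A PPT state has \<open>\<sigma>\<close> and
  \<open>\<sigma>\<^sup>\<Gamma>\<close> both positive: \<Gamma> can be applied,
  \<open>rho_v\<^sup>\<Gamma>\<close> replaced by \<open>Y\<close>, \<Gamma> undone and
  \<open>Y\<^sup>\<Gamma>\<close> compared with a scalar. PPT preparation allows the same two moves.
  All quantities are asymptotic, so certificates must multiply. Dominators do, and unlike the
  absolute value they leave a choice: taking the absolute value of
  \<open>rho_v\<^sup>\<Gamma>\<close> as \<open>Y\<close>, the same argument would only show that
  the cost is at least 1/2.\<close>

lemma mat_adjoint_dim [simp]:
  "dim_row (mat_adjoint A) = dim_col A" "dim_col (mat_adjoint A) = dim_row A"
  by (auto simp: mat_adjoint_def mat_of_rows_def)

lemma mat_adjoint_index [simp]: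
  assumes "i < dim_col A" "j < dim_row A"
  shows "mat_adjoint (A :: complex mat) $$ (i, j) = cnj (A $$ (j, i))"
  using assms by (simp add: mat_adjoint_def mat_of_rows_index)

lemma mat_adjoint_carrier [simp, intro]:
  "A \<in> carrier_mat n m \<Longrightarrow> mat_adjoint A \<in> carrier_mat m n"
  by (rule carrier_matI) auto

lemma mat_mult_index:
  assumes "A \<in> carrier_mat n m" "B \<in> carrier_mat m k" "i < n" "j < k"
  shows "(A * B) $$ (i, j) = (\<Sum>l<m. A $$ (i, l) * B $$ (l, j))"
  using assms by (simp add: scalar_prod_def atLeast0LessThan)

lemma mat_adjoint_mult:
  assumes "(A :: complex mat) \<in> carrier_mat n m" "B \<in> carrier_mat m k"
  shows "mat_adjoint (A * B) = mat_adjoint B * mat_adjoint A"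
proof (rule eq_matI)
  fix i j assume ij: "i < dim_row (mat_adjoint B * mat_adjoint A)"
    "j < dim_col (mat_adjoint B * mat_adjoint A)"
  then have ij': "i < k" "j < n" using assms by auto
  have "(mat_adjoint B * mat_adjoint A) $$ (i, j) =
      (\<Sum>l<m. mat_adjoint B $$ (i, l) * mat_adjoint A $$ (l, j))"
    by (rule mat_mult_index) (use assms ij' in auto)
  moreover have "(A * B) $$ (j, i) = (\<Sum>l<m. A $$ (j, l) * B $$ (l, i))"
    by (rule mat_mult_index) (use assms ij' in auto)
  ultimately show "mat_adjoint (A * B) $$ (i, j) = (mat_adjoint B * mat_adjoint A) $$ (i, j)"
    using assms ij' by (simp add: mult.commute)
qed (use assms in auto)

lemma mat_adjoint_adjoint [simp]: "mat_adjoint (mat_adjoint (A :: complex mat)) = A"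
  by (rule eq_matI) auto

definition hermitian :: "nat \<Rightarrow> complex mat \<Rightarrow> bool" where
  "hermitian D A \<longleftrightarrow> A \<in> carrier_mat D D \<and> (\<forall>i<D. \<forall>j<D. A $$ (j, i) = cnj (A $$ (i, j)))"

lemma hermitian_adjoint: "hermitian D A \<Longrightarrow> mat_adjoint A = A"
  unfolding hermitian_def by (intro eq_matI) (metis carrier_matD mat_adjoint_dim mat_adjoint_index, auto)

definition spectral_mat :: "nat \<Rightarrow> complex mat \<Rightarrow> (nat \<Rightarrow> real) \<Rightarrow> complex mat" where
  "spectral_mat D U d = U * mat_diag D (\<lambda>i. complex_of_real (d i)) * mat_adjoint U"

lemma spectral_mat_carrier [simp]:
  "U \<in> carrier_mat D D \<Longrightarrow> spectral_mat D U d \<in> carrier_mat D D"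
  unfolding spectral_mat_def by (intro mult_carrier_mat[of _ D D] mat_adjoint_carrier mat_diag_dim)

lemma spectral_mat_index:
  assumes "U \<in> carrier_mat D D" "i < D" "j < D"
  shows "spectral_mat D U d $$ (i, j) = (\<Sum>k<D. U $$ (i, k) * d k * cnj (U $$ (j, k)))"
proof -
  have "U * mat_diag D (\<lambda>i. complex_of_real (d i)) = mat D D (\<lambda>(i, j). U $$ (i, j) * d j)"
    by (rule mat_diag_mult_right) (use assms in auto)
  moreover have "(mat D D (\<lambda>(i, j). U $$ (i, j) * d j) * mat_adjoint U) $$ (i, j) =
     (\<Sum>k<D. mat D D (\<lambda>(i, j). U $$ (i, j) * d j) $$ (i, k) * mat_adjoint U $$ (k, j))"
    by (rule mat_mult_index) (use assms in auto)
  ultimately show ?thesis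
    using assms unfolding spectral_mat_def by (auto intro!: sum.cong)
qed

lemma unitary_matD:
  assumes "unitary_mat D U"
  shows "U \<in> carrier_mat D D"
    and "i < D \<Longrightarrow> j < D \<Longrightarrow> (\<Sum>k<D. U $$ (i, k) * cnj (U $$ (j, k))) = (if i = j then 1 else 0)"
    and "i < D \<Longrightarrow> j < D \<Longrightarrow> (\<Sum>k<D. U $$ (k, i) * cnj (U $$ (k, j))) = (if i = j then 1 else 0)"
proof -
  show U: "U \<in> carrier_mat D D" using assms by (simp add: unitary_mat_def)
  have 1: "U * mat_adjoint U = 1\<^sub>m D" "mat_adjoint U * U = 1\<^sub>m D"
    using assms by (auto simp: unitary_mat_def)
  show "(\<Sum>k<D. U $$ (i, k) * cnj (U $$ (j, k))) = (if i = j then 1 else 0)" if "i < D" "j < D"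
  proof -
    have "(U * mat_adjoint U) $$ (i, j) = (\<Sum>k<D. U $$ (i, k) * mat_adjoint U $$ (k, j))"
      by (rule mat_mult_index) (use U that in auto)
    then show ?thesis unfolding 1 using that U by simp
  qed
  show "(\<Sum>k<D. U $$ (k, i) * cnj (U $$ (k, j))) = (if i = j then 1 else 0)" if "i < D" "j < D"
  proof -
    have "(mat_adjoint U * U) $$ (j, i) = (\<Sum>k<D. mat_adjoint U $$ (j, k) * U $$ (k, i))"
      by (rule mat_mult_index) (use U that in auto)
    then show ?thesis unfolding 1 using that U by (auto simp: mult.commute)
  qed
qed

text \<open>Orthonormal columns suffice, because in finite dimension a left inverse is a right
  inverse.\<close>

lemma unitary_matI:
  assumes "U \<in> carrier_mat D D"
    and "\<And>i j. i < D \<Longrightarrow> j < D \<Longrightarrow>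
      (\<Sum>k<D. U $$ (k, i) * cnj (U $$ (k, j))) = (if i = j then 1 else 0)"
  shows "unitary_mat D U"
proof -
  have "mat_adjoint U * U = 1\<^sub>m D"
  proof (rule eq_matI)
    fix i j assume "i < dim_row (1\<^sub>m D :: complex mat)" "j < dim_col (1\<^sub>m D :: complex mat)"
    then have ij: "i < D" "j < D" by auto
    have "(mat_adjoint U * U) $$ (i, j) = (\<Sum>k<D. mat_adjoint U $$ (i, k) * U $$ (k, j))"
      by (rule mat_mult_index) (use assms ij in auto)
    also have "\<dots> = (\<Sum>k<D. U $$ (k, j) * cnj (U $$ (k, i)))"
      using assms(1) ij by (intro sum.cong) (simp_all add: mult.commute)
    finally show "(mat_adjoint U * U) $$ (i, j) = 1\<^sub>m D $$ (i, j)"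
      using assms(2)[of j i] ij by auto
  qed (use assms in auto)
  moreover from this have "U * mat_adjoint U = 1\<^sub>m D"
    using mat_mult_left_right_inverse[of "mat_adjoint U" D U] assms by auto
  ultimately show ?thesis using assms by (simp add: unitary_mat_def)
qed

text \<open>Gram-Schmidt applied to a basis starting with \<open>v\<close>. Since
  \<open>gram_schmidt\<close> delivers orthogonal but unnormalised vectors, the columns are
  rescaled, and the first one is only a multiple of \<open>v\<close>.\<close>

lemma orthonormal_completion:
  assumes v: "(v :: complex vec) \<in> carrier_vec n" "v \<noteq> 0\<^sub>v n"
  obtains W c where "unitary_mat n W" "c \<noteq> 0" "col W 0 = c \<cdot>\<^sub>v v" 
proof -
  have n: "n \<noteq> 0" using v by (metis carrier_vecD vec_of_dim_0 zero_vec_def dim_vec)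
  interpret cof_vec_space n "TYPE(complex)" .
  define b where "b = basis_completion v"
  define ws where "ws = gram_schmidt n b"
  note bc = basis_completion[OF v, folded b_def]
  from bc(6,7) n obtain vs where bv: "b = v # vs" by (cases b) auto
  from gram_schmidt_result[OF bc(2,4,5) refl, folded ws_def]
  have ws: "set ws \<subseteq> carrier_vec n" "corthogonal ws" "length ws = n"
    using bc(6) by auto
  have hdws: "hd ws = v"
    using gram_schmidt_hd[OF v(1), of vs] unfolding ws_def bv .
  then have ws0: "ws ! 0 = v" using ws(3) n by (metis hd_conv_nth length_greater_0_conv not_gr_zero)
  have wsd: "dim_vec (ws ! i) = n" if "i < n" for i
    using ws that by (metis carrier_vecD nth_mem subset_iff)
  define nn where "nn i = (\<Sum>k<n. (cmod (ws ! i $ k))\<^sup>2)" for i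
  have ip: "(ws ! i) \<bullet>c (ws ! j) = (\<Sum>k<n. ws ! i $ k * cnj (ws ! j $ k))" if "i < n" "j < n" for i j
    using wsd that by (simp add: scalar_prod_def atLeast0LessThan)
  have ipn: "(\<Sum>k<n. ws ! i $ k * cnj (ws ! i $ k)) = complex_of_real (nn i)" for i
    by (simp add: nn_def complex_norm_square del: of_real_power)
  have nn: "nn i > 0" if "i < n" for i
  proof -
    have "nn i \<noteq> 0" using corthogonalD[OF ws(2), of i i] ip[of i i] ipn[of i] that ws(3) by auto
    moreover have "nn i \<ge> 0" by (simp add: nn_def sum_nonneg)
    ultimately show ?thesis by simp
  qed
  define W where "W = mat n n (\<lambda>(k, i). complex_of_real (1 / sqrt (nn i)) * (ws ! i $ k))"
  have W: "W \<in> carrier_mat n n" by (simp add: W_def)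
  have "unitary_mat n W"
  proof (rule unitary_matI[OF W])
    fix i j assume ij: "i < n" "j < n"
    have "(\<Sum>k<n. W $$ (k, i) * cnj (W $$ (k, j))) =
      (\<Sum>k<n. complex_of_real (1 / sqrt (nn i) * (1 / sqrt (nn j))) * (ws ! i $ k * cnj (ws ! j $ k)))"
      using ij by (intro sum.cong) (auto simp: W_def)
    also have "\<dots> = complex_of_real (1 / sqrt (nn i) * (1 / sqrt (nn j))) * ((ws ! i) \<bullet>c (ws ! j))"
      by (simp only: ip[OF ij] sum_distrib_left)
    also have "\<dots> = (if i = j then 1 else 0)"
    proof (cases "i = j")
      case True
      have "complex_of_real (1 / sqrt (nn i) * (1 / sqrt (nn j))) * ((ws ! i) \<bullet>c (ws ! j)) =
          complex_of_real (1 / sqrt (nn i) * (1 / sqrt (nn i)) * nn i)"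
        using True ip[of i i] ipn[of i] ij by simp
      also have "1 / sqrt (nn i) * (1 / sqrt (nn i)) * nn i = 1"
        using nn[OF ij(1)] by (simp add: field_simps)
      finally show ?thesis using True by simp
    next
      case False
      then show ?thesis using corthogonalD[OF ws(2), of i j] ij ws(3) by auto
    qed
    finally show "(\<Sum>k<n. W $$ (k, i) * cnj (W $$ (k, j))) = (if i = j then 1 else 0)" .
  qed
  moreover have "col W 0 = complex_of_real (1 / sqrt (nn 0)) \<cdot>\<^sub>v v"
    using n v by (intro eq_vecI) (auto simp: W_def ws0)
  moreover have "complex_of_real (1 / sqrt (nn 0)) \<noteq> 0" using nn[of 0] n by simp
  ultimately show ?thesis using that by blast
qed

lemma eigenvector_exists:
  assumes "(A :: complex mat) \<in> carrier_mat n n" "n \<noteq> 0"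
  obtains v e where "v \<in> carrier_vec n" "v \<noteq> 0\<^sub>v n" "A *\<^sub>v v = e \<cdot>\<^sub>v v"
proof -
  from char_poly_factorized[OF assms(1)] obtain as where
    as: "char_poly A = (\<Prod>a\<leftarrow>as. [:- a, 1:])" "length as = n" by auto
  then obtain e es where "as = e # es" using assms(2) by (cases as) auto
  then have "eigenvalue A e" unfolding eigenvalue_root_char_poly[OF assms(1)] as by simp
  then obtain v where "eigenvector A v e" unfolding eigenvalue_def by auto
  then show ?thesis using that assms(1) unfolding eigenvector_def by auto
qed

text \<open>Induction by deflation: conjugation with a unitary whose first column is an eigenvector
  leaves a Hermitian matrix whose first column, hence also its first row, vanishes off the corner.
  The induction hypothesis diagonalises the remaining block.\<close>

lemma spectral_theorem:
  assumes "hermitian D A"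
  shows "\<exists>U d. unitary_mat D U \<and> A = spectral_mat D U d"
  using assms
proof (induction D arbitrary: A)
  case 0
  have "unitary_mat 0 (1\<^sub>m 0)" by (rule unitary_matI) auto
  moreover have "A = spectral_mat 0 (1\<^sub>m 0) (\<lambda>_. 0)"
    using 0 by (intro eq_matI) (auto simp: hermitian_def spectral_mat_def)
  ultimately show ?case by blast
next
  case (Suc n)
  let ?N = "Suc n"
  have A: "A \<in> carrier_mat ?N ?N" using Suc.prems by (simp add: hermitian_def)
  obtain v e where v: "v \<in> carrier_vec ?N" "v \<noteq> 0\<^sub>v ?N" "A *\<^sub>v v = e \<cdot>\<^sub>v v"
    using eigenvector_exists[OF A] by auto
  obtain W c where W: "unitary_mat ?N W" "c \<noteq> 0" "col W 0 = c \<cdot>\<^sub>v v"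
    using orthonormal_completion[OF v(1,2)] by blast
  note Wc = unitary_matD(1)[OF W(1)]
  note Wo = unitary_matD(3)[OF W(1)]
  have WW: "W * mat_adjoint W = 1\<^sub>m ?N" "mat_adjoint W * W = 1\<^sub>m ?N"
    using W(1) by (auto simp: unitary_mat_def)
  define B where "B = mat_adjoint W * (A * W)"
  have Bc: "B \<in> carrier_mat ?N ?N" unfolding B_def using A Wc by auto
  have Bh: "mat_adjoint B = B"
  proof -
    have "mat_adjoint B = mat_adjoint (A * W) * W"
      unfolding B_def by (subst mat_adjoint_mult) (use A Wc in auto)
    also have "mat_adjoint (A * W) = mat_adjoint W * A"
      by (subst mat_adjoint_mult) (use A Wc hermitian_adjoint[OF Suc.prems] in auto)
    also have "mat_adjoint W * A * W = B"
      unfolding B_def by (rule assoc_mult_mat) (use A Wc in auto)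
    finally show ?thesis .
  qed
  have Bcnj: "B $$ (j, i) = cnj (B $$ (i, j))" if "i < ?N" "j < ?N" for i j
    using that Bh Bc by (metis carrier_matD mat_adjoint_index)
  have AW: "(A * W) $$ (k, 0) = e * W $$ (k, 0)" if "k < ?N" for k
  proof -
    have "col (A * W) 0 = A *\<^sub>v col W 0" using A Wc by auto
    also have "\<dots> = c \<cdot>\<^sub>v (A *\<^sub>v v)" unfolding W(3) using A v by (simp add: mult_mat_vec)
    also have "\<dots> = e \<cdot>\<^sub>v col W 0" unfolding W(3) v(3) by (simp add: smult_smult_assoc mult.commute)
    finally have "col (A * W) 0 $ k = (e \<cdot>\<^sub>v col W 0) $ k" by simp
    then show ?thesis using that A Wc by simp
  qed
  have B0: "B $$ (i, 0) = (if i = 0 then e else 0)" if "i < ?N" for i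
  proof -
    have "B $$ (i, 0) = (\<Sum>k<?N. mat_adjoint W $$ (i, k) * (A * W) $$ (k, 0))"
      unfolding B_def by (rule mat_mult_index) (use A Wc that in auto)
    also have "\<dots> = (\<Sum>k<?N. e * (W $$ (k, 0) * cnj (W $$ (k, i))))"
      using Wc that by (intro sum.cong) (auto simp: AW)
    also have "\<dots> = e * (if 0 = i then 1 else 0)"
      using Wo[of 0 i] that by (simp only: sum_distrib_left[symmetric])
    finally show ?thesis by auto
  qed
  have B0': "B $$ (0, i) = (if i = 0 then e else 0)" if "i < ?N" for i
    using B0[OF that] Bcnj[of i 0] Bcnj[of 0 0] B0[of 0] that by auto
  \<comment> \<open>A diagonal entry of a Hermitian matrix is real, so the eigenvalue, a priori
    complex, may enter the real spectrum \<open>d'\<close>.\<close>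
  have er: "e = complex_of_real (Re e)"
    using Bcnj[of 0 0] B0[of 0] by (simp add: complex_eq_iff)
  define C where "C = mat n n (\<lambda>(i, j). B $$ (Suc i, Suc j))"
  have "hermitian n C"
    unfolding hermitian_def C_def by (auto intro: Bcnj)
  from Suc.IH[OF this] obtain V d where V: "unitary_mat n V" "C = spectral_mat n V d" by blast
  note Vc = unitary_matD(1)[OF V(1)]
  define V' where "V' = mat ?N ?N (\<lambda>(i, j). case i of 0 \<Rightarrow> (if j = 0 then 1 else 0)
     | Suc i' \<Rightarrow> (case j of 0 \<Rightarrow> 0 | Suc j' \<Rightarrow> V $$ (i', j')))"
  define d' where "d' i = (case i of 0 \<Rightarrow> Re e | Suc i' \<Rightarrow> d i')" for i
  have V'c: "V' \<in> carrier_mat ?N ?N" by (simp add: V'_def)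
  have "unitary_mat ?N V'"
  proof (rule unitary_matI[OF V'c])
    fix i j assume "i < ?N" "j < ?N"
    then show "(\<Sum>k<?N. V' $$ (k, i) * cnj (V' $$ (k, j))) = (if i = j then 1 else 0)"
      using unitary_matD(3)[OF V(1)]
      by (cases i; cases j) (auto simp: V'_def sum.lessThan_Suc_shift simp del: sum.lessThan_Suc)
  qed
  have Bsp: "B = spectral_mat ?N V' d'"
  proof (rule eq_matI)
    fix i j assume "i < dim_row (spectral_mat ?N V' d')" "j < dim_col (spectral_mat ?N V' d')"
    then have ij: "i < ?N" "j < ?N" using V'c by (auto simp: spectral_mat_def)
    show "B $$ (i, j) = spectral_mat ?N V' d' $$ (i, j)"
    proof (cases "i = 0 \<or> j = 0")
      case True
      then show ?thesis
        unfolding spectral_mat_index[OF V'c ij]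
        using ij B0[of i] B0'[of j] er
        by (auto simp: V'_def d'_def sum.lessThan_Suc_shift simp del: sum.lessThan_Suc split: nat.splits)
    next
      case False
      then obtain i' j' where i'j': "i = Suc i'" "j = Suc j'" by (meson not0_implies_Suc)
      have "B $$ (i, j) = C $$ (i', j')" unfolding C_def using ij i'j' by simp
      also have "\<dots> = (\<Sum>k<n. V $$ (i', k) * d k * cnj (V $$ (j', k)))"
        unfolding V(2) by (rule spectral_mat_index[OF Vc]) (use ij i'j' in auto)
      finally show ?thesis
        unfolding spectral_mat_index[OF V'c ij] using ij i'j'
        by (simp add: V'_def d'_def sum.lessThan_Suc_shift del: sum.lessThan_Suc)
    qed
  qed (use Bc V'c in \<open>auto simp: spectral_mat_def\<close>)
  let ?U = "W * V'" and ?\<Delta> = "mat_diag ?N (\<lambda>i. complex_of_real (d' i))"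
  have Uc: "?U \<in> carrier_mat ?N ?N" using Wc V'c by auto
  have V'o: "V' * mat_adjoint V' = 1\<^sub>m ?N" "mat_adjoint V' * V' = 1\<^sub>m ?N"
    using \<open>unitary_mat ?N V'\<close> by (auto simp: unitary_mat_def)
  have Ua: "mat_adjoint ?U = mat_adjoint V' * mat_adjoint W"
    by (rule mat_adjoint_mult[OF Wc V'c])
  have "mat_adjoint ?U * ?U = mat_adjoint V' * (mat_adjoint W * (W * V'))"
    unfolding Ua by (rule assoc_mult_mat) (use Wc V'c in auto)
  also have "mat_adjoint W * (W * V') = (mat_adjoint W * W) * V'"
    by (rule assoc_mult_mat[symmetric]) (use Wc V'c in auto)
  finally have UU: "mat_adjoint ?U * ?U = 1\<^sub>m ?N" using WW V'o V'c by simp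
  then have "unitary_mat ?N ?U"
    unfolding unitary_mat_def using mat_mult_left_right_inverse[of "mat_adjoint ?U" ?N ?U] Uc by auto
  moreover have "A = spectral_mat ?N ?U d'"
  proof -
    have D: "?\<Delta> \<in> carrier_mat ?N ?N" by simp
    have Wa: "mat_adjoint W \<in> carrier_mat ?N ?N" and Va: "mat_adjoint V' \<in> carrier_mat ?N ?N"
      using Wc V'c by auto
    have VD: "V' * ?\<Delta> \<in> carrier_mat ?N ?N" using V'c D by auto
    have "spectral_mat ?N ?U d' = W * (V' * ?\<Delta>) * (mat_adjoint V' * mat_adjoint W)"
      unfolding spectral_mat_def Ua by (subst assoc_mult_mat[OF Wc V'c D]) simp
    also have "\<dots> = W * (V' * ?\<Delta>) * mat_adjoint V' * mat_adjoint W"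
      by (rule assoc_mult_mat[symmetric, OF mult_carrier_mat[OF Wc VD] Va Wa])
    also have "W * (V' * ?\<Delta>) * mat_adjoint V' = W * (V' * ?\<Delta> * mat_adjoint V')"
      by (rule assoc_mult_mat[OF Wc VD Va])
    also have "W * (V' * ?\<Delta> * mat_adjoint V') = W * B" unfolding Bsp spectral_mat_def ..
    also have "W * B = W * mat_adjoint W * (A * W)"
      unfolding B_def by (rule assoc_mult_mat[symmetric]) (use Wc Wa A in auto)
    also have "\<dots> = A * W" unfolding WW using A Wc by auto
    also have "A * W * mat_adjoint W = A * (W * mat_adjoint W)"
      by (rule assoc_mult_mat) (use Wc Wa A in auto)
    also have "\<dots> = A" unfolding WW using A by auto
    finally show ?thesis ..
  qed
  ultimately show ?case by blast
qed

section \<open>Positive semidefinite matrices\<close>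

text \<open>Test vectors are plain functions on indices, which frees them from carrier
  conditions.\<close>

definition quad_form :: "nat \<Rightarrow> complex mat \<Rightarrow> (nat \<Rightarrow> complex) \<Rightarrow> complex" where
  "quad_form D A v = (\<Sum>i<D. \<Sum>j<D. A $$ (i, j) * v j * cnj (v i))"

lemma psd_mat_iff:
  "psd_mat D A \<longleftrightarrow> A \<in> carrier_mat D D \<and> (\<forall>v. 0 \<le> quad_form D A v)"
proof -
  have eq: "(A *\<^sub>v v) \<bullet>c v = quad_form D A (\<lambda>i. v $ i)"
    if "A \<in> carrier_mat D D" "v \<in> carrier_vec D" for v
    using that by (auto simp: quad_form_def scalar_prod_def atLeast0LessThan sum_distrib_right intro!: sum.cong)
  have "quad_form D A v = (A *\<^sub>v vec D v) \<bullet>c vec D v" if "A \<in> carrier_mat D D" for v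
    unfolding eq[OF that vec_carrier] by (auto simp: quad_form_def intro!: sum.cong)
  then show ?thesis unfolding psd_mat_def using eq by (metis vec_carrier)
qed

lemma psd_mat_carrier: "psd_mat D A \<Longrightarrow> A \<in> carrier_mat D D"
  by (simp add: psd_mat_def)

text \<open>The free index set \<open>I\<close> lets Gram families be combined over product sets, as
  happens for tensor products and ampliations.\<close>

lemma psd_mat_gramI:
  assumes "A \<in> carrier_mat D D"
    and "\<And>i j. i < D \<Longrightarrow> j < D \<Longrightarrow> A $$ (i, j) = (\<Sum>k\<in>I. a k i * cnj (a k j))"
  shows "psd_mat D A"
  unfolding psd_mat_iff
proof (intro conjI allI)
  fix v
  have "quad_form D A v = (\<Sum>i<D. \<Sum>j<D. \<Sum>k\<in>I. a k i * cnj (a k j) * v j * cnj (v i))"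
    unfolding quad_form_def using assms(2) by (intro sum.cong) (auto simp: sum_distrib_right)
  also have "\<dots> = (\<Sum>k\<in>I. \<Sum>i<D. \<Sum>j<D. a k i * cnj (a k j) * v j * cnj (v i))"
    by (simp add: sum.swap[of _ I])
  also have "\<dots> = (\<Sum>k\<in>I. cnj (\<Sum>i<D. cnj (a k i) * v i) * (\<Sum>j<D. cnj (a k j) * v j))"
    by (simp add: sum_product sum_distrib_left mult_ac)
  also have "\<dots> = (\<Sum>k\<in>I. complex_of_real ((cmod (\<Sum>i<D. cnj (a k i) * v i))\<^sup>2))"
    by (simp only: complex_norm_square mult.commute)
  also have "0 \<le> \<dots>"
    by (intro sum_nonneg) (simp add: less_eq_complex_def)
  finally show "0 \<le> quad_form D A v" .
qed (fact assms)

text \<open>Polarisation: the form is real at basis vectors, at \<open>e_i + e_j\<close> and at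
  \<open>e_i + \<i> e_j\<close>, which determines the real and imaginary parts of the opposite
  entry.\<close>

lemma psd_mat_hermitian:
  assumes "psd_mat D A"
  shows "hermitian D A"
  unfolding hermitian_def
proof (intro conjI allI impI)
  fix i j assume ij: "i < D" "j < D"
  have q: "0 \<le> quad_form D A v" for v using assms by (simp add: psd_mat_iff)
  \<comment> \<open>Writing the test vector as a sum of two indicator terms makes the formula valid
    for \<open>i = j\<close> as well.\<close>
  have qf: "quad_form D A (\<lambda>k. (if k = i then a else 0) + (if k = j then b else 0)) =
      A $$ (i, i) * a * cnj a + A $$ (i, j) * b * cnj a + A $$ (j, i) * a * cnj b + A $$ (j, j) * b * cnj b"
    for a b
  proof -
    have *: "cnj ((if k = i then a else 0) + (if k = j then b else 0)) =
       (if k = i then cnj a else 0) + (if k = j then cnj b else 0)" for k by simp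
    have s: "(\<Sum>k<D. f k * ((if k = i then a else 0) + (if k = j then b else 0))) = f i * a + f j * b"
      for f :: "nat \<Rightarrow> complex" and a b
    proof -
      have "(\<Sum>k<D. f k * ((if k = i then a else 0) + (if k = j then b else 0))) =
        (\<Sum>k<D. (if k = i then f i * a else 0)) + (\<Sum>k<D. (if k = j then f j * b else 0))"
        unfolding sum.distrib[symmetric] by (rule sum.cong) (auto simp: distrib_left)
      then show ?thesis using ij by simp
    qed
    show ?thesis
      unfolding quad_form_def * sum_distrib_right[symmetric] s
      by (simp add: distrib_right algebra_simps)
  qed
  have "Im (A $$ (i, i)) = 0" "Im (A $$ (j, j)) = 0"
    using q[of "(\<lambda>k. (if k = i then 1 else 0) + (if k = j then 0 else 0))"]
      q[of "(\<lambda>k. (if k = i then 0 else 0) + (if k = j then 1 else 0))"]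
    unfolding qf by (auto simp: less_eq_complex_def)
  then show "A $$ (j, i) = cnj (A $$ (i, j))"
    using q[of "(\<lambda>k. (if k = i then 1 else 0) + (if k = j then 1 else 0))"]
      q[of "(\<lambda>k. (if k = i then 1 else 0) + (if k = j then \<i> else 0))"]
    unfolding qf by (simp add: less_eq_complex_def complex_eq_iff)
qed (use assms psd_mat_carrier in blast)

lemma psd_mat_spectral:
  assumes "psd_mat D A"
  obtains U d where "unitary_mat D U" "A = spectral_mat D U d" "\<And>k. k < D \<Longrightarrow> 0 \<le> d k"
proof -
  obtain U d where U: "unitary_mat D U" "A = spectral_mat D U d"
    using spectral_theorem[OF psd_mat_hermitian[OF assms]] by blast
  note Uc = unitary_matD(1)[OF U(1)]
  have "0 \<le> d k" if k: "k < D" for k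
  proof -
    \<comment> \<open>Evaluated at the k-th eigenvector, the form returns the eigenvalue
      \<open>d k\<close>.\<close>
    have "0 \<le> quad_form D A (\<lambda>i. U $$ (i, k))" using assms by (simp add: psd_mat_iff)
    also have "quad_form D A (\<lambda>i. U $$ (i, k)) =
      (\<Sum>i<D. \<Sum>j<D. (\<Sum>l<D. U $$ (i, l) * d l * cnj (U $$ (j, l))) * U $$ (j, k) * cnj (U $$ (i, k)))"
      unfolding quad_form_def U(2) by (intro sum.cong refl) (simp add: spectral_mat_index[OF Uc])
    also have "\<dots> = (\<Sum>i<D. \<Sum>l<D. \<Sum>j<D. U $$ (i, l) * d l * cnj (U $$ (j, l)) * U $$ (j, k) * cnj (U $$ (i, k)))"
      unfolding sum_distrib_right by (intro sum.cong refl sum.swap)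
    also have "\<dots> = (\<Sum>l<D. \<Sum>i<D. \<Sum>j<D. U $$ (i, l) * d l * cnj (U $$ (j, l)) * U $$ (j, k) * cnj (U $$ (i, k)))"
      by (rule sum.swap)
    also have "\<dots> = (\<Sum>l<D. d l * (\<Sum>i<D. U $$ (i, l) * cnj (U $$ (i, k))) * (\<Sum>j<D. U $$ (j, k) * cnj (U $$ (j, l))))"
      by (simp add: sum_product sum_distrib_left mult_ac)
    also have "\<dots> = (\<Sum>l<D. if l = k then complex_of_real (d l) else 0)"
      using k unitary_matD(3)[OF U(1)] by (intro sum.cong) auto
    also have "\<dots> = d k" using k by simp
    finally show ?thesis by (simp add: less_eq_complex_def)
  qed
  then show ?thesis using that U by blast
qed

lemma spectral_mat_psd:
  assumes "U \<in> carrier_mat D D" "\<And>k. k < D \<Longrightarrow> 0 \<le> d k"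
  shows "psd_mat D (spectral_mat D U d)"
proof (rule psd_mat_gramI)
  fix i j assume ij: "i < D" "j < D"
  have "U $$ (i, k) * d k * cnj (U $$ (j, k)) =
    complex_of_real (sqrt (d k)) * U $$ (i, k) * cnj (complex_of_real (sqrt (d k)) * U $$ (j, k))"
    if "k < D" for k
  proof -
    have "complex_of_real (d k) = complex_of_real (sqrt (d k)) * complex_of_real (sqrt (d k))"
      using assms(2)[OF that] by (simp flip: of_real_mult)
    then show ?thesis by simp
  qed
  then show "spectral_mat D U d $$ (i, j) = (\<Sum>k<D. complex_of_real (sqrt (d k)) * U $$ (i, k) *
     cnj (complex_of_real (sqrt (d k)) * U $$ (j, k)))"
    unfolding spectral_mat_index[OF assms(1) ij] by (intro sum.cong) auto
qed (use assms in simp)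

lemma psd_mat_gramE:
  assumes "psd_mat D A"
  obtains a where "\<And>i j. i < D \<Longrightarrow> j < D \<Longrightarrow> A $$ (i, j) = (\<Sum>k<D. a k i * cnj (a k j))"
proof -
  obtain U d where U: "unitary_mat D U" "A = spectral_mat D U d" "\<And>k. k < D \<Longrightarrow> 0 \<le> d k"
    using psd_mat_spectral[OF assms] by blast
  note Uc = unitary_matD(1)[OF U(1)]
  have "A $$ (i, j) = (\<Sum>k<D. complex_of_real (sqrt (d k)) * U $$ (i, k) *
     cnj (complex_of_real (sqrt (d k)) * U $$ (j, k)))" if "i < D" "j < D" for i j
    unfolding U(2) spectral_mat_index[OF Uc that]
  proof (intro sum.cong refl)
    fix k assume "k \<in> {..<D}"
    then have "complex_of_real (d k) = complex_of_real (sqrt (d k)) * complex_of_real (sqrt (d k))"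
      using U(3)[of k] by (simp flip: of_real_mult)
    then show "U $$ (i, k) * d k * cnj (U $$ (j, k)) =
        complex_of_real (sqrt (d k)) * U $$ (i, k) * cnj (complex_of_real (sqrt (d k)) * U $$ (j, k))"
      by simp
  qed
  then show ?thesis by (rule that)
qed

lemma psd_mat_add:
  assumes "psd_mat D A" "psd_mat D B"
  shows "psd_mat D (A + B)"
proof -
  have "quad_form D (A + B) v = quad_form D A v + quad_form D B v" for v
    using assms[THEN psd_mat_carrier]
    by (simp add: quad_form_def distrib_right sum.distrib)
  then show ?thesis using assms by (auto simp: psd_mat_iff)
qed

lemma psd_mat_smult:
  assumes "psd_mat D A" "0 \<le> c"
  shows "psd_mat D (complex_of_real c \<cdot>\<^sub>m A)"
proof -
  have "quad_form D (complex_of_real c \<cdot>\<^sub>m A) v = c * quad_form D A v" for v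
    using assms(1)[THEN psd_mat_carrier]
    by (simp add: quad_form_def sum_distrib_left mult_ac)
  then show ?thesis using assms by (auto simp: psd_mat_iff less_eq_complex_def)
qed

lemma psd_mat_one: "psd_mat D (1\<^sub>m D)"
  by (rule psd_mat_gramI[where I = "{..<D}" and a = "\<lambda>k i. if k = i then 1 else 0"])
    (auto simp: if_distrib cong: if_cong)

lemma psd_mat_zero: "psd_mat D (0\<^sub>m D D)"
  by (rule psd_mat_gramI[where I = "{}" and a = "\<lambda>k i. 0"]) auto

section \<open>The trace pairing\<close>

text \<open>This is the trace of the product, kept as a double sum so that bilinearity, symmetry and
  invariance under \<Gamma> are manipulations of finite sums.\<close>

definition trace_pair :: "nat \<Rightarrow> complex mat \<Rightarrow> complex mat \<Rightarrow> complex" where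
  "trace_pair D X Y = (\<Sum>i<D. \<Sum>j<D. X $$ (i, j) * Y $$ (j, i))"

lemma mat_trace_mult:
  assumes "X \<in> carrier_mat D D" "Y \<in> carrier_mat D D"
  shows "mat_trace (X * Y) = trace_pair D X Y"
proof -
  have "mat_trace (X * Y) = (\<Sum>i<D. (X * Y) $$ (i, i))" using assms by (simp add: mat_trace_def)
  also have "\<dots> = (\<Sum>i<D. \<Sum>j<D. X $$ (i, j) * Y $$ (j, i))"
    by (intro sum.cong refl mat_mult_index) (use assms in auto)
  finally show ?thesis by (simp add: trace_pair_def)
qed

lemma trace_pair_commute: "trace_pair D X Y = trace_pair D Y X"
  unfolding trace_pair_def by (subst sum.swap) (simp add: mult.commute)

lemma trace_pair_one_left: "Y \<in> carrier_mat D D \<Longrightarrow> trace_pair D (1\<^sub>m D) Y = mat_trace Y"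
  using mat_trace_mult[of "1\<^sub>m D" D Y] by simp

lemma trace_pair_one_right: "Y \<in> carrier_mat D D \<Longrightarrow> trace_pair D Y (1\<^sub>m D) = mat_trace Y"
  using mat_trace_mult[of Y D "1\<^sub>m D"] by simp

lemma trace_pair_smult_left [simp]:
  "X \<in> carrier_mat D D \<Longrightarrow> trace_pair D (c \<cdot>\<^sub>m X) Y = c * trace_pair D X Y"
  by (simp add: trace_pair_def sum_distrib_left mult_ac)

lemma trace_pair_smult_right [simp]:
  "Y \<in> carrier_mat D D \<Longrightarrow> trace_pair D X (c \<cdot>\<^sub>m Y) = c * trace_pair D X Y"
  by (simp add: trace_pair_def sum_distrib_left mult_ac)

lemma trace_pair_add_left:
  "X \<in> carrier_mat D D \<Longrightarrow> X' \<in> carrier_mat D D \<Longrightarrow>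
    trace_pair D (X + X') Y = trace_pair D X Y + trace_pair D X' Y"
  by (simp add: trace_pair_def distrib_right sum.distrib)

lemma trace_pair_add_right:
  "Y \<in> carrier_mat D D \<Longrightarrow> Y' \<in> carrier_mat D D \<Longrightarrow>
    trace_pair D X (Y + Y') = trace_pair D X Y + trace_pair D X Y'"
  by (simp add: trace_pair_def distrib_left sum.distrib)

lemma trace_pair_diff_left:
  "X \<in> carrier_mat D D \<Longrightarrow> X' \<in> carrier_mat D D \<Longrightarrow>
    trace_pair D (X - X') Y = trace_pair D X Y - trace_pair D X' Y"
  by (simp add: trace_pair_def left_diff_distrib sum_subtractf)

lemma trace_pair_diff_right:
  "Y \<in> carrier_mat D D \<Longrightarrow> Y' \<in> carrier_mat D D \<Longrightarrow>
    trace_pair D X (Y - Y') = trace_pair D X Y - trace_pair D X Y'"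
  by (simp add: trace_pair_def right_diff_distrib sum_subtractf)

lemmas trace_pair_linear =
  trace_pair_add_left trace_pair_add_right trace_pair_diff_left trace_pair_diff_right

text \<open>Inserting Gram vectors of \<open>X\<close> turns the pairing into a sum of values of the
  quadratic form of \<open>Y\<close>.\<close>

lemma trace_pair_nonneg:
  assumes "psd_mat D X" "psd_mat D Y"
  shows "0 \<le> trace_pair D X Y"
proof -
  obtain a where a: "\<And>i j. i < D \<Longrightarrow> j < D \<Longrightarrow> X $$ (i, j) = (\<Sum>k<D. a k i * cnj (a k j))"
    using psd_mat_gramE[OF assms(1)] by blast
  have "trace_pair D X Y = (\<Sum>i<D. \<Sum>j<D. \<Sum>k<D. Y $$ (j, i) * a k i * cnj (a k j))"
    unfolding trace_pair_def by (intro sum.cong refl) (simp add: a sum_distrib_right sum_distrib_left mult_ac)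
  also have "\<dots> = (\<Sum>j<D. \<Sum>k<D. \<Sum>i<D. Y $$ (j, i) * a k i * cnj (a k j))"
    by (subst sum.swap) (intro sum.cong refl sum.swap)
  also have "\<dots> = (\<Sum>k<D. quad_form D Y (a k))"
    unfolding quad_form_def by (rule sum.swap)
  also have "0 \<le> \<dots>" using assms(2) by (intro sum_nonneg) (simp add: psd_mat_iff)
  finally show ?thesis .
qed

lemma trace_pair_nonneg_Re: "psd_mat D X \<Longrightarrow> psd_mat D Y \<Longrightarrow> 0 \<le> Re (trace_pair D X Y)"
  using trace_pair_nonneg by (fastforce simp: less_eq_complex_def)

section \<open>Dominators\<close>

definition dominates :: "nat \<Rightarrow> complex mat \<Rightarrow> complex mat \<Rightarrow> bool" where
  "dominates D A X \<longleftrightarrow> A \<in> carrier_mat D D \<and> X \<in> carrier_mat D D \<and>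
     psd_mat D (A + X) \<and> psd_mat D (A - X)"

lemma dominates_carrier:
  assumes "dominates D A X"
  shows "A \<in> carrier_mat D D" "X \<in> carrier_mat D D"
  using assms by (auto simp: dominates_def)

lemma dominates_psd:
  assumes "dominates D A X"
  shows "psd_mat D A"
proof -
  have "A = complex_of_real (1 / 2) \<cdot>\<^sub>m ((A + X) + (A - X))"
    using dominates_carrier[OF assms] by (intro eq_matI) auto
  moreover have "psd_mat D (complex_of_real (1 / 2) \<cdot>\<^sub>m ((A + X) + (A - X)))"
    using assms psd_mat_add[of D "A + X" "A - X"] by (intro psd_mat_smult) (auto simp: dominates_def)
  ultimately show ?thesis by simp
qed

lemma dominates_smult:
  assumes "dominates D A X" "0 \<le> c"
  shows "dominates D (complex_of_real c \<cdot>\<^sub>m A) (complex_of_real c \<cdot>\<^sub>m X)"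
proof -
  note c = dominates_carrier[OF assms(1)]
  have "complex_of_real c \<cdot>\<^sub>m A + complex_of_real c \<cdot>\<^sub>m X = complex_of_real c \<cdot>\<^sub>m (A + X)"
    "complex_of_real c \<cdot>\<^sub>m A - complex_of_real c \<cdot>\<^sub>m X = complex_of_real c \<cdot>\<^sub>m (A - X)"
    using c by (auto intro!: eq_matI simp: algebra_simps)
  then show ?thesis using assms c by (auto simp: dominates_def intro!: psd_mat_smult)
qed

lemma psd_mat_dominates_self:
  assumes "psd_mat D A"
  shows "dominates D A A"
proof -
  have "A - A = 0\<^sub>m D D" using assms[THEN psd_mat_carrier] by (intro eq_matI) auto
  then show ?thesis
    using assms psd_mat_add[OF assms assms] psd_mat_carrier[OF assms] psd_mat_zero[of D]
    by (simp add: dominates_def)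
qed

text \<open>In each of the two sums of nonnegative pairings the mixed terms cancel, leaving twice
  \<open>tr (A B) - tr (X Z)\<close> and twice \<open>tr (A B) + tr (X Z)\<close>.\<close>

lemma dominates_trace_pair:
  assumes "dominates D A X" "dominates D B Z"
  shows "\<bar>Re (trace_pair D X Z)\<bar> \<le> Re (trace_pair D A B)"
proof -
  note c = dominates_carrier[OF assms(1)] dominates_carrier[OF assms(2)]
  have p: "psd_mat D (A + X)" "psd_mat D (A - X)" "psd_mat D (B + Z)" "psd_mat D (B - Z)"
    using assms by (auto simp: dominates_def)
  have "0 \<le> Re (trace_pair D (A + X) (B - Z)) + Re (trace_pair D (A - X) (B + Z))"
    "0 \<le> Re (trace_pair D (A + X) (B + Z)) + Re (trace_pair D (A - X) (B - Z))"
    using p by (auto intro!: add_nonneg_nonneg trace_pair_nonneg_Re)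
  then show ?thesis using c by (simp add: trace_pair_linear)
qed

section \<open>Regrouped tensor products and partial transposes\<close>

lemma sum_mult_index:
  "(\<Sum>i<m * n. f i) = (\<Sum>a<m. \<Sum>b<n. f (a * n + b :: nat))"
proof -
  have "(\<Sum>i<m * n. f i) = (\<Sum>a<m. sum f {a * n..<a * n + n})"
    by (rule sum.nat_group[symmetric])
  also have "\<dots> = (\<Sum>a<m. \<Sum>b<n. f (a * n + b))"
  proof (rule sum.cong[OF refl])
    fix a
    show "sum f {a * n..<a * n + n} = (\<Sum>b<n. f (a * n + b))"
      using sum.shift_bounds_nat_ivl[of f 0 "a * n" n] by (simp add: atLeast0LessThan add.commute)
  qed
  finally show ?thesis .
qed

lemma mult_index_less:
  assumes "a < m" "b < n"
  shows "a * n + b < m * (n :: nat)"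
proof -
  have "a * n + b < Suc a * n" using assms by simp
  also have "\<dots> \<le> m * n" using assms by (intro mult_le_mono1) simp
  finally show ?thesis .
qed

lemma mult_index_div_mod:
  assumes "b < n"
  shows "(a * n + b) div n = (a :: nat)" "(a * n + b) mod n = b"
  using assms by auto

lemma div_mod_index_less:
  assumes "i < m * (n :: nat)"
  shows "i div n < m" "i mod n < n"
  using assms by (auto simp: less_mult_imp_div_less intro!: mod_less_divisor gr0I)

lemma fst_index_less:
  assumes "i < (dA1 * dA2) * (dB1 * dB2)"
  shows "fst_index dB1 dA2 dB2 i < dA1 * dB1"
  using assms unfolding fst_index_def
  by (intro mult_index_less) (metis div_mod_index_less)+

lemma snd_index_less:
  assumes "i < (dA1 * dA2) * (dB1 * dB2)"
  shows "snd_index dB1 dA2 dB2 i < dA2 * dB2"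
  using assms unfolding snd_index_def
  by (intro mult_index_less) (metis div_mod_index_less)+

text \<open>The regrouped index has the digits a1, a2, b1, b2, the two component indices have the
  digits a1, b1 and a2, b2; only the two middle sums change places.\<close>

lemma sum_fst_snd_index:
  "(\<Sum>i<(dA1 * dA2) * (dB1 * dB2). f (fst_index dB1 dA2 dB2 i) (snd_index dB1 dA2 dB2 i)) =
    (\<Sum>p<dA1 * dB1. \<Sum>q<dA2 * dB2. f p q)" (is "?L = ?R")
proof -
  have "?L = (\<Sum>a1<dA1. \<Sum>a2<dA2. \<Sum>b1<dB1. \<Sum>b2<dB2. f (a1 * dB1 + b1) (a2 * dB2 + b2))"
    unfolding sum_mult_index
  proof (intro sum.cong refl)
    fix a1 a2 b1 b2 assume "a1 \<in> {..<dA1}" "a2 \<in> {..<dA2}" "b1 \<in> {..<dB1}" "b2 \<in> {..<dB2}"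
    then have b: "b1 * dB2 + b2 < dB1 * dB2" "b2 < dB2" "a2 < dA2"
      by (auto intro: mult_index_less)
    note dm = mult_index_div_mod[OF b(1), of "a1 * dA2 + a2"]
    show "f (fst_index dB1 dA2 dB2 ((a1 * dA2 + a2) * (dB1 * dB2) + (b1 * dB2 + b2)))
        (snd_index dB1 dA2 dB2 ((a1 * dA2 + a2) * (dB1 * dB2) + (b1 * dB2 + b2))) =
       f (a1 * dB1 + b1) (a2 * dB2 + b2)"
      unfolding fst_index_def snd_index_def dm using b by simp
  qed
  also have "\<dots> = (\<Sum>a1<dA1. \<Sum>b1<dB1. \<Sum>a2<dA2. \<Sum>b2<dB2. f (a1 * dB1 + b1) (a2 * dB2 + b2))"
    by (intro sum.cong refl sum.swap)
  also have "\<dots> = ?R" by (simp add: sum_mult_index)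
  finally show ?thesis .
qed

lemma bip_tensor_carrier [simp]:
  "bip_tensor dA1 dB1 dA2 dB2 M N \<in> carrier_mat ((dA1 * dA2) * (dB1 * dB2)) ((dA1 * dA2) * (dB1 * dB2))"
  by (simp add: bip_tensor_def)

lemma bip_tensor_index:
  "i < (dA1 * dA2) * (dB1 * dB2) \<Longrightarrow> j < (dA1 * dA2) * (dB1 * dB2) \<Longrightarrow>
   bip_tensor dA1 dB1 dA2 dB2 M N $$ (i, j) =
     M $$ (fst_index dB1 dA2 dB2 i, fst_index dB1 dA2 dB2 j) *
     N $$ (snd_index dB1 dA2 dB2 i, snd_index dB1 dA2 dB2 j)"
  by (simp add: bip_tensor_def)

lemma bip_tensor_psd:
  assumes "psd_mat (dA1 * dB1) M" "psd_mat (dA2 * dB2) N"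
  shows "psd_mat ((dA1 * dA2) * (dB1 * dB2)) (bip_tensor dA1 dB1 dA2 dB2 M N)"
proof -
  let ?D1 = "dA1 * dB1" and ?D2 = "dA2 * dB2"
  obtain a where a: "\<And>i j. i < ?D1 \<Longrightarrow> j < ?D1 \<Longrightarrow> M $$ (i, j) = (\<Sum>k<?D1. a k i * cnj (a k j))"
    using psd_mat_gramE[OF assms(1)] by blast
  obtain b where b: "\<And>i j. i < ?D2 \<Longrightarrow> j < ?D2 \<Longrightarrow> N $$ (i, j) = (\<Sum>k<?D2. b k i * cnj (b k j))"
    using psd_mat_gramE[OF assms(2)] by blast
  let ?f = "fst_index dB1 dA2 dB2" and ?s = "snd_index dB1 dA2 dB2"
  show ?thesis
  proof (rule psd_mat_gramI[where I = "{..<?D1} \<times> {..<?D2}" and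
        a = "\<lambda>(k, l) i. a k (?f i) * b l (?s i)"])
    fix i j assume ij: "i < (dA1 * dA2) * (dB1 * dB2)" "j < (dA1 * dA2) * (dB1 * dB2)"
    show "bip_tensor dA1 dB1 dA2 dB2 M N $$ (i, j) = (\<Sum>k\<in>{..<?D1} \<times> {..<?D2}.
       (case k of (k, l) \<Rightarrow> \<lambda>i. a k (?f i) * b l (?s i)) i *
       cnj ((case k of (k, l) \<Rightarrow> \<lambda>i. a k (?f i) * b l (?s i)) j))"
      unfolding bip_tensor_index[OF ij]
      using ij by (simp add: a b fst_index_less snd_index_less sum_product flip: sum.cartesian_product')
        (simp add: sum.cartesian_product case_prod_beta mult_ac)
  qed simp
qed

text \<open>Twice \<open>A \<otimes> B \<plusminus> X \<otimes> Y\<close> is \<open>(A + X)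
  \<otimes> (B \<plusminus> Y) + (A - X) \<otimes> (B \<mp> Y)\<close>, a sum of tensor products of
  positive operators.\<close>

lemma bip_tensor_dominates:
  assumes "dominates (dA1 * dB1) A X" "dominates (dA2 * dB2) B Y"
  shows "dominates ((dA1 * dA2) * (dB1 * dB2)) (bip_tensor dA1 dB1 dA2 dB2 A B) (bip_tensor dA1 dB1 dA2 dB2 X Y)"
proof -
  let ?T = "bip_tensor dA1 dB1 dA2 dB2" and ?D = "(dA1 * dA2) * (dB1 * dB2)"
  let ?f = "fst_index dB1 dA2 dB2" and ?s = "snd_index dB1 dA2 dB2"
  note c = dominates_carrier[OF assms(1)] dominates_carrier[OF assms(2)]
  have ix: "?T A B $$ (i, j) = A $$ (?f i, ?f j) * B $$ (?s i, ?s j)"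
    "?T X Y $$ (i, j) = X $$ (?f i, ?f j) * Y $$ (?s i, ?s j)"
    "?T (A + X) (B + Y) $$ (i, j) = (A $$ (?f i, ?f j) + X $$ (?f i, ?f j)) * (B $$ (?s i, ?s j) + Y $$ (?s i, ?s j))"
    "?T (A + X) (B - Y) $$ (i, j) = (A $$ (?f i, ?f j) + X $$ (?f i, ?f j)) * (B $$ (?s i, ?s j) - Y $$ (?s i, ?s j))"
    "?T (A - X) (B + Y) $$ (i, j) = (A $$ (?f i, ?f j) - X $$ (?f i, ?f j)) * (B $$ (?s i, ?s j) + Y $$ (?s i, ?s j))"
    "?T (A - X) (B - Y) $$ (i, j) = (A $$ (?f i, ?f j) - X $$ (?f i, ?f j)) * (B $$ (?s i, ?s j) - Y $$ (?s i, ?s j))"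
    if ij: "i < ?D" "j < ?D" for i j
    unfolding bip_tensor_index[OF ij]
    using c fst_index_less[OF ij(1)] fst_index_less[OF ij(2)] snd_index_less[OF ij(1)] snd_index_less[OF ij(2)]
    by auto
  have dim: "dim_row (?T P Q) = ?D" "dim_col (?T P Q) = ?D" for P Q
    by (simp_all add: bip_tensor_def)
  have eq: "?T A B + ?T X Y = complex_of_real (1 / 2) \<cdot>\<^sub>m (?T (A + X) (B + Y) + ?T (A - X) (B - Y))"
    "?T A B - ?T X Y = complex_of_real (1 / 2) \<cdot>\<^sub>m (?T (A + X) (B - Y) + ?T (A - X) (B + Y))"
    by - (rule eq_matI; simp add: dim ix; simp add: field_simps)+
  have p: "psd_mat ?D (?T (A + X) (B + Y))" "psd_mat ?D (?T (A - X) (B - Y))"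
    "psd_mat ?D (?T (A + X) (B - Y))" "psd_mat ?D (?T (A - X) (B + Y))"
    using assms by (auto simp: dominates_def intro!: bip_tensor_psd)
  show ?thesis
    unfolding dominates_def eq using p by (intro conjI psd_mat_smult psd_mat_add bip_tensor_carrier) auto
qed

lemma trace_pair_bip_tensor:
  assumes "M \<in> carrier_mat (dA1 * dB1) (dA1 * dB1)" "N \<in> carrier_mat (dA2 * dB2) (dA2 * dB2)"
  shows "trace_pair ((dA1 * dA2) * (dB1 * dB2)) (bip_tensor dA1 dB1 dA2 dB2 M N) (bip_tensor dA1 dB1 dA2 dB2 M' N') =
    trace_pair (dA1 * dB1) M M' * trace_pair (dA2 * dB2) N N'"
proof -
  let ?f = "fst_index dB1 dA2 dB2" and ?s = "snd_index dB1 dA2 dB2"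
  let ?D = "(dA1 * dA2) * (dB1 * dB2)" and ?D1 = "dA1 * dB1" and ?D2 = "dA2 * dB2"
  define g where "g p q p' q' = M $$ (p, p') * N $$ (q, q') * (M' $$ (p', p) * N' $$ (q', q))" for p q p' q'
  have "trace_pair ?D (bip_tensor dA1 dB1 dA2 dB2 M N) (bip_tensor dA1 dB1 dA2 dB2 M' N') =
      (\<Sum>i<?D. \<Sum>j<?D. g (?f i) (?s i) (?f j) (?s j))"
    unfolding trace_pair_def by (intro sum.cong refl) (simp add: bip_tensor_index g_def)
  also have "\<dots> = (\<Sum>i<?D. \<Sum>p'<?D1. \<Sum>q'<?D2. g (?f i) (?s i) p' q')"
    by (intro sum.cong refl sum_fst_snd_index)
  also have "\<dots> = (\<Sum>p<?D1. \<Sum>q<?D2. \<Sum>p'<?D1. \<Sum>q'<?D2. g p q p' q')"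
    by (rule sum_fst_snd_index)
  also have "\<dots> = (\<Sum>p<?D1. \<Sum>p'<?D1. \<Sum>q<?D2. \<Sum>q'<?D2. g p q p' q')"
    by (intro sum.cong refl sum.swap)
  also have "\<dots> = (\<Sum>p<?D1. \<Sum>p'<?D1. (M $$ (p, p') * M' $$ (p', p)) * trace_pair ?D2 N N')"
    unfolding g_def trace_pair_def sum_distrib_left by (intro sum.cong refl) (simp add: mult_ac)
  also have "\<dots> = trace_pair ?D1 M M' * trace_pair ?D2 N N'"
    by (simp only: trace_pair_def sum_distrib_right)
  finally show ?thesis .
qed

section \<open>Partial transposition\<close>

lemma partial_transpose_carrier [simp]:
  "partial_transpose dA dB X \<in> carrier_mat (dA * dB) (dA * dB)"
  by (simp add: partial_transpose_def)

lemma partial_transpose_dim [simp]: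
  "dim_row (partial_transpose dA dB X) = dA * dB" "dim_col (partial_transpose dA dB X) = dA * dB"
  by (simp_all add: partial_transpose_def)

lemma partial_transpose_index:
  "i < dA * dB \<Longrightarrow> j < dA * dB \<Longrightarrow> partial_transpose dA dB X $$ (i, j) =
    X $$ ((i div dB) * dB + j mod dB, (j div dB) * dB + i mod dB)"
  by (simp add: partial_transpose_def)

lemma partial_transpose_index_less:
  assumes "i < dA * dB" "j < dA * dB"
  shows "i div dB * dB + j mod dB < dA * (dB :: nat)"
  by (intro mult_index_less) (use assms div_mod_index_less in auto)

lemma partial_transpose_partial_transpose:
  assumes "X \<in> carrier_mat (dA * dB) (dA * dB)"
  shows "partial_transpose dA dB (partial_transpose dA dB X) = X"
proof (rule eq_matI)
  fix i j assume "i < dim_row X" "j < dim_col X"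
  then have ij: "i < dA * dB" "j < dA * dB" using assms by auto
  then have "dB > 0" by (metis mult_0_right not_gr_zero not_less_zero)
  then show "partial_transpose dA dB (partial_transpose dA dB X) $$ (i, j) = X $$ (i, j)"
    using ij by (simp add: partial_transpose_index partial_transpose_index_less)
qed (use assms in auto)

lemma partial_transpose_add:
  assumes "X \<in> carrier_mat (dA * dB) (dA * dB)" "Y \<in> carrier_mat (dA * dB) (dA * dB)"
  shows "partial_transpose dA dB (X + Y) = partial_transpose dA dB X + partial_transpose dA dB Y"
  using assms by (intro eq_matI) (auto simp: partial_transpose_index partial_transpose_index_less)

lemma partial_transpose_diff:
  assumes "X \<in> carrier_mat (dA * dB) (dA * dB)" "Y \<in> carrier_mat (dA * dB) (dA * dB)"
  shows "partial_transpose dA dB (X - Y) = partial_transpose dA dB X - partial_transpose dA dB Y"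
  using assms by (intro eq_matI) (auto simp: partial_transpose_index partial_transpose_index_less)

lemma partial_transpose_smult:
  assumes "X \<in> carrier_mat (dA * dB) (dA * dB)"
  shows "partial_transpose dA dB (c \<cdot>\<^sub>m X) = c \<cdot>\<^sub>m partial_transpose dA dB X"
  using assms by (intro eq_matI) (auto simp: partial_transpose_index partial_transpose_index_less)

lemma partial_transpose_one: "partial_transpose dA dB (1\<^sub>m (dA * dB)) = 1\<^sub>m (dA * dB)"
proof (rule eq_matI)
  fix i j assume "i < dim_row (1\<^sub>m (dA * dB) :: complex mat)" "j < dim_col (1\<^sub>m (dA * dB) :: complex mat)"
  then have ij: "i < dA * dB" "j < dA * dB" by auto
  then have d: "dB > 0" by (metis mult_0_right not_gr_zero not_less_zero)
  have "i div dB * dB + j mod dB = j div dB * dB + i mod dB \<longleftrightarrow> i = j"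
  proof
    assume eq: "i div dB * dB + j mod dB = j div dB * dB + i mod dB"
    have "i div dB = j div dB"
      using arg_cong[OF eq, of "\<lambda>x. x div dB"] d by simp
    moreover from this have "j mod dB = i mod dB" using eq by (simp only: add_left_cancel)
    ultimately show "i = j" by (metis div_mult_mod_eq)
  qed simp
  then show "partial_transpose dA dB (1\<^sub>m (dA * dB)) $$ (i, j) = 1\<^sub>m (dA * dB) $$ (i, j)"
    using ij by (simp add: partial_transpose_index partial_transpose_index_less)
qed auto

text \<open>Both factors exchange the same two digits of Bob, so renaming his two summation indices
  undoes the transposition.\<close>

lemma trace_pair_partial_transpose:
  "trace_pair (dA * dB) (partial_transpose dA dB X) (partial_transpose dA dB Y) = trace_pair (dA * dB) X Y"
proof -
  define g where "g a b c d = X $$ (a * dB + d, c * dB + b) * Y $$ (c * dB + b, a * dB + d)" for a b c d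
  have "trace_pair (dA * dB) (partial_transpose dA dB X) (partial_transpose dA dB Y) =
      (\<Sum>a<dA. \<Sum>b<dB. \<Sum>c<dA. \<Sum>d<dB. g a b c d)"
    unfolding trace_pair_def sum_mult_index
    by (intro sum.cong refl) (simp add: partial_transpose_index mult_index_less g_def)
  also have "\<dots> = (\<Sum>a<dA. \<Sum>b<dB. \<Sum>d<dB. \<Sum>c<dA. g a b c d)"
    by (intro sum.cong refl sum.swap)
  also have "\<dots> = (\<Sum>a<dA. \<Sum>d<dB. \<Sum>b<dB. \<Sum>c<dA. g a b c d)"
    by (intro sum.cong refl sum.swap)
  also have "\<dots> = (\<Sum>a<dA. \<Sum>d<dB. \<Sum>c<dA. \<Sum>b<dB. g a b c d)"
    by (intro sum.cong refl sum.swap)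
  also have "\<dots> = trace_pair (dA * dB) X Y"
    unfolding trace_pair_def sum_mult_index g_def ..
  finally show ?thesis .
qed

lemma mat_trace_partial_transpose:
  assumes "X \<in> carrier_mat (dA * dB) (dA * dB)"
  shows "mat_trace (partial_transpose dA dB X) = mat_trace X"
  using trace_pair_partial_transpose[of dA dB "1\<^sub>m (dA * dB)" X] assms
  by (simp add: partial_transpose_one trace_pair_one_left)

lemma trace_pair_partial_transpose_swap:
  assumes "X \<in> carrier_mat (dA * dB) (dA * dB)"
  shows "trace_pair (dA * dB) X (partial_transpose dA dB Y) = trace_pair (dA * dB) (partial_transpose dA dB X) Y"
  using trace_pair_partial_transpose[of dA dB "partial_transpose dA dB X" Y] assms
  by (simp add: partial_transpose_partial_transpose)

text \<open>Regrouping keeps Alice's digits apart from Bob's, so exchanging all of Bob's digits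
  exchanges those of each factor; \<open>key\<close> is this fact in index arithmetic.\<close>

lemma partial_transpose_bip_tensor:
  "partial_transpose (dA1 * dA2) (dB1 * dB2) (bip_tensor dA1 dB1 dA2 dB2 M N) =
    bip_tensor dA1 dB1 dA2 dB2 (partial_transpose dA1 dB1 M) (partial_transpose dA2 dB2 N)"
proof (rule eq_matI)
  let ?f = "fst_index dB1 dA2 dB2" and ?s = "snd_index dB1 dA2 dB2" and ?n = "dB1 * dB2"
  let ?D = "(dA1 * dA2) * (dB1 * dB2)"
  fix i j
  assume "i < dim_row (bip_tensor dA1 dB1 dA2 dB2 (partial_transpose dA1 dB1 M) (partial_transpose dA2 dB2 N))"
    "j < dim_col (bip_tensor dA1 dB1 dA2 dB2 (partial_transpose dA1 dB1 M) (partial_transpose dA2 dB2 N))"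
  then have ij: "i < ?D" "j < ?D" by (auto simp: bip_tensor_def)
  have key: "?f (i div ?n * ?n + j mod ?n) = ?f i div dB1 * dB1 + ?f j mod dB1 \<and>
     ?s (i div ?n * ?n + j mod ?n) = ?s i div dB2 * dB2 + ?s j mod dB2"
    if "i < ?D" "j < ?D" for i j
  proof -
    have n: "?n > 0" using that(1) by (metis mult_0_right not_gr_zero not_less_zero)
    have "i mod ?n div dB2 < dB1" "j mod ?n div dB2 < dB1"
      using n by (metis div_mod_index_less(1) mod_less_divisor)+
    moreover have "i mod ?n mod dB2 < dB2" "j mod ?n mod dB2 < dB2"
      using n by auto
    ultimately show ?thesis using n by (simp add: fst_index_def snd_index_def)
  qed
  note l = fst_index_less[OF ij(1)] fst_index_less[OF ij(2)] snd_index_less[OF ij(1)] snd_index_less[OF ij(2)]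
  show "partial_transpose (dA1 * dA2) (dB1 * dB2) (bip_tensor dA1 dB1 dA2 dB2 M N) $$ (i, j) =
    bip_tensor dA1 dB1 dA2 dB2 (partial_transpose dA1 dB1 M) (partial_transpose dA2 dB2 N) $$ (i, j)"
    using key[OF ij] key[OF ij(2) ij(1)]
    by (simp add: partial_transpose_index[OF ij] bip_tensor_index ij partial_transpose_index_less
      partial_transpose_index l)
qed (auto simp: bip_tensor_def)

section \<open>Tensor powers\<close>

lemma bip_power_carrier [simp]:
  "bip_power dA dB M n \<in> carrier_mat (dA ^ n * dB ^ n) (dA ^ n * dB ^ n)"
  by (cases n) (auto simp: mult_ac intro!: carrier_matI, simp_all add: bip_tensor_def mult_ac)

lemma bip_power_dim [simp]:
  "dim_row (bip_power dA dB M n) = dA ^ n * dB ^ n" "dim_col (bip_power dA dB M n) = dA ^ n * dB ^ n"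
  using bip_power_carrier[of dA dB M n] by (auto simp del: bip_power_carrier)

lemma bip_power_dominates:
  assumes "dominates (dA * dB) A X"
  shows "dominates (dA ^ n * dB ^ n) (bip_power dA dB A n) (bip_power dA dB X n)"
proof (induction n)
  case 0
  then show ?case using psd_mat_dominates_self[OF psd_mat_one, of 1] by simp
next
  case (Suc n)
  show ?case using bip_tensor_dominates[OF assms Suc] by simp
qed

lemma bip_power_psd: "psd_mat (dA * dB) A \<Longrightarrow> psd_mat (dA ^ n * dB ^ n) (bip_power dA dB A n)"
  using bip_power_dominates[OF psd_mat_dominates_self] dominates_psd by blast

lemma trace_pair_bip_power:
  assumes "M \<in> carrier_mat (dA * dB) (dA * dB)"
  shows "trace_pair (dA ^ n * dB ^ n) (bip_power dA dB M n) (bip_power dA dB N n) = trace_pair (dA * dB) M N ^ n"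
proof (induction n)
  case 0
  then show ?case by (simp add: trace_pair_def)
next
  case (Suc n)
  then show ?case using trace_pair_bip_tensor[OF assms bip_power_carrier, where M' = N and N' = "bip_power dA dB N n"] by simp
qed

lemma partial_transpose_bip_power:
  "partial_transpose (dA ^ n) (dB ^ n) (bip_power dA dB M n) = bip_power dA dB (partial_transpose dA dB M) n"
proof (induction n)
  case 0
  then show ?case using partial_transpose_one[of 1 1] by simp
next
  case (Suc n)
  then show ?case using partial_transpose_bip_tensor[of dA "dA ^ n" dB "dB ^ n" M] by simp
qed

lemma bip_power_smult:
  assumes "M \<in> carrier_mat (dA * dB) (dA * dB)"
  shows "bip_power dA dB (c \<cdot>\<^sub>m M) n = c ^ n \<cdot>\<^sub>m bip_power dA dB M n"
proof (induction n)
  case 0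
  then show ?case by (auto intro: eq_matI)
next
  case (Suc n)
  have d: "fst_index dB (dA ^ n) (dB ^ n) i < dim_row M" "snd_index dB (dA ^ n) (dB ^ n) i < dA ^ n * dB ^ n"
    "fst_index dB (dA ^ n) (dB ^ n) i < dim_col M"
    if "i < dA * dA ^ n * (dB * dB ^ n)" for i
    using that assms by (auto simp: fst_index_less snd_index_less)
  show ?case
    by (rule eq_matI) (auto simp: Suc bip_tensor_def d mult_ac)
qed

lemma bip_tensor_one:
  "bip_tensor dA1 dB1 dA2 dB2 (1\<^sub>m (dA1 * dB1)) (1\<^sub>m (dA2 * dB2)) = 1\<^sub>m ((dA1 * dA2) * (dB1 * dB2))"
proof (rule eq_matI)
  let ?f = "fst_index dB1 dA2 dB2" and ?s = "snd_index dB1 dA2 dB2" and ?n = "dB1 * dB2"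
  let ?D = "(dA1 * dA2) * (dB1 * dB2)"
  fix i j assume "i < dim_row (1\<^sub>m ?D :: complex mat)" "j < dim_col (1\<^sub>m ?D :: complex mat)"
  then have ij: "i < ?D" "j < ?D" by auto
  \<comment> \<open>An index can be reassembled from its two component indices, so the two unit
    matrices detect equality of the full indices.\<close>
  have rec: "i = (?f i div dB1 * dA2 + ?s i div dB2) * ?n + (?f i mod dB1 * dB2 + ?s i mod dB2)"
    if "i < ?D" for i
  proof -
    have n: "?n > 0" using that by (metis mult_0_right not_gr_zero not_less_zero)
    have "i mod ?n div dB2 < dB1" using n by (metis div_mod_index_less(1) mod_less_divisor)
    moreover have "i mod ?n mod dB2 < dB2" using n by auto
    ultimately have "?f i div dB1 = i div ?n div dA2" "?s i div dB2 = i div ?n mod dA2"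
      "?f i mod dB1 = i mod ?n div dB2" "?s i mod dB2 = i mod ?n mod dB2"
      by (simp_all add: fst_index_def snd_index_def)
    then show ?thesis by (simp only: div_mult_mod_eq)
  qed
  have "?f i = ?f j \<and> ?s i = ?s j \<longleftrightarrow> i = j" using rec[OF ij(1)] rec[OF ij(2)] by metis
  then show "bip_tensor dA1 dB1 dA2 dB2 (1\<^sub>m (dA1 * dB1)) (1\<^sub>m (dA2 * dB2)) $$ (i, j) = 1\<^sub>m ?D $$ (i, j)"
    using ij by (auto simp: bip_tensor_index fst_index_less snd_index_less)
qed (auto simp: bip_tensor_def)

lemma bip_power_one: "bip_power dA dB (1\<^sub>m (dA * dB)) n = 1\<^sub>m (dA ^ n * dB ^ n)"
  by (induction n) (auto simp: bip_tensor_one)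

lemma mat_trace_bip_power:
  assumes "M \<in> carrier_mat (dA * dB) (dA * dB)"
  shows "mat_trace (bip_power dA dB M n) = mat_trace M ^ n"
  using trace_pair_bip_power[of "1\<^sub>m (dA * dB)" dA dB n M] assms
  by (simp add: bip_power_one trace_pair_one_left)

section \<open>Functional calculus and the trace norm\<close>

lemma spectral_mat_dim [simp]:
  "dim_row (spectral_mat D U d) = dim_row U" "dim_col (spectral_mat D U d) = dim_row U"
  by (simp_all add: spectral_mat_def)

lemma spectral_mat_cong:
  assumes "U \<in> carrier_mat D D" "\<And>k. k < D \<Longrightarrow> d k = e k"
  shows "spectral_mat D U d = spectral_mat D U e"
proof (rule eq_matI)
  fix i j assume "i < dim_row (spectral_mat D U e)" "j < dim_col (spectral_mat D U e)"
  then have "i < D" "j < D" using spectral_mat_carrier[OF assms(1), of e] by auto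
  then show "spectral_mat D U d $$ (i, j) = spectral_mat D U e $$ (i, j)"
    using assms by (auto simp: spectral_mat_index intro!: sum.cong)
qed (use assms in \<open>auto simp: spectral_mat_def\<close>)

lemma spectral_mat_add:
  assumes "U \<in> carrier_mat D D"
  shows "spectral_mat D U d + spectral_mat D U e = spectral_mat D U (\<lambda>k. d k + e k)"
proof (rule eq_matI)
  fix i j assume "i < dim_row (spectral_mat D U (\<lambda>k. d k + e k))" "j < dim_col (spectral_mat D U (\<lambda>k. d k + e k))"
  then have "i < D" "j < D" using assms(1) by auto
  then show "(spectral_mat D U d + spectral_mat D U e) $$ (i, j) = spectral_mat D U (\<lambda>k. d k + e k) $$ (i, j)"
    using assms spectral_mat_carrier[OF assms(1), of d] spectral_mat_carrier[OF assms(1), of e]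
    by (simp add: spectral_mat_index sum.distrib ring_distribs)
qed (use assms in \<open>auto simp: spectral_mat_def\<close>)

lemma spectral_mat_smult:
  assumes "U \<in> carrier_mat D D"
  shows "complex_of_real c \<cdot>\<^sub>m spectral_mat D U d = spectral_mat D U (\<lambda>k. c * d k)"
proof (rule eq_matI)
  fix i j assume "i < dim_row (spectral_mat D U (\<lambda>k. c * d k))" "j < dim_col (spectral_mat D U (\<lambda>k. c * d k))"
  then have "i < D" "j < D" using assms(1) by auto
  then show "(complex_of_real c \<cdot>\<^sub>m spectral_mat D U d) $$ (i, j) = spectral_mat D U (\<lambda>k. c * d k) $$ (i, j)"
    using assms spectral_mat_carrier[OF assms(1), of d]
    by (simp add: spectral_mat_index sum_distrib_left mult_ac)
qed (use assms in \<open>auto simp: spectral_mat_def\<close>)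

lemma spectral_mat_diff:
  assumes "U \<in> carrier_mat D D"
  shows "spectral_mat D U d - spectral_mat D U e = spectral_mat D U (\<lambda>k. d k - e k)"
proof (rule eq_matI)
  fix i j assume "i < dim_row (spectral_mat D U (\<lambda>k. d k - e k))" "j < dim_col (spectral_mat D U (\<lambda>k. d k - e k))"
  then have "i < D" "j < D" using assms(1) by auto
  then show "(spectral_mat D U d - spectral_mat D U e) $$ (i, j) = spectral_mat D U (\<lambda>k. d k - e k) $$ (i, j)"
    using assms spectral_mat_carrier[OF assms(1), of d] spectral_mat_carrier[OF assms(1), of e]
    by (simp add: spectral_mat_index sum_subtractf ring_distribs)
qed (use assms in \<open>auto simp: spectral_mat_def\<close>)

lemma spectral_mat_one:
  assumes "unitary_mat D U"
  shows "spectral_mat D U (\<lambda>_. 1) = 1\<^sub>m D"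
proof -
  have "U * 1\<^sub>m D = U" using unitary_matD(1)[OF assms] by simp
  then show ?thesis using assms by (simp add: spectral_mat_def unitary_mat_def)
qed

lemma spectral_mat_hermitian:
  assumes "U \<in> carrier_mat D D"
  shows "hermitian D (spectral_mat D U d)"
  unfolding hermitian_def
proof (intro conjI allI impI)
  fix i j assume "i < D" "j < D"
  then show "spectral_mat D U d $$ (j, i) = cnj (spectral_mat D U d $$ (i, j))"
    using assms by (simp add: spectral_mat_index mult_ac)
qed (use assms in simp)

lemma spectral_mat_intertwine:
  assumes "unitary_mat D U"
  shows "spectral_mat D U d * U = U * mat_diag D (\<lambda>k. complex_of_real (d k))"
    and "mat_adjoint U * spectral_mat D U d = mat_diag D (\<lambda>k. complex_of_real (d k)) * mat_adjoint U"
proof -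
  let ?\<Delta> = "mat_diag D (\<lambda>k. complex_of_real (d k))"
  note Uc = unitary_matD(1)[OF assms]
  have UU: "mat_adjoint U * U = 1\<^sub>m D" using assms by (simp add: unitary_mat_def)
  note c = Uc mat_adjoint_carrier[OF Uc] mat_diag_dim[of D "\<lambda>k. complex_of_real (d k)"]
  have "spectral_mat D U d * U = U * ?\<Delta> * (mat_adjoint U * U)"
    unfolding spectral_mat_def by (rule assoc_mult_mat[of _ D D _ D _ D]) (use c in auto)
  then show "spectral_mat D U d * U = U * ?\<Delta>"
    unfolding UU using right_mult_one_mat[of "U * ?\<Delta>" D D] c by (simp only: mult_carrier_mat)
  have "mat_adjoint U * spectral_mat D U d = mat_adjoint U * (U * (?\<Delta> * mat_adjoint U))"
    unfolding spectral_mat_def by (simp only: assoc_mult_mat[OF c(1,3,2)])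
  also have "\<dots> = mat_adjoint U * U * (?\<Delta> * mat_adjoint U)"
    by (rule assoc_mult_mat[symmetric, OF c(2,1) mult_carrier_mat[OF c(3,2)]])
  also have "\<dots> = ?\<Delta> * mat_adjoint U"
    unfolding UU by (intro left_mult_one_mat[of _ D D] mult_carrier_mat[of _ D D] c)
  finally show "mat_adjoint U * spectral_mat D U d = ?\<Delta> * mat_adjoint U" .
qed

lemma spectral_mat_mult:
  assumes "unitary_mat D U"
  shows "spectral_mat D U d * spectral_mat D U e = spectral_mat D U (\<lambda>k. d k * e k)"
proof -
  let ?\<Delta> = "\<lambda>d. mat_diag D (\<lambda>k. complex_of_real (d k))"
  note Uc = unitary_matD(1)[OF assms]
  note c = Uc mat_adjoint_carrier[OF Uc] mat_diag_dim[of D "\<lambda>k. complex_of_real (d k)"]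
     mat_diag_dim[of D "\<lambda>k. complex_of_real (e k)"]
  have "spectral_mat D U d * spectral_mat D U e = U * ?\<Delta> d * (mat_adjoint U * spectral_mat D U e)"
    unfolding spectral_mat_def[of D U d]
    by (rule assoc_mult_mat[of _ D D _ D _ D]) (use c in auto)
  also have "\<dots> = U * ?\<Delta> d * (?\<Delta> e * mat_adjoint U)"
    by (simp only: spectral_mat_intertwine(2)[OF assms])
  also have "\<dots> = U * ?\<Delta> d * ?\<Delta> e * mat_adjoint U"
    by (rule assoc_mult_mat[symmetric, OF mult_carrier_mat[OF c(1,3)] c(4,2)])
  also have "U * ?\<Delta> d * ?\<Delta> e = U * (?\<Delta> d * ?\<Delta> e)"
    by (rule assoc_mult_mat[of _ D D _ D _ D]) (use c in auto)
  finally show ?thesis by (simp add: spectral_mat_def)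
qed

lemma mat_trace_spectral_mat:
  assumes "unitary_mat D U"
  shows "mat_trace (spectral_mat D U d) = (\<Sum>k<D. complex_of_real (d k))"
proof -
  note Uc = unitary_matD(1)[OF assms]
  have "mat_trace (spectral_mat D U d) = (\<Sum>i<D. \<Sum>k<D. d k * (U $$ (i, k) * cnj (U $$ (i, k))))"
    unfolding mat_trace_def using Uc spectral_mat_carrier[OF Uc, of d]
    by (auto simp: spectral_mat_index mult_ac intro!: sum.cong)
  also have "\<dots> = (\<Sum>k<D. d k * (\<Sum>i<D. U $$ (i, k) * cnj (U $$ (i, k))))"
    by (subst sum.swap) (simp add: sum_distrib_left)
  also have "\<dots> = (\<Sum>k<D. complex_of_real (d k))"
    using unitary_matD(3)[OF assms] by (intro sum.cong) auto
  finally show ?thesis .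
qed

lemma trace_pair_spectral_mat:
  assumes "unitary_mat D U"
  shows "trace_pair D (spectral_mat D U d) (spectral_mat D U e) = (\<Sum>k<D. complex_of_real (d k * e k))"
  using mat_trace_mult[of "spectral_mat D U d" D "spectral_mat D U e"] unitary_matD(1)[OF assms]
  by (simp add: spectral_mat_mult[OF assms] mat_trace_spectral_mat[OF assms])

lemma spectral_mat_inject:
  assumes "unitary_mat D U" "spectral_mat D U d = spectral_mat D U e" "k < D"
  shows "d k = e k"
proof -
  have "(\<Sum>l<D. complex_of_real (d l * (if l = k then 1 else 0))) =
        (\<Sum>l<D. complex_of_real (e l * (if l = k then 1 else 0)))"
    unfolding trace_pair_spectral_mat[OF assms(1), symmetric] assms(2) ..
  then show ?thesis using assms(3) by (simp add: if_distrib cong: if_cong)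
qed

text \<open>The change of eigenbasis \<open>W\<close> intertwines the two diagonals, so its nonzero
  entries join only equal eigenvalues, and it also intertwines their images under \<open>f\<close>.
  This makes the \<open>THE\<close> in \<open>hermitian_fun\<close> well defined.\<close>

lemma spectral_mat_fun_unique:
  assumes U: "unitary_mat D U" and V: "unitary_mat D V"
    and eq: "spectral_mat D U d = spectral_mat D V e"
  shows "spectral_mat D U (\<lambda>k. f (d k)) = spectral_mat D V (\<lambda>k. f (e k))"
proof -
  let ?\<Delta> = "\<lambda>d. mat_diag D (\<lambda>k. complex_of_real (d k))"
  note Uc = unitary_matD(1)[OF U] and Vc = unitary_matD(1)[OF V]
  note Va = mat_adjoint_carrier[OF Vc] and Ua = mat_adjoint_carrier[OF Uc]
  note A = spectral_mat_carrier[OF Uc, of d]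
  have \<Delta>: "?\<Delta> d \<in> carrier_mat D D" for d by simp
  define W where "W = mat_adjoint V * U"
  have Wc: "W \<in> carrier_mat D D" using Uc Va by (simp add: W_def)
  have "W * ?\<Delta> d = mat_adjoint V * (spectral_mat D U d * U)"
    unfolding W_def spectral_mat_intertwine(1)[OF U] by (rule assoc_mult_mat[OF Va Uc \<Delta>])
  also have "\<dots> = mat_adjoint V * spectral_mat D U d * U"
    by (rule assoc_mult_mat[symmetric, OF Va A Uc])
  also have "\<dots> = ?\<Delta> e * mat_adjoint V * U"
    unfolding eq spectral_mat_intertwine(2)[OF V] ..
  also have "\<dots> = ?\<Delta> e * W"
    unfolding W_def by (rule assoc_mult_mat[OF \<Delta> Va Uc])
  finally have W: "mat D D (\<lambda>(i, j). W $$ (i, j) * complex_of_real (d j)) =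
      mat D D (\<lambda>(i, j). complex_of_real (e i) * W $$ (i, j))"
    unfolding mat_diag_mult_left[OF Wc] mat_diag_mult_right[OF Wc] .
  have "W $$ (i, j) * complex_of_real (f (d j)) = complex_of_real (f (e i)) * W $$ (i, j)"
    if "i < D" "j < D" for i j
  proof (cases "W $$ (i, j) = 0")
    case False
    have "W $$ (i, j) * complex_of_real (d j) = complex_of_real (e i) * W $$ (i, j)"
      using arg_cong[OF W, of "\<lambda>M. M $$ (i, j)"] that by simp
    then show ?thesis using False by (auto simp: mult.commute)
  qed simp
  then have fW: "W * ?\<Delta> (\<lambda>k. f (d k)) = ?\<Delta> (\<lambda>k. f (e k)) * W"
    unfolding mat_diag_mult_left[OF Wc] mat_diag_mult_right[OF Wc] by (intro eq_matI) auto
  have VW: "V * W = U"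
  proof -
    have "V * W = V * mat_adjoint V * U"
      unfolding W_def by (rule assoc_mult_mat[symmetric, OF Vc Va Uc])
    then show ?thesis using V Uc by (simp add: unitary_mat_def)
  qed
  have WU: "W * mat_adjoint U = mat_adjoint V"
  proof -
    have "W * mat_adjoint U = mat_adjoint V * (U * mat_adjoint U)"
      unfolding W_def by (rule assoc_mult_mat[OF Va Uc Ua])
    then show ?thesis using U right_mult_one_mat[OF Va] by (simp add: unitary_mat_def)
  qed
  have "spectral_mat D U (\<lambda>k. f (d k)) = V * W * ?\<Delta> (\<lambda>k. f (d k)) * mat_adjoint U"
    by (simp add: spectral_mat_def VW)
  also have "V * W * ?\<Delta> (\<lambda>k. f (d k)) = V * (?\<Delta> (\<lambda>k. f (e k)) * W)"
    unfolding fW[symmetric] by (rule assoc_mult_mat[OF Vc Wc \<Delta>])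
  also have "\<dots> = V * ?\<Delta> (\<lambda>k. f (e k)) * W"
    by (rule assoc_mult_mat[symmetric, OF Vc \<Delta> Wc])
  also have "\<dots> * mat_adjoint U = V * ?\<Delta> (\<lambda>k. f (e k)) * (W * mat_adjoint U)"
    by (rule assoc_mult_mat[of _ D D _ D _ D]) (use Vc Wc Ua in auto)
  also have "\<dots> = spectral_mat D V (\<lambda>k. f (e k))"
    unfolding WU spectral_mat_def ..
  finally show ?thesis .
qed

lemma hermitian_fun_spectral_mat:
  assumes "unitary_mat D U"
  shows "hermitian_fun f (spectral_mat D U d) = spectral_mat D U (\<lambda>k. f (d k))"
proof -
  have D: "dim_row (spectral_mat D U d) = D"
    using unitary_matD(1)[OF assms] by simp
  show ?thesis
    unfolding hermitian_fun_def D spectral_mat_def[symmetric]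
  proof (rule the_equality)
    show "\<exists>V e. unitary_mat D V \<and> spectral_mat D U d = spectral_mat D V e \<and>
        spectral_mat D U (\<lambda>k. f (d k)) = spectral_mat D V (\<lambda>k. f (e k))"
      by (rule exI[of _ U], rule exI[of _ d]) (simp add: assms)
    fix B
    assume "\<exists>V e. unitary_mat D V \<and> spectral_mat D U d = spectral_mat D V e \<and>
        B = spectral_mat D V (\<lambda>k. f (e k))"
    then obtain V e where "unitary_mat D V" "spectral_mat D U d = spectral_mat D V e"
        "B = spectral_mat D V (\<lambda>k. f (e k))"
      by auto
    then show "B = spectral_mat D U (\<lambda>k. f (d k))"
      using spectral_mat_fun_unique[OF assms, of V d e f] by simp
  qed
qed

text \<open>The spectrum lies in {0, c}, where \<open>f\<close> agrees with the linear function of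
  slope \<open>f c / c\<close>.\<close>

lemma hermitian_fun_idempotent:
  assumes "hermitian D A" "A * A = complex_of_real c \<cdot>\<^sub>m A" "c \<noteq> 0" "f 0 = 0"
  shows "hermitian_fun f A = complex_of_real (f c / c) \<cdot>\<^sub>m A"
proof -
  obtain U d where U: "unitary_mat D U" "A = spectral_mat D U d"
    using spectral_theorem[OF assms(1)] by blast
  note Uc = unitary_matD(1)[OF U(1)]
  have "d k * d k = c * d k" if "k < D" for k
    using assms(2) spectral_mat_inject[OF U(1) _ that, of "\<lambda>k. d k * d k" "\<lambda>k. c * d k"]
    unfolding U(2) spectral_mat_mult[OF U(1)] spectral_mat_smult[OF Uc] by blast
  then have "d k = 0 \<or> d k = c" if "k < D" for k using that by simp
  then have "f (d k) = f c / c * d k" if "k < D" for k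
    using assms(3,4) that by (metis mult_zero_right nonzero_eq_divide_eq times_divide_eq_left)
  then show ?thesis
    unfolding U(2) hermitian_fun_spectral_mat[OF U(1)] spectral_mat_smult[OF Uc]
    by (rule spectral_mat_cong[OF Uc])
qed

lemma dominates_spectral_mat:
  assumes "unitary_mat D U" "\<And>k. k < D \<Longrightarrow> \<bar>e k\<bar> \<le> d k"
  shows "dominates D (spectral_mat D U d) (spectral_mat D U e)"
  unfolding dominates_def spectral_mat_add[OF unitary_matD(1)[OF assms(1)]]
    spectral_mat_diff[OF unitary_matD(1)[OF assms(1)]]
  using assms(2) unitary_matD(1)[OF assms(1)] by (auto intro!: spectral_mat_psd simp: abs_le_iff) force+

section \<open>The trace norm and its duality with domination\<close>

lemma trace_norm_spectral_mat:
  assumes "unitary_mat D U"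
  shows "trace_norm (spectral_mat D U d) = (\<Sum>k<D. \<bar>d k\<bar>)"
  unfolding trace_norm_def hermitian_adjoint[OF spectral_mat_hermitian[OF unitary_matD(1)[OF assms]]]
    spectral_mat_mult[OF assms] hermitian_fun_spectral_mat[OF assms] mat_trace_spectral_mat[OF assms]
  by simp

lemma trace_norm_nonneg:
  assumes "A \<in> carrier_mat D D"
  shows "0 \<le> trace_norm A"
proof -
  have c: "mat_adjoint A * A \<in> carrier_mat D D" using assms by auto
  have "psd_mat D (mat_adjoint A * A)"
  proof (rule psd_mat_gramI[OF c])
    fix i j assume ij: "i < D" "j < D"
    have "(mat_adjoint A * A) $$ (i, j) = (\<Sum>k<D. mat_adjoint A $$ (i, k) * A $$ (k, j))"
      by (rule mat_mult_index) (use assms ij in auto)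
    then show "(mat_adjoint A * A) $$ (i, j) = (\<Sum>k<D. cnj (A $$ (k, i)) * cnj (cnj (A $$ (k, j))))"
      using assms ij by simp
  qed
  then obtain U d where U: "unitary_mat D U" "mat_adjoint A * A = spectral_mat D U d"
      "\<And>k. k < D \<Longrightarrow> 0 \<le> d k"
    using psd_mat_spectral by blast
  then show ?thesis
    by (auto simp: trace_norm_def hermitian_fun_spectral_mat mat_trace_spectral_mat intro!: sum_nonneg)
qed

lemma dominates_hermitian:
  assumes "dominates D A X"
  shows "hermitian D X"
proof -
  note c = dominates_carrier[OF assms]
  have h: "hermitian D (A + X)" "hermitian D (A - X)"
    using assms psd_mat_hermitian by (auto simp: dominates_def)
  show ?thesis unfolding hermitian_def
  proof (intro conjI allI impI)
    fix i j assume ij: "i < D" "j < D"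
    have "(A + X) $$ (j, i) = cnj ((A + X) $$ (i, j))" "(A - X) $$ (j, i) = cnj ((A - X) $$ (i, j))"
      using h ij unfolding hermitian_def by blast+
    then show "X $$ (j, i) = cnj (X $$ (i, j))" using c ij by (simp add: complex_eq_iff)
  qed (fact c)
qed

text \<open>The trace norm is the pairing of \<open>X\<close> with its sign, and the sign is
  dominated by the identity.\<close>

lemma trace_norm_le_dominates:
  assumes "dominates D A X"
  shows "trace_norm X \<le> Re (mat_trace A)"
proof -
  obtain U d where U: "unitary_mat D U" "X = spectral_mat D U d"
    using spectral_theorem[OF dominates_hermitian[OF assms]] by blast
  have "dominates D (1\<^sub>m D) (spectral_mat D U (\<lambda>k. sgn (d k)))"
    unfolding spectral_mat_one[OF U(1), symmetric]
    by (rule dominates_spectral_mat[OF U(1)]) (simp add: abs_sgn_eq)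
  from dominates_trace_pair[OF assms this]
  have "\<bar>\<Sum>k<D. d k * sgn (d k)\<bar> \<le> Re (mat_trace A)"
    unfolding U(2) trace_pair_spectral_mat[OF U(1)] using dominates_carrier[OF assms]
    by (simp add: trace_pair_one_right)
  moreover have "(\<Sum>k<D. \<bar>d k\<bar>) = (\<Sum>k<D. d k * sgn (d k))" by (simp add: abs_sgn)
  ultimately show ?thesis unfolding U(2) trace_norm_spectral_mat[OF U(1)] by linarith
qed

text \<open>Hoelder's inequality for trace norm and operator norm, the latter expressed as
  domination by a scalar; the absolute value of \<open>X\<close> serves as its dominator.\<close>

lemma trace_pair_le_trace_norm:
  assumes "hermitian D X" "dominates D (complex_of_real c \<cdot>\<^sub>m 1\<^sub>m D) Z"
  shows "\<bar>Re (trace_pair D X Z)\<bar> \<le> c * trace_norm X"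
proof -
  obtain U d where U: "unitary_mat D U" "X = spectral_mat D U d"
    using spectral_theorem[OF assms(1)] by blast
  have "dominates D (spectral_mat D U (\<lambda>k. \<bar>d k\<bar>)) X"
    unfolding U(2) by (rule dominates_spectral_mat[OF U(1)]) simp
  from dominates_trace_pair[OF this assms(2)]
  show ?thesis
    unfolding trace_pair_smult_right[OF one_carrier_mat]
      trace_pair_one_right[OF spectral_mat_carrier[OF unitary_matD(1)[OF U(1)]]]
      mat_trace_spectral_mat[OF U(1)]
    by (simp add: U(2) trace_norm_spectral_mat[OF U(1)])
qed

section \<open>Relative entropy of flat states\<close>

lemma mat_log2_idempotent:
  assumes "hermitian D A" "A * A = complex_of_real c \<cdot>\<^sub>m A" "0 < c"
  shows "mat_log2 A = complex_of_real (log 2 c / c) \<cdot>\<^sub>m A"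
  using hermitian_fun_idempotent[OF assms(1,2), of "\<lambda>x. if x > 0 then log 2 x else 0"] assms(3)
  by (simp add: mat_log2_def)

lemma mat_log2_spectral_mat:
  assumes "unitary_mat D U"
  shows "mat_log2 (spectral_mat D U d) = spectral_mat D U (\<lambda>k. if d k > 0 then log 2 (d k) else 0)"
  unfolding mat_log2_def by (rule hermitian_fun_spectral_mat[OF assms])

lemma trace_pair_spectral_mat_right:
  assumes "U \<in> carrier_mat D D" "X \<in> carrier_mat D D"
  shows "trace_pair D X (spectral_mat D U d) = (\<Sum>k<D. d k * quad_form D X (\<lambda>i. U $$ (i, k)))"
proof -
  have "trace_pair D X (spectral_mat D U d) =
      (\<Sum>i<D. \<Sum>j<D. \<Sum>k<D. d k * (X $$ (i, j) * U $$ (j, k) * cnj (U $$ (i, k))))"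
    unfolding trace_pair_def using assms(1)
    by (intro sum.cong refl) (simp add: spectral_mat_index sum_distrib_left mult_ac)
  also have "\<dots> = (\<Sum>i<D. \<Sum>k<D. \<Sum>j<D. d k * (X $$ (i, j) * U $$ (j, k) * cnj (U $$ (i, k))))"
    by (intro sum.cong refl sum.swap)
  also have "\<dots> = (\<Sum>k<D. \<Sum>i<D. \<Sum>j<D. d k * (X $$ (i, j) * U $$ (j, k) * cnj (U $$ (i, k))))"
    by (rule sum.swap)
  finally show ?thesis by (simp only: quad_form_def sum_distrib_left)
qed

text \<open>The columns of \<rho> lie in its support, hence in that of \<sigma>, and so are
  orthogonal to the kernel of \<sigma>. This disarms the convention that \<open>mat_log2\<close> is
  0 on the kernel, where the tangent bound for the logarithm may fail.\<close>

lemma quad_form_zero_of_supp: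
  assumes \<rho>: "psd_mat D \<rho>" and supp: "mat_supp \<rho> \<subseteq> mat_supp \<sigma>"
    and U: "unitary_mat D U" "\<sigma> = spectral_mat D U d" and k: "k < D" "d k = 0"
  shows "quad_form D \<rho> (\<lambda>i. U $$ (i, k)) = 0"
proof -
  note Uc = unitary_matD(1)[OF U(1)] and \<rho>c = psd_mat_carrier[OF \<rho>]
  have \<sigma>c: "\<sigma> \<in> carrier_mat D D" using U Uc by simp
  define u where "u = col U k"
  have u: "u \<in> carrier_vec D" "\<And>i. i < D \<Longrightarrow> u $ i = U $$ (i, k)" using Uc k by (auto simp: u_def)
  have "\<sigma> *\<^sub>v u = 0\<^sub>v D"
  proof -
    have "\<sigma> *\<^sub>v u = col (\<sigma> * U) k" unfolding u_def using Uc \<sigma>c k by auto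
    also have "\<sigma> * U = mat D D (\<lambda>(i, j). U $$ (i, j) * d j)"
      unfolding U(2) spectral_mat_intertwine(1)[OF U(1)] by (rule mat_diag_mult_right[OF Uc])
    finally show ?thesis using k by (auto intro!: eq_vecI)
  qed
  then have ker: "u \<in> mat_kernel \<sigma>" using u(1) \<sigma>c by (auto simp: mat_kernel_def)
  have "(\<Sum>i<D. \<rho> $$ (i, j) * cnj (U $$ (i, k))) = 0" if j: "j < D" for j
  proof -
    have "col \<rho> j \<in> mat_supp \<rho>"
      unfolding mat_supp_def
    proof (intro CollectI conjI ballI)
      show "col \<rho> j \<in> carrier_vec (dim_col \<rho>)" using \<rho>c j by auto
      fix w assume "w \<in> mat_kernel \<rho>"
      then have w: "w \<in> carrier_vec D" "\<rho> *\<^sub>v w = 0\<^sub>v D" using \<rho>c by (auto simp: mat_kernel_def)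
      have "cnj ((\<rho> *\<^sub>v w) $ j) = (\<Sum>i<D. cnj (\<rho> $$ (j, i)) * cnj (w $ i))"
        using \<rho>c w(1) j by (simp add: scalar_prod_def atLeast0LessThan)
      also have "\<dots> = (\<Sum>i<D. \<rho> $$ (i, j) * cnj (w $ i))"
        using psd_mat_hermitian[OF \<rho>] j by (intro sum.cong refl) (metis hermitian_def lessThan_iff)
      also have "\<dots> = col \<rho> j \<bullet>c w"
        using \<rho>c w(1) j by (simp add: scalar_prod_def atLeast0LessThan)
      finally show "col \<rho> j \<bullet>c w = 0" using w(2) j by simp
    qed
    then have "col \<rho> j \<bullet>c u = 0" using supp ker by (auto simp: mat_supp_def)
    moreover have "col \<rho> j \<bullet>c u = (\<Sum>i<D. \<rho> $$ (i, j) * cnj (U $$ (i, k)))"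
      using \<rho>c u j by (auto simp: scalar_prod_def atLeast0LessThan intro!: sum.cong)
    ultimately show ?thesis by simp
  qed
  moreover have "quad_form D \<rho> (\<lambda>i. U $$ (i, k)) =
      (\<Sum>j<D. U $$ (j, k) * (\<Sum>i<D. \<rho> $$ (i, j) * cnj (U $$ (i, k))))"
    unfolding quad_form_def by (subst sum.swap) (simp add: sum_distrib_left mult_ac)
  ultimately show ?thesis by simp
qed

text \<open>Jensen's inequality for the distribution of \<open>\<rho>\<close> over the eigenbasis of \<open>\<sigma>\<close>; the tangent
  line of the logarithm at \<open>t\<close> makes it termwise.\<close>

lemma trace_mult_mat_log2_le:
  assumes \<rho>: "psd_mat D \<rho>" "mat_trace \<rho> = 1" and \<sigma>: "psd_mat D \<sigma>"
    and supp: "mat_supp \<rho> \<subseteq> mat_supp \<sigma>" and t: "Re (trace_pair D \<rho> \<sigma>) \<le> t" "0 < t"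
  shows "Re (mat_trace (\<rho> * mat_log2 \<sigma>)) \<le> log 2 t"
proof -
  obtain U d where U: "unitary_mat D U" "\<sigma> = spectral_mat D U d" "\<And>k. k < D \<Longrightarrow> 0 \<le> d k"
    using psd_mat_spectral[OF \<sigma>] by blast
  note Uc = unitary_matD(1)[OF U(1)] and \<rho>c = psd_mat_carrier[OF \<rho>(1)]
  define q where "q k = Re (quad_form D \<rho> (\<lambda>i. U $$ (i, k)))" for k
  have q0: "0 \<le> q k" for k
    using \<rho>(1) by (auto simp: q_def psd_mat_iff less_eq_complex_def)
  have tp: "Re (trace_pair D \<rho> (spectral_mat D U e)) = (\<Sum>k<D. e k * q k)" for e
    unfolding trace_pair_spectral_mat_right[OF Uc \<rho>c] by (simp add: q_def)
  have q1: "(\<Sum>k<D. q k) = 1"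
    using tp[of "\<lambda>_. 1"] \<rho>(2) by (simp add: spectral_mat_one[OF U(1)] trace_pair_one_right[OF \<rho>c])
  have qd: "(\<Sum>k<D. d k * q k) \<le> t" using t(1) unfolding U(2) tp .
  let ?l = "\<lambda>x. if x > 0 then log 2 x else 0"
  have "Re (mat_trace (\<rho> * mat_log2 \<sigma>)) = (\<Sum>k<D. ?l (d k) * q k)"
    unfolding U(2) mat_log2_spectral_mat[OF U(1)] mat_trace_mult[OF \<rho>c spectral_mat_carrier[OF Uc]]
    by (rule tp)
  also have "\<dots> \<le> (\<Sum>k<D. ((d k / t - 1) / ln 2 + log 2 t) * q k)"
  proof (rule sum_mono)
    fix k assume "k \<in> {..<D}"
    then have k: "k < D" by simp
    show "?l (d k) * q k \<le> ((d k / t - 1) / ln 2 + log 2 t) * q k"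
    proof (cases "d k = 0")
      case True
      then have "q k = 0" using quad_form_zero_of_supp[OF \<rho>(1) supp U(1,2) k] by (simp add: q_def)
      then show ?thesis by simp
    next
      case False
      then have d: "d k > 0" using U(3)[OF k] by simp
      have "ln (d k / t) \<le> d k / t - 1" using d t by (intro ln_le_minus_one) simp
      then have "(ln (d k) - ln t) / ln 2 \<le> (d k / t - 1) / ln 2"
        using d t by (intro divide_right_mono) (simp_all add: ln_div)
      then have "?l (d k) \<le> (d k / t - 1) / ln 2 + log 2 t"
        using d by (simp add: log_def diff_divide_distrib)
      then show ?thesis by (rule mult_right_mono[OF _ q0])
    qed
  qed
  also have "\<dots> = ((\<Sum>k<D. d k * q k) / t - 1) / ln 2 + log 2 t"
  proof -
    have "(\<Sum>k<D. ((d k / t - 1) / ln 2 + log 2 t) * q k) =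
       (\<Sum>k<D. (d k * q k) * (1 / (t * ln 2)) + q k * (log 2 t - 1 / ln 2))"
      by (intro sum.cong refl) (simp add: field_simps)
    also have "\<dots> = (\<Sum>k<D. d k * q k) * (1 / (t * ln 2)) + (log 2 t - 1 / ln 2)"
      unfolding sum.distrib sum_distrib_right[symmetric] q1 by simp
    finally show ?thesis using t(2) by (simp add: field_simps)
  qed
  also have "\<dots> \<le> log 2 t"
  proof -
    have "(\<Sum>k<D. d k * q k) / t - 1 \<le> 0" using qd t(2) by simp
    then show ?thesis by (simp add: divide_le_0_iff)
  qed
  finally show ?thesis .
qed

lemma mat_trace_diff:
  "A \<in> carrier_mat D D \<Longrightarrow> B \<in> carrier_mat D D \<Longrightarrow> mat_trace (A - B) = mat_trace A - mat_trace B"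
  by (simp add: mat_trace_def sum_subtractf)

lemma mat_trace_add:
  "A \<in> carrier_mat D D \<Longrightarrow> B \<in> carrier_mat D D \<Longrightarrow> mat_trace (A + B) = mat_trace A + mat_trace B"
  by (simp add: mat_trace_def sum.distrib)

lemma mat_trace_smult:
  "A \<in> carrier_mat D D \<Longrightarrow> mat_trace (c \<cdot>\<^sub>m A) = c * mat_trace A"
  by (simp add: mat_trace_def sum_distrib_left)

text \<open>The logarithm of \<sigma> is a multiple of \<sigma>, and \<sigma> acts on \<rho> as the
  scalar \<open>e\<close>.\<close>

lemma trace_flat_log:
  assumes \<rho>: "psd_mat D \<rho>" "mat_trace \<rho> = 1"
    and \<sigma>: "hermitian D \<sigma>" "\<sigma> * \<sigma> = complex_of_real e \<cdot>\<^sub>m \<sigma>" "0 < e"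
    and \<rho>\<sigma>: "\<rho> * \<sigma> = complex_of_real e \<cdot>\<^sub>m \<rho>"
  shows "mat_trace (\<rho> * mat_log2 \<sigma>) = log 2 e"
proof -
  note \<rho>c = psd_mat_carrier[OF \<rho>(1)]
  have "\<sigma> \<in> carrier_mat D D" using \<sigma>(1) by (simp add: hermitian_def)
  then have "\<rho> * mat_log2 \<sigma> = complex_of_real (log 2 e / e) \<cdot>\<^sub>m (\<rho> * \<sigma>)"
    unfolding mat_log2_idempotent[OF \<sigma>] by (rule mult_smult_distrib[OF \<rho>c])
  then show ?thesis
    unfolding \<rho>\<sigma> using \<rho>(2) \<sigma>(3) \<rho>c by (simp add: mat_trace_smult[of _ D])
qed

lemma mat_log2_carrier:
  assumes "hermitian D \<sigma>"
  shows "mat_log2 \<sigma> \<in> carrier_mat D D"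
proof -
  obtain U d where U: "unitary_mat D U" "\<sigma> = spectral_mat D U d"
    using spectral_theorem[OF assms] by blast
  then show ?thesis by (simp add: mat_log2_spectral_mat unitary_matD(1))
qed

text \<open>A flat \<rho> is \<open>c\<close> times its support projection, so \<open>t\<close>
  bounds the overlap of \<sigma> with that projection; the entropy term \<open>log 2 c\<close>
  cancels the factor \<open>c\<close> in the bound on the pairing.\<close>

lemma rel_entropy_flat_ge:
  assumes \<rho>: "psd_mat D \<rho>" "mat_trace \<rho> = 1" "\<rho> * \<rho> = complex_of_real c \<cdot>\<^sub>m \<rho>" "0 < c"
    and \<sigma>: "psd_mat D \<sigma>" and t: "Re (trace_pair D \<rho> \<sigma>) \<le> c * t" "0 < t"
  shows "ereal (- log 2 t) \<le> rel_entropy \<rho> \<sigma>"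
proof (cases "mat_supp \<rho> \<subseteq> mat_supp \<sigma>")
  case True
  note h = psd_mat_hermitian[OF \<rho>(1)] psd_mat_hermitian[OF \<sigma>]
  have c: "\<rho> * mat_log2 \<rho> \<in> carrier_mat D D" "\<rho> * mat_log2 \<sigma> \<in> carrier_mat D D"
    using psd_mat_carrier[OF \<rho>(1)] mat_log2_carrier[OF h(1)] mat_log2_carrier[OF h(2)] by auto
  have "Re (mat_trace (\<rho> * mat_log2 \<sigma>)) \<le> log 2 (c * t)"
    using trace_mult_mat_log2_le[OF \<rho>(1,2) \<sigma> True t(1)] t(2) \<rho>(4) by simp
  moreover have "mat_trace (\<rho> * mat_log2 \<rho>) = log 2 c"
    by (rule trace_flat_log[OF \<rho>(1,2) h(1) \<rho>(3,4,3)])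
  ultimately have "- log 2 t \<le> Re (mat_trace (\<rho> * mat_log2 \<rho> - \<rho> * mat_log2 \<sigma>))"
    unfolding mat_trace_diff[OF c] using t(2) \<rho>(4) by (simp add: log_mult)
  then show ?thesis using True by (simp add: rel_entropy_def)
qed (simp add: rel_entropy_def)

text \<open>Serves the upper bounds, where the chosen \<sigma> is flat too and its eigenspace
  contains the range of \<rho>.\<close>

lemma rel_entropy_flat_eq:
  assumes \<rho>: "psd_mat D \<rho>" "mat_trace \<rho> = 1" "\<rho> * \<rho> = complex_of_real c \<cdot>\<^sub>m \<rho>" "0 < c"
    and \<sigma>: "hermitian D \<sigma>" "\<sigma> * \<sigma> = complex_of_real e \<cdot>\<^sub>m \<sigma>" "0 < e"
    and \<rho>\<sigma>: "\<rho> * \<sigma> = complex_of_real e \<cdot>\<^sub>m \<rho>"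
  shows "rel_entropy \<rho> \<sigma> = ereal (log 2 c - log 2 e)"
proof -
  note h = psd_mat_hermitian[OF \<rho>(1)]
  note \<rho>c = psd_mat_carrier[OF \<rho>(1)]
  have \<sigma>c: "\<sigma> \<in> carrier_mat D D" using \<sigma>(1) by (simp add: hermitian_def)
  \<comment> \<open>Supports are orthogonal complements of kernels, so the inclusion of kernels
    reverses to the inclusion of supports.\<close>
  have "mat_kernel \<sigma> \<subseteq> mat_kernel \<rho>"
  proof
    fix w assume "w \<in> mat_kernel \<sigma>"
    then have w: "w \<in> carrier_vec D" "\<sigma> *\<^sub>v w = 0\<^sub>v D" using \<sigma>c by (auto simp: mat_kernel_def)
    have "complex_of_real e \<cdot>\<^sub>v (\<rho> *\<^sub>v w) = complex_of_real e \<cdot>\<^sub>m \<rho> *\<^sub>v w"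
      using \<rho>c w(1) by (intro eq_vecI) (auto simp: scalar_prod_def sum_distrib_left mult_ac)
    also have "\<dots> = \<rho> *\<^sub>v (\<sigma> *\<^sub>v w)"
      unfolding \<rho>\<sigma>[symmetric] by (rule assoc_mult_mat_vec[OF \<rho>c \<sigma>c w(1)])
    also have "\<dots> = 0\<^sub>v D" unfolding w(2) using \<rho>c by auto
    finally have z: "complex_of_real e \<cdot>\<^sub>v (\<rho> *\<^sub>v w) = 0\<^sub>v D" .
    have "\<rho> *\<^sub>v w = 0\<^sub>v D"
    proof (rule eq_vecI)
      fix i assume "i < dim_vec (0\<^sub>v D :: complex vec)"
      then show "(\<rho> *\<^sub>v w) $ i = 0\<^sub>v D $ i"
        using arg_cong[OF z, of "\<lambda>v. v $ i"] \<rho>c \<sigma>(3) by simp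
    qed (use \<rho>c in simp)
    then show "w \<in> mat_kernel \<rho>" using w \<rho>c by (auto simp: mat_kernel_def)
  qed
  then have "mat_supp \<rho> \<subseteq> mat_supp \<sigma>" using \<rho>c \<sigma>c by (auto simp: mat_supp_def)
  moreover have "mat_trace (\<rho> * mat_log2 \<rho> - \<rho> * mat_log2 \<sigma>) = log 2 c - log 2 e"
  proof -
    have "\<rho> * mat_log2 \<rho> \<in> carrier_mat D D" "\<rho> * mat_log2 \<sigma> \<in> carrier_mat D D"
      using \<rho>c mat_log2_carrier[OF h] mat_log2_carrier[OF \<sigma>(1)] by auto
    then show ?thesis
      using trace_flat_log[OF \<rho>(1,2) h \<rho>(3,4,3)] trace_flat_log[OF \<rho>(1,2) \<sigma> \<rho>\<sigma>]
      by (simp add: mat_trace_diff)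
  qed
  ultimately show ?thesis by (simp add: rel_entropy_def)
qed

section \<open>Matrices with the symmetries of \<open>rho_v\<close>\<close>

text \<open>Certificate form: with a list of weights and real vectors, positivity of a concrete
  matrix is left to entrywise simplification.\<close>

lemma psd_mat_real_gramI:
  assumes "A \<in> carrier_mat D D"
    and "\<And>i j. i < D \<Longrightarrow> j < D \<Longrightarrow> A $$ (i, j) = complex_of_real (\<Sum>(c, u)\<leftarrow>vs. c * u i * u j)"
    and "\<And>c u. (c, u) \<in> set vs \<Longrightarrow> 0 \<le> c"
  shows "psd_mat D A"
proof (rule psd_mat_gramI[where I = "{..<length vs}" and
      a = "\<lambda>k i. complex_of_real (sqrt (fst (vs ! k)) * snd (vs ! k) i)"])
  fix i j assume ij: "i < D" "j < D"
  have "(\<Sum>(c, u)\<leftarrow>vs. c * u i * u j) = (\<Sum>k<length vs. fst (vs ! k) * snd (vs ! k) i * snd (vs ! k) j)"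
    by (simp add: sum_list_sum_nth atLeast0LessThan case_prod_beta)
  also have "\<dots> = (\<Sum>k<length vs. (sqrt (fst (vs ! k)) * snd (vs ! k) i) * (sqrt (fst (vs ! k)) * snd (vs ! k) j))"
  proof (intro sum.cong refl)
    fix k assume "k \<in> {..<length vs}"
    then have "0 \<le> fst (vs ! k)" using assms(3)[of "fst (vs ! k)" "snd (vs ! k)"] by simp
    then have sq: "fst (vs ! k) = sqrt (fst (vs ! k)) * sqrt (fst (vs ! k))" by simp
    show "fst (vs ! k) * snd (vs ! k) i * snd (vs ! k) j =
        (sqrt (fst (vs ! k)) * snd (vs ! k) i) * (sqrt (fst (vs ! k)) * snd (vs ! k) j)"
      by (subst sq) (simp only: mult_ac)
  qed
  finally show "A $$ (i, j) = (\<Sum>k<length vs. complex_of_real (sqrt (fst (vs ! k)) * snd (vs ! k) i) *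
      cnj (complex_of_real (sqrt (fst (vs ! k)) * snd (vs ! k) j)))"
    unfolding assms(2)[OF ij] by simp
qed (fact assms)

text \<open>The real matrices invariant under the symmetries of \<open>rho_v\<close>: with \<open>|ab>\<close> at index
  \<open>3 * a + b\<close>, the diagonal entry is \<open>d0\<close> at \<open>00\<close>, \<open>d1\<close> at \<open>01, 10, 02, 20\<close>, \<open>d4\<close> at \<open>11, 22\<close>
  and \<open>d5\<close> at \<open>12, 21\<close>; the off-diagonal entries are \<open>p\<close> for \<open>01/10\<close> and \<open>02/20\<close>, \<open>q\<close> for
  \<open>00/11\<close> and \<open>00/22\<close>, \<open>w\<close> for \<open>11/22\<close> and \<open>z\<close> for \<open>12/21\<close>.  Partial transposition
  exchanges \<open>p\<close> with \<open>q\<close> and \<open>w\<close> with \<open>z\<close>.\<close>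

definition sym_mat :: "real \<Rightarrow> real \<Rightarrow> real \<Rightarrow> real \<Rightarrow> real \<Rightarrow> real \<Rightarrow> real \<Rightarrow> real \<Rightarrow> complex mat" where
  "sym_mat d0 d1 d4 d5 p q w z = mat 9 9 (\<lambda>(i, j). complex_of_real (
     if i = j then [d0, d1, d1, d1, d4, d5, d1, d5, d4] ! i
     else if (i, j) \<in> {(1, 3), (3, 1), (2, 6), (6, 2)} then p
     else if (i, j) \<in> {(0, 4), (4, 0), (0, 8), (8, 0)} then q
     else if (i, j) \<in> {(4, 8), (8, 4)} then w
     else if (i, j) \<in> {(5, 7), (7, 5)} then z else 0))"

lemma all_less_nine:
  "(\<forall>i<9. P i) \<longleftrightarrow> P 0 \<and> P 1 \<and> P 2 \<and> P 3 \<and> P 4 \<and> P 5 \<and> P 6 \<and> P 7 \<and> P (8 :: nat)"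
  by (simp add: numeral_eq_Suc All_less_Suc) blast

lemma sum_less_nine:
  "(\<Sum>i<9. f i) = f 0 + f 1 + f 2 + f 3 + f 4 + f 5 + f 6 + f 7 + (f (8 :: nat) :: 'a :: comm_monoid_add)"
  by (simp add: numeral_eq_Suc)

lemma sym_mat_carrier [simp]: "sym_mat d0 d1 d4 d5 p q w z \<in> carrier_mat 9 9"
  "dim_row (sym_mat d0 d1 d4 d5 p q w z) = 9" "dim_col (sym_mat d0 d1 d4 d5 p q w z) = 9"
  by (simp_all add: sym_mat_def)

lemma sym_mat_index:
  "\<forall>i<9. \<forall>j<9. sym_mat d0 d1 d4 d5 p q w z $$ (i, j) = complex_of_real (
     if i = j then [d0, d1, d1, d1, d4, d5, d1, d5, d4] ! i
     else if (i, j) \<in> {(1, 3), (3, 1), (2, 6), (6, 2)} then p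
     else if (i, j) \<in> {(0, 4), (4, 0), (0, 8), (8, 0)} then q
     else if (i, j) \<in> {(4, 8), (8, 4)} then w
     else if (i, j) \<in> {(5, 7), (7, 5)} then z else 0)"
  by (simp add: sym_mat_def)

lemmas sym_mat_entry = sym_mat_index[unfolded all_less_nine, simplified]

lemma mat_nine_eqI:
  assumes "A \<in> carrier_mat 9 9" "B \<in> carrier_mat 9 9" "\<forall>i<9. \<forall>j<9. A $$ (i, j) = B $$ (i, j)"
  shows "A = B"
  using assms by (intro eq_matI) auto

lemma sym_mat_add:
  "sym_mat d0 d1 d4 d5 p q w z + sym_mat d0' d1' d4' d5' p' q' w' z' =
   sym_mat (d0 + d0') (d1 + d1') (d4 + d4') (d5 + d5') (p + p') (q + q') (w + w') (z + z')"
  by (rule mat_nine_eqI) (simp_all add: all_less_nine, simp_all add: sym_mat_entry)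

lemma sym_mat_diff:
  "sym_mat d0 d1 d4 d5 p q w z - sym_mat d0' d1' d4' d5' p' q' w' z' =
   sym_mat (d0 - d0') (d1 - d1') (d4 - d4') (d5 - d5') (p - p') (q - q') (w - w') (z - z')"
  by (rule mat_nine_eqI) (simp_all add: all_less_nine minus_carrier_mat, simp_all add: sym_mat_entry)

lemma sym_mat_smult:
  "complex_of_real c \<cdot>\<^sub>m sym_mat d0 d1 d4 d5 p q w z =
   sym_mat (c * d0) (c * d1) (c * d4) (c * d5) (c * p) (c * q) (c * w) (c * z)"
  by (rule mat_nine_eqI) (simp_all add: all_less_nine, simp_all add: sym_mat_entry)

lemma sym_mat_one: "1\<^sub>m 9 = sym_mat 1 1 1 1 0 0 0 0"
  by (rule mat_nine_eqI) (simp_all add: all_less_nine, simp_all add: sym_mat_entry)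

lemma sym_mat_scalar: "complex_of_real c \<cdot>\<^sub>m 1\<^sub>m 9 = sym_mat c c c c 0 0 0 0"
  by (simp add: sym_mat_one sym_mat_smult)

lemma sym_mat_partial_transpose:
  "partial_transpose 3 3 (sym_mat d0 d1 d4 d5 p q w z) = sym_mat d0 d1 d4 d5 q p z w"
  by (rule mat_nine_eqI)
    (use partial_transpose_carrier[of 3 3] in \<open>simp_all add: all_less_nine partial_transpose_index\<close>, simp add: sym_mat_entry flip: numeral_2_eq_2)

lemma sym_mat_trace: "mat_trace (sym_mat d0 d1 d4 d5 p q w z) = complex_of_real (d0 + 4 * d1 + 2 * d4 + 2 * d5)"
  unfolding mat_trace_def sym_mat_carrier sum_less_nine by (simp add: sym_mat_entry)

lemma sym_mat_trace_pair:
  "trace_pair 9 (sym_mat d0 d1 d4 d5 p q w z) (sym_mat d0' d1' d4' d5' p' q' w' z') =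
   complex_of_real (d0 * d0' + 4 * (d1 * d1') + 2 * (d4 * d4') + 2 * (d5 * d5') +
     4 * (p * p') + 4 * (q * q') + 2 * (w * w') + 2 * (z * z'))"
  unfolding trace_pair_def sum_less_nine by (simp add: sym_mat_entry)

text \<open>Restricted to matrices supported on 01, 10, 02, 20, which covers \<open>rho_v\<close>
  and the comparison operators in the entropy upper bounds.\<close>

lemma sym_mat_mult:
  "sym_mat 0 a 0 0 b 0 0 0 * sym_mat 0 a' 0 0 b' 0 0 0 = sym_mat 0 (a * a' + b * b') 0 0 (a * b' + b * a') 0 0 0"
proof (rule mat_nine_eqI)
  let ?A = "sym_mat 0 a 0 0 b 0 0 0" and ?B = "sym_mat 0 a' 0 0 b' 0 0 0"
  have "(?A * ?B) $$ (i, j) = (\<Sum>l<9. ?A $$ (i, l) * ?B $$ (l, j))" if "i < 9" "j < 9" for i j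
    by (rule mat_mult_index) (use that in simp_all)
  then show "\<forall>i<9. \<forall>j<9. (?A * ?B) $$ (i, j) = sym_mat 0 (a * a' + b * b') 0 0 (a * b' + b * a') 0 0 0 $$ (i, j)"
    by (simp add: all_less_nine sum_less_nine sym_mat_entry)
qed (auto intro!: mult_carrier_mat)

text \<open>The block on \<open>00, 11, 22\<close> splits off the vector \<open>|11> - |22>\<close>, and a Schur complement
  treats the rest; for \<open>d0 = 0\<close> the hypothesis forces \<open>q = 0\<close>, so that \<open>q / d0\<close> is harmless.\<close>

lemma sym_mat_psd:
  assumes "\<bar>p\<bar> \<le> d1" "\<bar>z\<bar> \<le> d5" "\<bar>w\<bar> \<le> d4" "0 \<le> d0" "2 * q\<^sup>2 \<le> d0 * (d4 + w)"
  shows "psd_mat 9 (sym_mat d0 d1 d4 d5 p q w z)"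
proof -
  have q: "q * q / d0 \<le> (d4 + w) / 2" "d0 * (q / d0) = q"
  proof -
    have "d0 = 0 \<Longrightarrow> q = 0" using assms(5) zero_le_power2[of q] by auto
    then show "d0 * (q / d0) = q" by auto
    show "q * q / d0 \<le> (d4 + w) / 2"
      using assms(3-5) by (cases "d0 = 0") (auto simp: field_simps power2_eq_square)
  qed
  define vs :: "(real \<times> (nat \<Rightarrow> real)) list" where "vs =
    [((d1 + p) / 2, (!) [0, 1, 0, 1, 0, 0, 0, 0, 0]), ((d1 - p) / 2, (!) [0, 1, 0, -1, 0, 0, 0, 0, 0]),
     ((d1 + p) / 2, (!) [0, 0, 1, 0, 0, 0, 1, 0, 0]), ((d1 - p) / 2, (!) [0, 0, 1, 0, 0, 0, -1, 0, 0]),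
     ((d5 + z) / 2, (!) [0, 0, 0, 0, 0, 1, 0, 1, 0]), ((d5 - z) / 2, (!) [0, 0, 0, 0, 0, 1, 0, -1, 0]),
     ((d4 - w) / 2, (!) [0, 0, 0, 0, 1, 0, 0, 0, -1]),
     (d0, (!) [1, 0, 0, 0, q / d0, 0, 0, 0, q / d0]),
     ((d4 + w) / 2 - q * q / d0, (!) [0, 0, 0, 0, 1, 0, 0, 0, 1])]"
  have q2: "d0 * (q / d0) * (q / d0) = q * q / d0" unfolding q by simp
  have "\<forall>i<9. \<forall>j<9. sym_mat d0 d1 d4 d5 p q w z $$ (i, j) = complex_of_real (\<Sum>(c, u)\<leftarrow>vs. c * u i * u j)"
    unfolding vs_def all_less_nine
    by (simp add: sym_mat_entry q2[simplified] q(2)[simplified] add_divide_distrib diff_divide_distrib flip: of_real_add of_real_diff of_real_mult of_real_divide)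
  then show ?thesis
    by (intro psd_mat_real_gramI[where vs = vs]) (use assms q in \<open>auto simp: vs_def abs_le_iff\<close>)
qed

lemma sym_mat_dominates:
  assumes "\<bar>p + p'\<bar> \<le> d1 + d1'" "\<bar>z + z'\<bar> \<le> d5 + d5'" "\<bar>w + w'\<bar> \<le> d4 + d4'" "0 \<le> d0 + d0'"
    "2 * (q + q')\<^sup>2 \<le> (d0 + d0') * (d4 + d4' + (w + w'))"
    and "\<bar>p - p'\<bar> \<le> d1 - d1'" "\<bar>z - z'\<bar> \<le> d5 - d5'" "\<bar>w - w'\<bar> \<le> d4 - d4'" "0 \<le> d0 - d0'"
    "2 * (q - q')\<^sup>2 \<le> (d0 - d0') * (d4 - d4' + (w - w'))"
  shows "dominates 9 (sym_mat d0 d1 d4 d5 p q w z) (sym_mat d0' d1' d4' d5' p' q' w' z')"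
  unfolding dominates_def sym_mat_add sym_mat_diff using assms by (simp add: sym_mat_psd)

lemma ket2_index:
  assumes "i < d" "j < d" "k < d * d"
  shows "ket2 d i j $ k = (if k = i * d + j then 1 else 0)"
proof -
  have "k div d < d" "k mod d < d" using div_mod_index_less[OF assms(3)] by auto
  moreover have "k div d = i \<and> k mod d = j \<longleftrightarrow> k = i * d + j"
    using assms(2) by (metis div_mult_mod_eq mult_index_div_mod)
  ultimately show ?thesis
    using assms by (auto simp: ket2_def tensor_vec_def)
qed

lemma ket2_dim [simp]: "dim_vec (ket2 d i j) = d * d"
  by (simp add: ket2_def tensor_vec_def)

lemma rho_v_eq: "rho_v = sym_mat 0 (1 / 4) 0 0 (- 1 / 4) 0 0 0"
proof (rule mat_nine_eqI)
  have s: "complex_of_real (sqrt 2) * complex_of_real (sqrt 2) = 2"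
    by (simp flip: of_real_mult)
  have v: "v1 \<in> carrier_vec 9" "v2 \<in> carrier_vec 9"
    by (rule carrier_vecI, simp add: v1_def v2_def)+
  then show "rho_v \<in> carrier_mat 9 9" by (auto simp: rho_v_def ket_bra_def)
  have i1: "\<forall>i<9. v1 $ i = complex_of_real (if i = 1 then 1 / sqrt 2 else if i = 3 then - 1 / sqrt 2 else 0)"
    and i2: "\<forall>i<9. v2 $ i = complex_of_real (if i = 2 then 1 / sqrt 2 else if i = 6 then - 1 / sqrt 2 else 0)"
    by (auto simp: v1_def v2_def ket2_index)
  have "rho_v $$ (i, j) = 1 / 2 * (v1 $ i * cnj (v1 $ j) + v2 $ i * cnj (v2 $ j))" if "i < 9" "j < 9" for i j
    using that v by (simp add: rho_v_def ket_bra_def)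
  note this[simp]
  note i1[unfolded all_less_nine, simplified, simp] i2[unfolded all_less_nine, simplified, simp]
  show "\<forall>i<9. \<forall>j<9. rho_v $$ (i, j) = sym_mat 0 (1 / 4) 0 0 (- 1 / 4) 0 0 0 $$ (i, j)"
    by (simp add: all_less_nine sym_mat_entry s flip: of_real_mult)
qed simp

section \<open>Maximally entangled states\<close>

lemma all_less_four: "(\<forall>i<4. P i) \<longleftrightarrow> P 0 \<and> P 1 \<and> P 2 \<and> P (3 :: nat)"
  by (simp add: numeral_eq_Suc All_less_Suc) blast

definition bell_mat :: "complex mat" where
  "bell_mat = ket_bra bell_vec"

lemma bell_mat_carrier [simp]: "bell_mat \<in> carrier_mat 4 4" "dim_row bell_mat = 4" "dim_col bell_mat = 4"
  by (simp_all add: bell_mat_def ket_bra_def bell_vec_def)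

lemma bell_mat_index:
  "i < 4 \<Longrightarrow> j < 4 \<Longrightarrow> bell_mat $$ (i, j) = (if i \<in> {0, 3} \<and> j \<in> {0, 3} then 1 / 2 else 0)"
proof -
  have s: "complex_of_real (sqrt 2) * complex_of_real (sqrt 2) = 2"
    by (simp flip: of_real_mult)
  have "bell_vec $ i = (if i = 0 \<or> i = 3 then complex_of_real (1 / sqrt 2) else 0)" if "i < 4" for i
    using that by (simp add: bell_vec_def ket2_index)
  then show "i < 4 \<Longrightarrow> j < 4 \<Longrightarrow> ?thesis"
    unfolding bell_mat_def ket_bra_def by (simp add: bell_vec_def[THEN arg_cong, of dim_vec] s)
qed

lemma bell_mat_psd: "psd_mat 4 bell_mat"
proof (rule psd_mat_real_gramI[where vs = "[(1 / 2, (!) [1, 0, 0, 1])]"])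
  have "\<forall>i<4. \<forall>j<4. bell_mat $$ (i, j) = complex_of_real (\<Sum>(c, u)\<leftarrow>[(1 / 2, (!) [1, 0, 0, 1])]. c * u i * u j)"
    by (simp add: all_less_four bell_mat_index)
  then show "bell_mat $$ (i, j) = complex_of_real (\<Sum>(c, u)\<leftarrow>[(1 / 2, (!) [1, 0, 0, 1])]. c * u i * u j)"
    if "i < 4" "j < 4" for i j using that by blast
qed auto

lemma bell_mat_le_one: "dominates 4 (1\<^sub>m 4) bell_mat"
proof -
  let ?vs = "[(1 / 2, (!) [1, 0, 0, - 1]), (1, (!) [0, 1, 0, 0]), (1, (!) [0, 0, 1, 0])] :: (real \<times> (nat \<Rightarrow> real)) list"
  have "\<forall>i<4. \<forall>j<4. (1\<^sub>m 4 - bell_mat) $$ (i, j) = complex_of_real (\<Sum>(c, u)\<leftarrow>?vs. c * u i * u j)"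
    by (simp add: all_less_four bell_mat_index)
  then have "psd_mat 4 (1\<^sub>m 4 - bell_mat)"
    by (intro psd_mat_real_gramI[where vs = ?vs]) (auto intro!: minus_carrier_mat)
  then show ?thesis
    using psd_mat_add[OF psd_mat_one bell_mat_psd] by (simp add: dominates_def)
qed

text \<open>The partial transpose is half the swap operator, with eigenvalues \<plusminus>1/2. The
  lists \<open>?vs\<close> and \<open>?ws\<close> span the symmetric and the antisymmetric
  subspace.\<close>

lemma bell_mat_partial_transpose: "dominates 4 (complex_of_real (1 / 2) \<cdot>\<^sub>m 1\<^sub>m 4) (partial_transpose 2 2 bell_mat)"
proof -
  let ?A = "complex_of_real (1 / 2) \<cdot>\<^sub>m 1\<^sub>m 4" and ?B = "partial_transpose 2 2 bell_mat"
  have Bc: "?B \<in> carrier_mat 4 4" using partial_transpose_carrier[of 2 2] by simp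
  let ?vs = "[(1, (!) [1, 0, 0, 0]), (1, (!) [0, 0, 0, 1]), (1 / 2, (!) [0, 1, 1, 0])] :: (real \<times> (nat \<Rightarrow> real)) list"
  let ?ws = "[(1 / 2, (!) [0, 1, - 1, 0])] :: (real \<times> (nat \<Rightarrow> real)) list"
  have "\<forall>i<4. \<forall>j<4. ?B $$ (i, j) =
      (if (i, j) \<in> {(0, 0), (1, 2), (2, 1), (3, 3)} then 1 / 2 else 0)"
    by (simp add: all_less_four partial_transpose_index bell_mat_index flip: numeral_2_eq_2)
  then have B': "?B $$ (i, j) = (if (i, j) \<in> {(0, 0), (1, 2), (2, 1), (3, 3)} then 1 / 2 else 0)"
    if "i < 4" "j < 4" for i j using that by blast
  have "\<forall>i<4. \<forall>j<4. (?A + ?B) $$ (i, j) = complex_of_real (\<Sum>(c, u)\<leftarrow>?vs. c * u i * u j)"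
    using Bc by (simp add: all_less_four B')
  then have 1: "psd_mat 4 (?A + ?B)"
    using Bc by (intro psd_mat_real_gramI[where vs = ?vs]) auto
  have "\<forall>i<4. \<forall>j<4. (?A - ?B) $$ (i, j) = complex_of_real (\<Sum>(c, u)\<leftarrow>?ws. c * u i * u j)"
    using Bc by (simp add: all_less_four B')
  then have "psd_mat 4 (?A - ?B)"
    using Bc by (intro psd_mat_real_gramI[where vs = ?ws]) (auto intro!: minus_carrier_mat)
  with 1 show ?thesis using Bc by (simp add: dominates_def)
qed

lemma ebits_eq: "ebits k = bip_power 2 2 bell_mat k"
  by (simp add: ebits_def bell_mat_def)

lemma ebits_carrier [simp]: "ebits k \<in> carrier_mat (2 ^ k * 2 ^ k) (2 ^ k * 2 ^ k)"
  by (simp add: ebits_eq)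

lemma ebits_psd: "psd_mat (2 ^ k * 2 ^ k) (ebits k)"
  unfolding ebits_eq by (rule bip_power_psd) (simp add: bell_mat_psd)

lemma ebits_le_one: "dominates (2 ^ k * 2 ^ k) (1\<^sub>m (2 ^ k * 2 ^ k)) (ebits k)"
  using bip_power_dominates[of 2 2 "1\<^sub>m (2 * 2)" bell_mat k] bell_mat_le_one
  unfolding ebits_eq bip_power_one by simp

lemma ebits_partial_transpose:
  "dominates (2 ^ k * 2 ^ k) (complex_of_real (1 / 2 ^ k) \<cdot>\<^sub>m 1\<^sub>m (2 ^ k * 2 ^ k)) (partial_transpose (2 ^ k) (2 ^ k) (ebits k))"
  using bip_power_dominates[of 2 2 "complex_of_real (1 / 2) \<cdot>\<^sub>m 1\<^sub>m (2 * 2)" "partial_transpose 2 2 bell_mat" k]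
    bell_mat_partial_transpose
  unfolding ebits_eq bip_power_smult[OF one_carrier_mat] bip_power_one partial_transpose_bip_power
  by (simp add: power_one_over)

lemma lessThan_four: "{..<4} = {0, 1, 2, 3 :: nat}"
  by auto

lemma ebits_trace: "mat_trace (ebits k) = 1"
proof -
  have "mat_trace bell_mat = 1"
    unfolding mat_trace_def bell_mat_carrier lessThan_four by (simp add: bell_mat_index)
  then show ?thesis unfolding ebits_eq by (subst mat_trace_bip_power) simp_all
qed

lemma ebits_trace_pair: "trace_pair (2 ^ k * 2 ^ k) (ebits k) (ebits k) = 1"
proof -
  have "trace_pair 4 bell_mat bell_mat = 1"
    unfolding trace_pair_def lessThan_four by (simp add: bell_mat_index)
  then show ?thesis unfolding ebits_eq by (subst trace_pair_bip_power) simp_all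
qed

section \<open>Quantum operations\<close>

text \<open>Complete positivity at ancilla dimension 1.\<close>

lemma completely_positive_psd:
  assumes "completely_positive D D' f" "psd_mat D X"
  shows "psd_mat D' (f X)"
proof -
  have "psd_mat (1 * D') (ampliation 1 D D' f X)"
    using assms unfolding completely_positive_def by (metis mult_1)
  moreover have "ampliation 1 D D' f X = f X"
  proof -
    have X: "X \<in> carrier_mat D D" using assms(2) by (rule psd_mat_carrier)
    have "f X \<in> carrier_mat D' D'"
      using assms(1) X by (auto simp: completely_positive_def linear_op_def)
    moreover have "mat D D (\<lambda>(p, q). X $$ (p, q)) = X" using X by (intro eq_matI) auto
    ultimately show ?thesis by (intro eq_matI) (auto simp: ampliation_def)
  qed
  ultimately show ?thesis by simp
qed

lemma linear_op_diff:
  assumes "linear_op D D' f" "X \<in> carrier_mat D D" "Y \<in> carrier_mat D D"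
  shows "f (X - Y) = f X - f Y"
proof -
  have XY: "X - Y = X + (- 1) \<cdot>\<^sub>m Y" using assms by (intro eq_matI) auto
  have "f (X - Y) = f X + f ((- 1) \<cdot>\<^sub>m Y)"
    unfolding XY using assms by (simp add: linear_op_def)
  also have "f ((- 1) \<cdot>\<^sub>m Y) = (- 1) \<cdot>\<^sub>m f Y" using assms by (simp add: linear_op_def)
  also have "f X + (- 1) \<cdot>\<^sub>m f Y = f X - f Y"
  proof -
    have "f X \<in> carrier_mat D' D'" "f Y \<in> carrier_mat D' D'" using assms by (auto simp: linear_op_def)
    then show ?thesis by (intro eq_matI) auto
  qed
  finally show ?thesis .
qed

lemma completely_positive_dominates:
  assumes "completely_positive D D' f" "dominates D A X"
  shows "dominates D' (f A) (f X)"
proof -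
  note c = dominates_carrier[OF assms(2)]
  have l: "linear_op D D' f" using assms(1) by (simp add: completely_positive_def)
  have "f (A + X) = f A + f X" "f (A - X) = f A - f X"
    using l c linear_op_diff[OF l c] by (auto simp: linear_op_def)
  moreover have "psd_mat D' (f (A + X))" "psd_mat D' (f (A - X))"
    using assms by (auto simp: dominates_def intro: completely_positive_psd)
  ultimately show ?thesis using l c by (simp add: dominates_def linear_op_def)
qed

section \<open>Measure-and-prepare maps\<close>

definition measure_prepare ::
  "nat \<Rightarrow> complex mat \<Rightarrow> complex mat \<Rightarrow> complex mat \<Rightarrow> complex mat \<Rightarrow> complex mat \<Rightarrow> complex mat" where
  "measure_prepare D M N A B X = trace_pair D M X \<cdot>\<^sub>m A + trace_pair D N X \<cdot>\<^sub>m B"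

lemma block_index_less: "i < k * D' \<Longrightarrow> p < D \<Longrightarrow> i div D' * D + p < k * (D :: nat)"
  by (rule mult_index_less) (auto simp: div_mod_index_less)

text \<open>Gram vectors of the three operators combine: each vector of \<open>X\<close> is
  contracted with one of \<open>M\<close> on the measured system, and the resulting ancilla vector
  is tensored with one of \<open>A\<close>.\<close>

lemma ampliation_measure_psd:
  assumes M: "psd_mat D M" and A: "psd_mat D' A" and X: "psd_mat (k * D) X"
  shows "psd_mat (k * D') (mat (k * D') (k * D') (\<lambda>(i, j).
    trace_pair D M (mat D D (\<lambda>(p, q). X $$ (i div D' * D + p, j div D' * D + q))) * A $$ (i mod D', j mod D')))"
    (is "psd_mat _ ?T")
proof -
  obtain m where m: "\<And>i j. i < D \<Longrightarrow> j < D \<Longrightarrow> M $$ (i, j) = (\<Sum>l<D. m l i * cnj (m l j))"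
    using psd_mat_gramE[OF M] by blast
  obtain a where a: "\<And>i j. i < D' \<Longrightarrow> j < D' \<Longrightarrow> A $$ (i, j) = (\<Sum>s<D'. a s i * cnj (a s j))"
    using psd_mat_gramE[OF A] by blast
  obtain x where x: "\<And>i j. i < k * D \<Longrightarrow> j < k * D \<Longrightarrow> X $$ (i, j) = (\<Sum>r<k * D. x r i * cnj (x r j))"
    using psd_mat_gramE[OF X] by blast
  define g where "g l r i = (\<Sum>q<D. cnj (m l q) * x r (i div D' * D + q))" for l r i
  show ?thesis
  proof (rule psd_mat_gramI[where I = "({..<D} \<times> {..<k * D}) \<times> {..<D'}" and
      a = "\<lambda>((l, r), s) i. g l r i * a s (i mod D')"])
    fix i j assume ij: "i < k * D'" "j < k * D'"
    have sp: "(\<Sum>p<D. \<Sum>q<D. f q * h p) = sum f {..<D} * sum h {..<D}" for f h :: "nat \<Rightarrow> complex"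
      by (subst sum.swap) (simp add: sum_product)
    have "trace_pair D M (mat D D (\<lambda>(p, q). X $$ (i div D' * D + p, j div D' * D + q))) =
      (\<Sum>p<D. \<Sum>q<D. \<Sum>(l, r)\<in>{..<D} \<times> {..<k * D}.
         (cnj (m l q) * x r (i div D' * D + q)) * (m l p * cnj (x r (j div D' * D + p))))"
      unfolding trace_pair_def
    proof (intro sum.cong refl)
      fix p q assume "p \<in> {..<D}" "q \<in> {..<D}"
      then have "M $$ (p, q) * mat D D (\<lambda>(p, q). X $$ (i div D' * D + p, j div D' * D + q)) $$ (q, p) =
        (\<Sum>l<D. m l p * cnj (m l q)) *
        (\<Sum>r<k * D. x r (i div D' * D + q) * cnj (x r (j div D' * D + p)))"
        using ij by (simp add: m x[OF block_index_less block_index_less])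
      also have "\<dots> = (\<Sum>(l, r)\<in>{..<D} \<times> {..<k * D}.
         (cnj (m l q) * x r (i div D' * D + q)) * (m l p * cnj (x r (j div D' * D + p))))"
        unfolding sum_product sum.cartesian_product
        by (intro sum.cong refl) (simp add: case_prod_beta)
      finally show "M $$ (p, q) * mat D D (\<lambda>(p, q). X $$ (i div D' * D + p, j div D' * D + q)) $$ (q, p) = \<dots>" .
    qed
    also have "\<dots> = (\<Sum>p<D. \<Sum>(l, r)\<in>{..<D} \<times> {..<k * D}. \<Sum>q<D.
         (cnj (m l q) * x r (i div D' * D + q)) * (m l p * cnj (x r (j div D' * D + p))))"
      unfolding case_prod_beta by (intro sum.cong refl sum.swap)
    also have "\<dots> = (\<Sum>(l, r)\<in>{..<D} \<times> {..<k * D}. \<Sum>p<D. \<Sum>q<D.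
         (cnj (m l q) * x r (i div D' * D + q)) * (m l p * cnj (x r (j div D' * D + p))))"
      unfolding case_prod_beta by (rule sum.swap)
    also have "\<dots> = (\<Sum>(l, r)\<in>{..<D} \<times> {..<k * D}. g l r i * cnj (g l r j))"
      unfolding sp by (simp add: g_def)
    finally have tp: "trace_pair D M (mat D D (\<lambda>(p, q). X $$ (i div D' * D + p, j div D' * D + q))) =
       (\<Sum>(l, r)\<in>{..<D} \<times> {..<k * D}. g l r i * cnj (g l r j))" .
    have mods: "i mod D' < D'" "j mod D' < D'" using ij by (auto simp: div_mod_index_less)
    have "?T $$ (i, j) = (\<Sum>(l, r)\<in>{..<D} \<times> {..<k * D}. g l r i * cnj (g l r j)) *
        (\<Sum>s<D'. a s (i mod D') * cnj (a s (j mod D')))"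
      using ij by (simp only: index_mat split tp a[OF mods])
    also have "\<dots> = (\<Sum>t\<in>({..<D} \<times> {..<k * D}) \<times> {..<D'}.
       (case t of (lr, s) \<Rightarrow> (case lr of (l, r) \<Rightarrow> \<lambda>s i. g l r i * a s (i mod D')) s) i *
       cnj ((case t of (lr, s) \<Rightarrow> (case lr of (l, r) \<Rightarrow> \<lambda>s i. g l r i * a s (i mod D')) s) j))"
      unfolding sum_product sum.cartesian_product
      by (intro sum.cong refl) (simp add: case_prod_beta mult_ac)
    finally show "?T $$ (i, j) = \<dots>" .
  qed simp
qed

lemma completely_positive_measure_prepare:
  assumes "psd_mat D M" "psd_mat D N" "psd_mat D' A" "psd_mat D' B"
  shows "completely_positive D D' (measure_prepare D M N A B)"
  unfolding completely_positive_def
proof (intro conjI allI impI)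
  note c = assms[THEN psd_mat_carrier]
  show "linear_op D D' (measure_prepare D M N A B)"
    unfolding linear_op_def
  proof (intro conjI allI ballI)
    fix X Y :: "complex mat" and z :: complex
    assume X: "X \<in> carrier_mat D D"
    show "measure_prepare D M N A B X \<in> carrier_mat D' D'" using c by (simp add: measure_prepare_def)
    show "measure_prepare D M N A B (z \<cdot>\<^sub>m X) = z \<cdot>\<^sub>m measure_prepare D M N A B X"
      using c X by (intro eq_matI) (auto simp: measure_prepare_def algebra_simps)
    assume Y: "Y \<in> carrier_mat D D"
    show "measure_prepare D M N A B (X + Y) = measure_prepare D M N A B X + measure_prepare D M N A B Y"
      using c X Y by (intro eq_matI) (auto simp: measure_prepare_def trace_pair_linear algebra_simps)
  qed
  fix k X assume X: "psd_mat (k * D) X"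
  let ?T = "\<lambda>M A. mat (k * D') (k * D') (\<lambda>(i, j).
    trace_pair D M (mat D D (\<lambda>(p, q). X $$ (i div D' * D + p, j div D' * D + q))) * A $$ (i mod D', j mod D'))"
  have "ampliation k D D' (measure_prepare D M N A B) X = ?T M A + ?T N B"
    using c by (intro eq_matI) (auto simp: ampliation_def measure_prepare_def div_mod_index_less)
  then show "psd_mat (k * D') (ampliation k D D' (measure_prepare D M N A B) X)"
    using assms X by (simp add: psd_mat_add ampliation_measure_psd)
qed

text \<open>Conjugation by partial transposes agrees with a measure-and-prepare map only on matrices
  of the right size; complete positivity sees no others.\<close>

lemma completely_positive_cong:
  assumes "completely_positive D D' f" "\<And>X. X \<in> carrier_mat D D \<Longrightarrow> g X = f X"
  shows "completely_positive D D' g"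
proof -
  have "linear_op D D' g" using assms by (auto simp: completely_positive_def linear_op_def)
  moreover have "ampliation k D D' g X = ampliation k D D' f X" for k X
    unfolding ampliation_def by (simp add: assms(2))
  ultimately show ?thesis using assms(1) by (simp add: completely_positive_def)
qed

text \<open>Trace preservation holds because the two outcomes sum to the identity and both prepared
  states have trace 1. The transposed operators may fail to be positive, so \<open>eq\<close> asks
  for another measure-and-prepare form of the conjugated map, with positive operators.\<close>

lemma measure_prepare_ppt:
  assumes psd: "psd_mat (dA * dB) M" "psd_mat (dA * dB) (1\<^sub>m (dA * dB) - M)"
      "psd_mat (dA' * dB') A" "psd_mat (dA' * dB') B"
    and tr: "mat_trace A = 1" "mat_trace B = 1"
    and psd': "psd_mat (dA * dB) M'" "psd_mat (dA * dB) N'"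
      "psd_mat (dA' * dB') A'" "psd_mat (dA' * dB') B'"
    and eq: "\<And>X. X \<in> carrier_mat (dA * dB) (dA * dB) \<Longrightarrow>
      trace_pair (dA * dB) (partial_transpose dA dB M) X \<cdot>\<^sub>m partial_transpose dA' dB' A +
      (mat_trace X - trace_pair (dA * dB) (partial_transpose dA dB M) X) \<cdot>\<^sub>m partial_transpose dA' dB' B =
      measure_prepare (dA * dB) M' N' A' B' X"
  shows "measure_prepare (dA * dB) M (1\<^sub>m (dA * dB) - M) A B \<in> ppt_operations dA dB dA' dB'"
proof -
  let ?D = "dA * dB" and ?N = "1\<^sub>m (dA * dB) - M"
  note c = psd[THEN psd_mat_carrier]
  have N: "trace_pair ?D ?N X = mat_trace X - trace_pair ?D M X" if "X \<in> carrier_mat ?D ?D" for X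
    using c that by (simp add: trace_pair_linear trace_pair_one_left)
  have cp: "completely_positive ?D (dA' * dB') (measure_prepare ?D M ?N A B)"
    by (rule completely_positive_measure_prepare[OF psd])
  moreover have "mat_trace (measure_prepare ?D M ?N A B X) = mat_trace X" if "X \<in> carrier_mat ?D ?D" for X
    using c tr that unfolding measure_prepare_def
    by (simp add: mat_trace_add[of _ "dA' * dB'"] mat_trace_smult[of _ "dA' * dB'"] N)
  moreover have "completely_positive ?D (dA' * dB')
      (partial_transpose dA' dB' \<circ> measure_prepare ?D M ?N A B \<circ> partial_transpose dA dB)"
  proof (rule completely_positive_cong[OF completely_positive_measure_prepare[OF psd']])
    fix X :: "complex mat" assume X: "X \<in> carrier_mat ?D ?D"
    show "(partial_transpose dA' dB' \<circ> measure_prepare ?D M ?N A B \<circ> partial_transpose dA dB) X =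
        measure_prepare ?D M' N' A' B' X"
      unfolding eq[OF X, symmetric] using c X
      by (simp add: measure_prepare_def partial_transpose_add partial_transpose_smult
          trace_pair_partial_transpose_swap partial_transpose_diff partial_transpose_one
          trace_pair_diff_left trace_pair_one_left mat_trace_partial_transpose)
  qed
  ultimately show ?thesis by (simp add: ppt_operations_def cptp_def)
qed

section \<open>Bounds for PPT operations\<close>

lemma bip_tensor_mult:
  assumes "M \<in> carrier_mat (dA1 * dB1) (dA1 * dB1)" "M' \<in> carrier_mat (dA1 * dB1) (dA1 * dB1)"
    "N \<in> carrier_mat (dA2 * dB2) (dA2 * dB2)" "N' \<in> carrier_mat (dA2 * dB2) (dA2 * dB2)"
  shows "bip_tensor dA1 dB1 dA2 dB2 M N * bip_tensor dA1 dB1 dA2 dB2 M' N' =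
    bip_tensor dA1 dB1 dA2 dB2 (M * M') (N * N')"
proof (rule eq_matI)
  let ?T = "bip_tensor dA1 dB1 dA2 dB2" and ?D = "(dA1 * dA2) * (dB1 * dB2)"
  let ?f = "fst_index dB1 dA2 dB2" and ?s = "snd_index dB1 dA2 dB2"
  fix i j assume "i < dim_row (?T (M * M') (N * N'))" "j < dim_col (?T (M * M') (N * N'))"
  then have ij: "i < ?D" "j < ?D" by (auto simp: bip_tensor_def)
  note l = fst_index_less[OF ij(1)] fst_index_less[OF ij(2)] snd_index_less[OF ij(1)] snd_index_less[OF ij(2)]
  have "(?T M N * ?T M' N') $$ (i, j) = (\<Sum>k<?D. ?T M N $$ (i, k) * ?T M' N' $$ (k, j))"
    by (rule mat_mult_index) (use ij in auto)
  also have "\<dots> = (\<Sum>k<?D. (M $$ (?f i, ?f k) * M' $$ (?f k, ?f j)) * (N $$ (?s i, ?s k) * N' $$ (?s k, ?s j)))"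
    by (intro sum.cong refl) (simp add: bip_tensor_index ij)
  also have "\<dots> = (\<Sum>p<dA1 * dB1. \<Sum>q<dA2 * dB2. (M $$ (?f i, p) * M' $$ (p, ?f j)) * (N $$ (?s i, q) * N' $$ (q, ?s j)))"
    by (rule sum_fst_snd_index)
  also have "\<dots> = (M * M') $$ (?f i, ?f j) * (N * N') $$ (?s i, ?s j)"
    unfolding mat_mult_index[OF assms(1,2) l(1,2)] mat_mult_index[OF assms(3,4) l(3,4)] sum_product ..
  also have "\<dots> = ?T (M * M') (N * N') $$ (i, j)" by (simp add: bip_tensor_index ij)
  finally show "(?T M N * ?T M' N') $$ (i, j) = ?T (M * M') (N * N') $$ (i, j)" .
qed (auto simp: bip_tensor_def)

lemma bip_power_mult:
  assumes "M \<in> carrier_mat (dA * dB) (dA * dB)" "N \<in> carrier_mat (dA * dB) (dA * dB)"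
  shows "bip_power dA dB M n * bip_power dA dB N n = bip_power dA dB (M * N) n"
proof (induction n)
  case (Suc n)
  then show ?case using bip_tensor_mult[OF assms bip_power_carrier bip_power_carrier] by simp
qed simp

lemma bip_power_1:
  assumes "M \<in> carrier_mat (dA * dB) (dA * dB)"
  shows "bip_power dA dB M 1 = M"
proof -
  have "bip_tensor dA dB 1 1 M (1\<^sub>m 1) = M"
    using assms by (intro eq_matI) (auto simp: bip_tensor_def fst_index_def snd_index_def)
  then show ?thesis by simp
qed

lemma dominates_scalar_mono:
  assumes "dominates D (complex_of_real c \<cdot>\<^sub>m 1\<^sub>m D) X" "c \<le> c'"
  shows "dominates D (complex_of_real c' \<cdot>\<^sub>m 1\<^sub>m D) X"
proof -
  note X = dominates_carrier(2)[OF assms(1)]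
  have "complex_of_real c' \<cdot>\<^sub>m 1\<^sub>m D + X = complex_of_real (c' - c) \<cdot>\<^sub>m 1\<^sub>m D + (complex_of_real c \<cdot>\<^sub>m 1\<^sub>m D + X)"
    "complex_of_real c' \<cdot>\<^sub>m 1\<^sub>m D - X = complex_of_real (c' - c) \<cdot>\<^sub>m 1\<^sub>m D + (complex_of_real c \<cdot>\<^sub>m 1\<^sub>m D - X)"
    using X by (auto intro!: eq_matI)
  moreover have "psd_mat D (complex_of_real (c' - c) \<cdot>\<^sub>m 1\<^sub>m D)"
    using assms(2) by (intro psd_mat_smult psd_mat_one) simp
  ultimately show ?thesis using assms(1) by (auto simp: dominates_def intro!: psd_mat_add)
qed

lemma trace_norm_diff_self:
  assumes "A \<in> carrier_mat D D"
  shows "trace_norm (A - A) = 0"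
proof -
  have "A - A = 0\<^sub>m D D" using assms by (intro eq_matI) auto
  then show ?thesis
    using trace_norm_le_dominates[OF psd_mat_dominates_self[OF psd_mat_zero, of D]] trace_norm_nonneg[of "0\<^sub>m D D" D]
    by (simp add: mat_trace_def)
qed

section \<open>Overlap bounds for outputs of PPT operations\<close>

lemma ppt_operationsD:
  assumes "\<Lambda> \<in> ppt_operations dA dB dA' dB'"
  shows "completely_positive (dA * dB) (dA' * dB') \<Lambda>"
    and "completely_positive (dA * dB) (dA' * dB') (partial_transpose dA' dB' \<circ> \<Lambda> \<circ> partial_transpose dA dB)"
    and "X \<in> carrier_mat (dA * dB) (dA * dB) \<Longrightarrow> \<Lambda> X \<in> carrier_mat (dA' * dB') (dA' * dB')"
    and "X \<in> carrier_mat (dA * dB) (dA * dB) \<Longrightarrow> mat_trace (\<Lambda> X) = mat_trace X"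
  using assms by (auto simp: ppt_operations_def cptp_def completely_positive_def linear_op_def)

lemma ppt_operations_dominates:
  assumes "\<Lambda> \<in> ppt_operations dA dB dA' dB'" "X \<in> carrier_mat (dA * dB) (dA * dB)"
    and "dominates (dA * dB) G (partial_transpose dA dB X)"
  shows "dominates (dA' * dB') (partial_transpose dA' dB' (\<Lambda> (partial_transpose dA dB G)))
    (partial_transpose dA' dB' (\<Lambda> X))"
  using completely_positive_dominates[OF ppt_operationsD(2)[OF assms(1)] assms(3)] assms(2)
  by (simp add: partial_transpose_partial_transpose)

text \<open>This is the log-negativity bound: for \<open>G\<close> the absolute value of
  \<open>X\<^sup>\<Gamma>\<close> and \<open>Z\<close> a maximally entangled state of Schmidt rank
  \<open>K\<close>, where \<open>c = 1 / K\<close>, the fidelity is at most the trace norm of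
  \<open>X\<^sup>\<Gamma>\<close> divided by \<open>K\<close>.\<close>

lemma ppt_operations_distill_le:
  assumes \<Lambda>: "\<Lambda> \<in> ppt_operations dA dB dA' dB'" and X: "X \<in> carrier_mat (dA * dB) (dA * dB)"
    and G: "dominates (dA * dB) G (partial_transpose dA dB X)"
    and Z: "dominates (dA' * dB') (complex_of_real c \<cdot>\<^sub>m 1\<^sub>m (dA' * dB')) (partial_transpose dA' dB' Z)"
  shows "Re (trace_pair (dA' * dB') (\<Lambda> X) Z) \<le> c * Re (mat_trace G)"
proof -
  let ?G = "partial_transpose dA dB G"
  have "Re (trace_pair (dA' * dB') (\<Lambda> X) Z) =
      Re (trace_pair (dA' * dB') (partial_transpose dA' dB' (\<Lambda> X)) (partial_transpose dA' dB' Z))"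
    by (simp add: trace_pair_partial_transpose)
  also have "\<dots> \<le> Re (trace_pair (dA' * dB') (partial_transpose dA' dB' (\<Lambda> ?G)) (complex_of_real c \<cdot>\<^sub>m 1\<^sub>m (dA' * dB')))"
    using dominates_trace_pair[OF ppt_operations_dominates[OF \<Lambda> X G] Z] by linarith
  also have "\<dots> = c * Re (mat_trace G)"
    using ppt_operationsD(3,4)[OF \<Lambda>, of ?G] dominates_carrier(1)[OF G]
    by (simp add: trace_pair_one_right mat_trace_partial_transpose)
  finally show ?thesis .
qed

text \<open>Both positivity properties of \<Lambda> enter. The conjugated map carries the scalar
  dominator of \<open>X\<^sup>\<Gamma>\<close> to the output, where \<open>Y\<close> replaces
  \<open>Z\<^sup>\<Gamma>\<close>; then \<Gamma> is moved onto \<open>Y\<close>, and positivity of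
  \<Lambda> on the identity reduces the pairing to a trace.\<close>

lemma ppt_operations_dilute_le:
  assumes \<Lambda>: "\<Lambda> \<in> ppt_operations dA dB dA' dB'" and X: "X \<in> carrier_mat (dA * dB) (dA * dB)"
    and c: "dominates (dA * dB) (complex_of_real c \<cdot>\<^sub>m 1\<^sub>m (dA * dB)) (partial_transpose dA dB X)" "0 \<le> c"
    and Z: "Z \<in> carrier_mat (dA' * dB') (dA' * dB')"
    and Y: "dominates (dA' * dB') Y (partial_transpose dA' dB' Z)"
    and b: "dominates (dA' * dB') (complex_of_real b \<cdot>\<^sub>m 1\<^sub>m (dA' * dB')) (partial_transpose dA' dB' Y)"
  shows "Re (trace_pair (dA' * dB') (\<Lambda> X) Z) \<le> c * b * real (dA * dB)"
proof -
  let ?C = "complex_of_real c \<cdot>\<^sub>m 1\<^sub>m (dA * dB)" and ?p = "partial_transpose dA' dB'" and ?D = "dA' * dB'"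
  have C: "?C \<in> carrier_mat (dA * dB) (dA * dB)" by simp
  have ptC: "partial_transpose dA dB ?C = ?C"
    by (simp add: partial_transpose_smult partial_transpose_one)
  have \<Lambda>C: "psd_mat ?D (\<Lambda> ?C)"
    by (rule completely_positive_psd[OF ppt_operationsD(1)[OF \<Lambda>]])
      (intro psd_mat_smult psd_mat_one c(2))
  have "Re (trace_pair ?D (\<Lambda> X) Z) = Re (trace_pair ?D (?p (\<Lambda> X)) (?p Z))"
    by (simp add: trace_pair_partial_transpose)
  also have "\<dots> \<le> Re (trace_pair ?D (?p (\<Lambda> ?C)) Y)"
    using dominates_trace_pair[OF ppt_operations_dominates[OF \<Lambda> X c(1)] Y] unfolding ptC by linarith
  also have "\<dots> = Re (trace_pair ?D (\<Lambda> ?C) (?p Y))"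
    using trace_pair_partial_transpose_swap[OF ppt_operationsD(3)[OF \<Lambda> C], of Y] by simp
  also have "\<dots> \<le> Re (trace_pair ?D (\<Lambda> ?C) (complex_of_real b \<cdot>\<^sub>m 1\<^sub>m ?D))"
    using dominates_trace_pair[OF psd_mat_dominates_self[OF \<Lambda>C] b] by linarith
  also have "\<dots> = b * Re (mat_trace ?C)"
    using ppt_operationsD(3,4)[OF \<Lambda> C] by (simp add: trace_pair_one_right)
  also have "mat_trace ?C = c * (dA * dB)"
    unfolding mat_trace_smult[OF one_carrier_mat] by (simp add: mat_trace_def)
  finally show ?thesis by (simp add: mult_ac)
qed

text \<open>A real infimum over the empty set carries no information, so this is what allows
  operations to be extracted from a vanishing infimum. The witness is the constant map to the
  maximally mixed state.\<close>

lemma ppt_operations_nonempty: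
  assumes "0 < dA'" "0 < dB'"
  shows "ppt_operations dA dB dA' dB' \<noteq> {}"
proof -
  let ?A = "complex_of_real (1 / real (dA' * dB')) \<cdot>\<^sub>m 1\<^sub>m (dA' * dB')"
  have A: "psd_mat (dA' * dB') ?A" by (intro psd_mat_smult psd_mat_one) simp
  have "mat_trace ?A = 1"
    unfolding mat_trace_smult[OF one_carrier_mat] using assms by (simp add: mat_trace_def)
  moreover have "1\<^sub>m (dA * dB) - 1\<^sub>m (dA * dB) = (0\<^sub>m (dA * dB) (dA * dB) :: complex mat)"
    by (intro eq_matI) auto
  then have "psd_mat (dA * dB) (1\<^sub>m (dA * dB) - 1\<^sub>m (dA * dB))" by (simp only: psd_mat_zero)
  ultimately have "measure_prepare (dA * dB) (1\<^sub>m (dA * dB)) (1\<^sub>m (dA * dB) - 1\<^sub>m (dA * dB)) ?A ?A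
      \<in> ppt_operations dA dB dA' dB'"
    using A psd_mat_one[of "dA * dB"]
    by (intro measure_prepare_ppt[where M' = "1\<^sub>m (dA * dB)" and N' = "1\<^sub>m (dA * dB) - 1\<^sub>m (dA * dB)" and A' = ?A and B' = ?A])
      (auto simp: measure_prepare_def partial_transpose_one partial_transpose_smult trace_pair_one_left trace_pair_diff_left)
  then show ?thesis by blast
qed

section \<open>Exact distillation and exact dilution\<close>

text \<open>Both operations below measure \<open>{M, 1 - M}\<close> and prepare a state for each outcome.  Conjugation
  by the partial transposes turns these operators into non-positive ones, but the conjugated map can
  be rewritten with the positive operators \<open>1 \<plusminus> K X\<^sup>\<Gamma>\<close>; entrywise, this identity is that rewriting.\<close>

lemma twirl_identity:
  fixes K m x \<phi> \<delta> :: complex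
  assumes "K \<noteq> 0" "K - 1 \<noteq> 0" "K + 1 \<noteq> 0"
  shows "m * \<phi> + (x - m) * (1 / (K * K - 1) * (\<delta> - \<phi>)) =
    (x + K * m) * (1 / (2 * (K + 1)) * (1 / K * \<delta> + \<phi>)) + (x - K * m) * (1 / (2 * (K - 1)) * (1 / K * \<delta> - \<phi>))"
proof -
  have "K * K - 1 = (K - 1) * (K + 1)" by (simp add: algebra_simps)
  moreover have "(K - 1) * (K + 1) \<noteq> 0" using assms by simp
  moreover have "2 + K * 2 \<noteq> 0"
  proof -
    have "2 + K * 2 = 2 * (K + 1)" by simp
    then show ?thesis using assms(3) by (metis mult_eq_0_iff zero_neq_numeral)
  qed
  ultimately show ?thesis using assms by (simp add: divide_simps) (simp add: algebra_simps)
qed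

lemma psd_mat_scaled_sum:
  assumes "dominates D (complex_of_real (1 / K) \<cdot>\<^sub>m A) X" "0 < K"
  shows "psd_mat D (A + complex_of_real K \<cdot>\<^sub>m X)" "psd_mat D (A - complex_of_real K \<cdot>\<^sub>m X)"
proof -
  have "complex_of_real K \<cdot>\<^sub>m (complex_of_real (1 / K) \<cdot>\<^sub>m A) = A"
    using assms(2) by (intro eq_matI) auto
  then have "dominates D A (complex_of_real K \<cdot>\<^sub>m X)"
    using dominates_smult[OF assms(1), of K] assms(2) by simp
  then show "psd_mat D (A + complex_of_real K \<cdot>\<^sub>m X)" "psd_mat D (A - complex_of_real K \<cdot>\<^sub>m X)"
    by (auto simp: dominates_def)
qed

lemma measure_prepare_exact:
  assumes "trace_pair D M X = 1" "mat_trace X = 1" "M \<in> carrier_mat D D" "X \<in> carrier_mat D D"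
    and "A \<in> carrier_mat D' D'" "B \<in> carrier_mat D' D'"
  shows "measure_prepare D M (1\<^sub>m D - M) A B X = A"
  using assms by (intro eq_matI) (auto simp: measure_prepare_def trace_pair_diff_left trace_pair_one_left)

text \<open>The test \<open>M\<close> accepts \<open>X\<close> with certainty. Acceptance prepares
  the target, rejection prepares \<open>B\<close>, the normalised complement of the target. The
  scalar bound on \<open>M\<^sup>\<Gamma>\<close> is exactly the positivity of \<open>M'\<close> and
  \<open>N'\<close>.\<close>

lemma exact_distillation:
  assumes K: "K = 2 ^ k" "0 < k"
    and M: "psd_mat (dA * dB) M" "psd_mat (dA * dB) (1\<^sub>m (dA * dB) - M)"
      "dominates (dA * dB) (complex_of_real (1 / real K) \<cdot>\<^sub>m 1\<^sub>m (dA * dB)) (partial_transpose dA dB M)"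
    and X: "X \<in> carrier_mat (dA * dB) (dA * dB)" "trace_pair (dA * dB) M X = 1" "mat_trace X = 1"
  shows "\<exists>\<Lambda> \<in> ppt_operations dA dB K K. \<Lambda> X = ebits k"
proof -
  let ?D = "dA * dB" and ?c = "1 / real K" and ?\<Phi> = "ebits k" and ?pt = "partial_transpose K K (ebits k)"
  let ?ptM = "partial_transpose dA dB M"
  \<comment> \<open>The normalisation of \<open>B'\<close> divides by \<open>K - 1\<close>, hence
    the demand for at least one ebit.\<close>
  have K2: "K \<ge> 2" using K by (cases k) auto
  have \<Phi>: "?\<Phi> \<in> carrier_mat (K * K) (K * K)" using K by simp
  have \<Phi>d: "dominates (K * K) (1\<^sub>m (K * K)) ?\<Phi>" "dominates (K * K) (complex_of_real ?c \<cdot>\<^sub>m 1\<^sub>m (K * K)) ?pt"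
    using ebits_le_one[of k] ebits_partial_transpose[of k] K(1) by simp_all
  define B where "B = complex_of_real (1 / (real K * real K - 1)) \<cdot>\<^sub>m (1\<^sub>m (K * K) - ?\<Phi>)"
  \<comment> \<open>The partial transpose of \<open>ebits k\<close> is the swap operator divided by
    \<open>K\<close>, so \<open>A'\<close> and \<open>B'\<close> are half the normalised projections
    onto the symmetric and the antisymmetric subspace.\<close>
  define A' where "A' = complex_of_real (1 / (2 * (real K + 1))) \<cdot>\<^sub>m (complex_of_real ?c \<cdot>\<^sub>m 1\<^sub>m (K * K) + ?pt)"
  define B' where "B' = complex_of_real (1 / (2 * (real K - 1))) \<cdot>\<^sub>m (complex_of_real ?c \<cdot>\<^sub>m 1\<^sub>m (K * K) - ?pt)"
  define M' where "M' = 1\<^sub>m ?D + complex_of_real (real K) \<cdot>\<^sub>m ?ptM"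
  define N' where "N' = 1\<^sub>m ?D - complex_of_real (real K) \<cdot>\<^sub>m ?ptM"
  have KK: "real K * real K \<ge> 4" using K2 mult_mono[of 2 "real K" 2 "real K"] by simp
  have Bc: "1\<^sub>m (K * K) - ?\<Phi> \<in> carrier_mat (K * K) (K * K)" using \<Phi> by (rule minus_carrier_mat)
  have "psd_mat (K * K) B"
    unfolding B_def using \<Phi>d(1) KK by (intro psd_mat_smult) (auto simp: dominates_def)
  moreover have "mat_trace B = 1"
  proof -
    have "mat_trace B = complex_of_real (1 / (real K * real K - 1)) * (complex_of_real (real K * real K) - 1)"
      unfolding B_def mat_trace_smult[OF Bc] mat_trace_diff[OF one_carrier_mat \<Phi>] ebits_trace by (simp add: mat_trace_def)
    also have "\<dots> = complex_of_real (1 / (real K * real K - 1) * (real K * real K - 1))"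
      by (simp only: of_real_mult of_real_diff of_real_1)
    also have "1 / (real K * real K - 1) * (real K * real K - 1) = 1" using KK by simp
    finally show ?thesis by simp
  qed
  moreover have "psd_mat ?D M'" "psd_mat ?D N'"
    unfolding M'_def N'_def using psd_mat_scaled_sum[OF M(3)] K2 by auto
  moreover have "psd_mat (K * K) A'" "psd_mat (K * K) B'"
    unfolding A'_def B'_def using \<Phi>d(2) K2 by (auto intro!: psd_mat_smult simp del: of_real_divide simp: dominates_def)
  moreover have "trace_pair ?D ?ptM W \<cdot>\<^sub>m ?pt + (mat_trace W - trace_pair ?D ?ptM W) \<cdot>\<^sub>m partial_transpose K K B =
      measure_prepare ?D M' N' A' B' W" if W: "W \<in> carrier_mat ?D ?D" for W
  proof -
    have tp: "trace_pair ?D M' W = mat_trace W + of_nat K * trace_pair ?D ?ptM W"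
      "trace_pair ?D N' W = mat_trace W - of_nat K * trace_pair ?D ?ptM W"
      unfolding M'_def N'_def using W by (simp_all add: trace_pair_add_left trace_pair_diff_left trace_pair_one_left)
    have ptB: "partial_transpose K K B = complex_of_real (1 / (real K * real K - 1)) \<cdot>\<^sub>m (1\<^sub>m (K * K) - ?pt)"
      unfolding B_def partial_transpose_smult[OF Bc] partial_transpose_diff[OF one_carrier_mat \<Phi>] partial_transpose_one ..
    have "complex_of_nat K \<noteq> 0" "complex_of_nat K - 1 \<noteq> 0" "complex_of_nat K + 1 \<noteq> 0"
      using K2 by (auto simp: complex_eq_iff)
    note id = twirl_identity[OF this]
    show ?thesis
    proof (rule eq_matI)
      let ?x = "mat_trace W" and ?f = "trace_pair ?D ?ptM W"
      fix i j assume "i < dim_row (measure_prepare ?D M' N' A' B' W)" "j < dim_col (measure_prepare ?D M' N' A' B' W)"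
      then have ij: "i < K * K" "j < K * K" by (auto simp: measure_prepare_def B'_def)
      show "(?f \<cdot>\<^sub>m ?pt + (?x - ?f) \<cdot>\<^sub>m partial_transpose K K B) $$ (i, j) = measure_prepare ?D M' N' A' B' W $$ (i, j)"
        using id[of ?f "?pt $$ (i, j)" ?x "1\<^sub>m (K * K) $$ (i, j)"] ij
        unfolding measure_prepare_def tp ptB A'_def B'_def
        by (simp add: mult_ac)
    qed (auto simp: measure_prepare_def B'_def ptB)
  qed
  ultimately have "measure_prepare ?D M (1\<^sub>m ?D - M) ?\<Phi> B \<in> ppt_operations dA dB K K"
    using M ebits_psd[of k] ebits_trace K(1) by (intro measure_prepare_ppt) auto
  moreover have "B \<in> carrier_mat (K * K) (K * K)" unfolding B_def using Bc by simp
  then have "measure_prepare ?D M (1\<^sub>m ?D - M) ?\<Phi> B X = ?\<Phi>"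
    using X M(1) \<Phi> psd_mat_carrier by (intro measure_prepare_exact) auto
  ultimately show ?thesis by blast
qed

text \<open>The roles of tested and prepared operators are exchanged compared with distillation. The
  operation built here sends the identity to \<omega>, since rejection has trace
  \<open>K * K - 1\<close> and prepares \<open>B\<close>; this explains the trace of
  \<omega>.\<close>

lemma exact_dilution:
  assumes K: "K = 2 ^ k" "0 < k"
    and \<rho>: "psd_mat (dA * dB) \<rho>" "mat_trace \<rho> = 1"
    and \<omega>: "dominates (dA * dB) \<omega> \<rho>" "mat_trace \<omega> = of_nat (K * K)" "partial_transpose dA dB \<omega> = \<omega>"
      "dominates (dA * dB) \<omega> (complex_of_real (real K) \<cdot>\<^sub>m partial_transpose dA dB \<rho>)"
  shows "\<exists>\<Lambda> \<in> ppt_operations K K dA dB. \<Lambda> (ebits k) = \<rho>"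
proof -
  let ?D = "dA * dB" and ?c = "1 / real K" and ?\<Phi> = "ebits k" and ?pt = "partial_transpose K K (ebits k)"
  let ?pt\<rho> = "partial_transpose dA dB \<rho>"
  have K2: "K \<ge> 2" using K by (cases k) auto
  have \<Phi>: "?\<Phi> \<in> carrier_mat (K * K) (K * K)" using K by simp
  have \<Phi>d: "dominates (K * K) (1\<^sub>m (K * K)) ?\<Phi>" "dominates (K * K) (complex_of_real ?c \<cdot>\<^sub>m 1\<^sub>m (K * K)) ?pt"
    using ebits_le_one[of k] ebits_partial_transpose[of k] K(1) by simp_all
  have \<rho>c: "\<rho> \<in> carrier_mat ?D ?D" and \<omega>c: "\<omega> \<in> carrier_mat ?D ?D"
    using dominates_carrier[OF \<omega>(1)] by auto
  define B where "B = complex_of_real (1 / (real K * real K - 1)) \<cdot>\<^sub>m (\<omega> - \<rho>)"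
  define A' where "A' = complex_of_real (1 / (2 * (real K + 1))) \<cdot>\<^sub>m (\<omega> + complex_of_real (real K) \<cdot>\<^sub>m ?pt\<rho>)"
  define B' where "B' = complex_of_real (1 / (2 * (real K - 1))) \<cdot>\<^sub>m (\<omega> - complex_of_real (real K) \<cdot>\<^sub>m ?pt\<rho>)"
  define M' where "M' = complex_of_real ?c \<cdot>\<^sub>m 1\<^sub>m (K * K) + ?pt"
  define N' where "N' = complex_of_real ?c \<cdot>\<^sub>m 1\<^sub>m (K * K) - ?pt"
  have KK: "real K * real K \<ge> 4" using K2 mult_mono[of 2 "real K" 2 "real K"] by simp
  have Bc: "\<omega> - \<rho> \<in> carrier_mat ?D ?D" using \<rho>c by (rule minus_carrier_mat)
  have "psd_mat ?D B"
    unfolding B_def using \<omega>(1) KK by (intro psd_mat_smult) (auto simp: dominates_def)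
  moreover have "mat_trace B = 1"
  proof -
    have "mat_trace B = complex_of_real (1 / (real K * real K - 1)) * (complex_of_real (real K * real K) - 1)"
      unfolding B_def mat_trace_smult[OF Bc] mat_trace_diff[OF \<omega>c \<rho>c] \<rho>(2) \<omega>(2) by simp
    also have "\<dots> = complex_of_real (1 / (real K * real K - 1) * (real K * real K - 1))"
      by (simp only: of_real_mult of_real_diff of_real_1)
    also have "1 / (real K * real K - 1) * (real K * real K - 1) = 1" using KK by simp
    finally show ?thesis by simp
  qed
  moreover have "psd_mat (K * K) M'" "psd_mat (K * K) N'"
    unfolding M'_def N'_def using \<Phi>d(2) by (auto simp: dominates_def)
  moreover have "psd_mat ?D A'" "psd_mat ?D B'"
    unfolding A'_def B'_def using \<omega>(4) K2 by (auto intro!: psd_mat_smult simp del: of_real_divide simp: dominates_def)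
  moreover have "trace_pair (K * K) ?pt W \<cdot>\<^sub>m ?pt\<rho> + (mat_trace W - trace_pair (K * K) ?pt W) \<cdot>\<^sub>m partial_transpose dA dB B =
      measure_prepare (K * K) M' N' A' B' W" if W: "W \<in> carrier_mat (K * K) (K * K)" for W
  proof -
    have tp: "trace_pair (K * K) M' W = 1 / of_nat K * mat_trace W + trace_pair (K * K) ?pt W"
      "trace_pair (K * K) N' W = 1 / of_nat K * mat_trace W - trace_pair (K * K) ?pt W"
      unfolding M'_def N'_def using W by (simp_all add: trace_pair_add_left trace_pair_diff_left trace_pair_one_left)
    have ptB: "partial_transpose dA dB B = complex_of_real (1 / (real K * real K - 1)) \<cdot>\<^sub>m (\<omega> - ?pt\<rho>)"
      unfolding B_def partial_transpose_smult[OF Bc] partial_transpose_diff[OF \<omega>c \<rho>c] \<omega>(3) ..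
    have "complex_of_nat K \<noteq> 0" "complex_of_nat K - 1 \<noteq> 0" "complex_of_nat K + 1 \<noteq> 0"
      using K2 by (auto simp: complex_eq_iff)
    note id = twirl_identity[OF this]
    show ?thesis
    proof (rule eq_matI)
      let ?x = "mat_trace W" and ?f = "trace_pair (K * K) ?pt W"
      fix i j assume "i < dim_row (measure_prepare (K * K) M' N' A' B' W)" "j < dim_col (measure_prepare (K * K) M' N' A' B' W)"
      then have ij: "i < ?D" "j < ?D" using \<omega>c by (auto simp: measure_prepare_def B'_def)
      show "(?f \<cdot>\<^sub>m ?pt\<rho> + (?x - ?f) \<cdot>\<^sub>m partial_transpose dA dB B) $$ (i, j) = measure_prepare (K * K) M' N' A' B' W $$ (i, j)"
        using id[of "?pt\<rho> $$ (i, j)" ?f "\<omega> $$ (i, j)" ?x] ij \<omega>c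
        unfolding measure_prepare_def tp ptB A'_def B'_def
        by (simp add: mult_ac)
    qed (use \<omega>c in \<open>auto simp: measure_prepare_def B'_def ptB\<close>)
  qed
  ultimately have "measure_prepare (K * K) ?\<Phi> (1\<^sub>m (K * K) - ?\<Phi>) \<rho> B \<in> ppt_operations K K dA dB"
    using \<rho> ebits_psd[of k] \<Phi>d(1) K(1) by (intro measure_prepare_ppt) (auto simp: dominates_def)
  moreover have "B \<in> carrier_mat ?D ?D" unfolding B_def using Bc by simp
  then have "measure_prepare (K * K) ?\<Phi> (1\<^sub>m (K * K) - ?\<Phi>) \<rho> B ?\<Phi> = \<rho>"
    using \<Phi> \<rho>c ebits_trace_pair[of k] ebits_trace K(1) by (intro measure_prepare_exact) auto
  ultimately show ?thesis by blast
qed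

section \<open>The witnesses\<close>

definition tau :: real where "tau = 1 + 1 / sqrt 2"

lemma tau_inverse: "1 / tau = 2 - sqrt 2"
proof -
  have "1 / sqrt 2 = sqrt 2 / 2" by (subst frac_eq_eq) simp_all
  then have "(2 - sqrt 2) * tau = 1" by (simp add: tau_def algebra_simps)
  moreover have "tau > 0" by (simp add: tau_def add_pos_pos)
  ultimately show ?thesis by (simp add: eq_divide_eq divide_eq_eq)
qed

lemma tau_bounds: "1 < tau" "tau < 2"
proof -
  have "1 < sqrt 2" by simp
  then show "1 < tau" "tau < 2" by (simp_all add: tau_def)
qed

lemma inverse_tau_bounds: "1 / 2 < 1 / tau" "1 / tau < 1"
  using tau_bounds by simp_all

text \<open>The transpose of \<open>flip_mat 1\<close> has eigenvalue \<open>1 / tau\<close> at 01,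
  10, 02, 20 and \<plusminus>\<surd>2 (1 - 1/\<tau>) on the block 00, 11, 22. Balancing the two
  moduli fixes the weight; this is the balance, squared.\<close>

lemma inverse_tau_quadratic: "2 * (1 / tau - 1)\<^sup>2 = (1 / tau)\<^sup>2"
  unfolding tau_inverse by (simp add: power2_eq_square algebra_simps)

text \<open>The matrix \<open>flip_mat 1\<close> is the support projection of \<open>rho_v\<close>, which lives on antisymmetric vectors, plus
  \<open>3 - 2 \<surd>2\<close> times its symmetric counterpart; this weight minimises the norm of the partial transpose.\<close>

definition flip_mat :: "real \<Rightarrow> complex mat" where
  "flip_mat c = sym_mat 0 (c * (1 / tau)) 0 0 (c * (1 / tau - 1)) 0 0 0"

abbreviation rho_pow :: "nat \<Rightarrow> complex mat" where
  "rho_pow \<equiv> bip_power 3 3 rho_v"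

abbreviation pdim :: "nat \<Rightarrow> nat" where
  "pdim n \<equiv> 3 ^ n * 3 ^ n"

lemma rho_v_carrier [simp]: "rho_v \<in> carrier_mat (3 * 3) (3 * 3)"
  by (simp add: rho_v_eq)

lemma rho_v_partial_transpose: "partial_transpose 3 3 rho_v = sym_mat 0 (1 / 4) 0 0 0 (- 1 / 4) 0 0"
  unfolding rho_v_eq sym_mat_partial_transpose by simp

lemma rho_pow_psd: "psd_mat (pdim n) (rho_pow n)"
  by (rule bip_power_psd) (simp add: rho_v_eq sym_mat_psd)

lemma rho_pow_trace: "mat_trace (rho_pow n) = 1"
  unfolding mat_trace_bip_power[OF rho_v_carrier] by (simp add: rho_v_eq sym_mat_trace)

lemma rho_pow_mult: "rho_pow n * rho_pow n = complex_of_real ((1 / 2) ^ n) \<cdot>\<^sub>m rho_pow n"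
proof -
  have "rho_v * rho_v = complex_of_real (1 / 2) \<cdot>\<^sub>m rho_v"
    unfolding rho_v_eq sym_mat_mult sym_mat_smult by simp
  then show ?thesis
    unfolding bip_power_mult[OF rho_v_carrier rho_v_carrier] by (simp only: bip_power_smult[OF rho_v_carrier] of_real_power)
qed

lemma rho_pow_le: "dominates (pdim n) (complex_of_real ((1 / 2) ^ n) \<cdot>\<^sub>m 1\<^sub>m (pdim n)) (rho_pow n)"
proof -
  have "dominates 9 (complex_of_real (1 / 2) \<cdot>\<^sub>m 1\<^sub>m 9) rho_v"
    unfolding rho_v_eq sym_mat_scalar by (rule sym_mat_dominates) simp_all
  then have "dominates (3 * 3) (complex_of_real (1 / 2) \<cdot>\<^sub>m 1\<^sub>m (3 * 3)) rho_v" by simp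
  from bip_power_dominates[OF this, of n] show ?thesis
    by (simp only: bip_power_smult[OF one_carrier_mat] bip_power_one of_real_power)
qed

lemma flip_mat_carrier [simp]: "flip_mat c \<in> carrier_mat (3 * 3) (3 * 3)"
  by (simp add: flip_mat_def)

lemma flip_pow_partial_transpose:
  assumes "0 \<le> c"
  shows "dominates (pdim n) (complex_of_real ((c * (1 / tau)) ^ n) \<cdot>\<^sub>m 1\<^sub>m (pdim n))
    (partial_transpose (3 ^ n) (3 ^ n) (bip_power 3 3 (flip_mat c) n))"
proof -
  have q: "2 * (c * (1 / tau - 1))\<^sup>2 = (c * (1 / tau)) * (c * (1 / tau))"
  proof -
    have "2 * (c * (1 / tau - 1))\<^sup>2 = c\<^sup>2 * (2 * (1 / tau - 1)\<^sup>2)" by (simp add: power_mult_distrib)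
    then show ?thesis unfolding inverse_tau_quadratic by (simp add: power2_eq_square)
  qed
  have "0 \<le> c * (1 / tau)" using assms tau_bounds by simp
  then have "dominates 9 (sym_mat (c * (1 / tau)) (c * (1 / tau)) (c * (1 / tau)) (c * (1 / tau)) 0 0 0 0)
      (sym_mat 0 (c * (1 / tau)) 0 0 0 (c * (1 / tau - 1)) 0 0)"
    using q by (intro sym_mat_dominates) simp_all
  then have "dominates (3 * 3) (complex_of_real (c * (1 / tau)) \<cdot>\<^sub>m 1\<^sub>m (3 * 3)) (partial_transpose 3 3 (flip_mat c))"
    unfolding flip_mat_def sym_mat_partial_transpose using sym_mat_scalar[of "c * (1 / tau)"] by simp
  from bip_power_dominates[OF this, of n] show ?thesis
    by (simp only: bip_power_smult[OF one_carrier_mat] bip_power_one of_real_power partial_transpose_bip_power)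
qed

text \<open>At scale 1/2 the antisymmetric part of \<open>flip_mat\<close> is \<open>rho_v\<close>
  itself and the symmetric part is an added positive term; scale 1 is the distillation test.\<close>

lemma rho_pow_le_flip: "dominates (pdim n) (bip_power 3 3 (flip_mat (1 / 2)) n) (rho_pow n)"
proof (rule bip_power_dominates)
  show "dominates (3 * 3) (flip_mat (1 / 2)) rho_v"
  proof -
    define u where "u = 1 / tau"
    have "1 / 2 < u" "u < 1" using inverse_tau_bounds by (simp_all add: u_def)
    then have "dominates 9 (flip_mat (1 / 2)) rho_v"
      unfolding flip_mat_def rho_v_eq u_def[symmetric]
      by (intro sym_mat_dominates) (auto simp: abs_le_iff diff_divide_distrib)
    then show ?thesis by simp
  qed
qed

lemma flip_pow_le_one: "dominates (pdim n) (1\<^sub>m (pdim n)) (bip_power 3 3 (flip_mat 1) n)"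
proof -
  have "dominates (3 * 3) (1\<^sub>m (3 * 3)) (flip_mat 1)"
  proof -
    define u where "u = 1 / tau"
    have "1 / 2 < u" "u < 1" using inverse_tau_bounds by (simp_all add: u_def)
    then have "dominates 9 (1\<^sub>m 9) (flip_mat 1)"
      unfolding flip_mat_def sym_mat_one u_def[symmetric] by (intro sym_mat_dominates) auto
    then show ?thesis by simp
  qed
  from bip_power_dominates[OF this, of n] show ?thesis by (simp only: bip_power_one)
qed

lemma flip_pow_psd: "psd_mat (pdim n) (bip_power 3 3 (flip_mat 1) n)"
  by (rule bip_power_psd) (use inverse_tau_bounds in \<open>simp add: flip_mat_def sym_mat_psd\<close>)

lemma flip_pow_trace_pair: "trace_pair (pdim n) (bip_power 3 3 (flip_mat 1) n) (rho_pow n) = 1"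
proof -
  have "trace_pair (3 * 3) (flip_mat 1) rho_v = 1"
    unfolding flip_mat_def rho_v_eq using sym_mat_trace_pair by (simp add: algebra_simps)
  then show ?thesis by (simp add: trace_pair_bip_power[OF flip_mat_carrier])
qed

text \<open>The absolute value of the partial transpose of \<open>rho_v\<close>.\<close>

definition abs_pt_mat :: "complex mat" where
  "abs_pt_mat = sym_mat (1 / (2 * sqrt 2)) (1 / 4) (1 / (4 * sqrt 2)) 0 0 0 (1 / (4 * sqrt 2)) 0"

lemma abs_pt_mat_dominates: "dominates (3 * 3) abs_pt_mat (partial_transpose 3 3 rho_v)"
  unfolding abs_pt_mat_def rho_v_partial_transpose
  by (simp, rule sym_mat_dominates) (simp_all add: power2_eq_square)

lemma abs_pt_mat_trace: "mat_trace abs_pt_mat = complex_of_real tau"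
  unfolding abs_pt_mat_def sym_mat_trace tau_def by (intro arg_cong[of _ _ complex_of_real]) (simp add: field_simps)

text \<open>This \<open>Y\<close> dominates \<open>rho_v\<^sup>\<Gamma>\<close> without being above its absolute value: lowering the entry at \<open>00\<close>
  at the expense of the block on \<open>11, 22\<close> is what brings the norm of \<open>Y\<^sup>\<Gamma>\<close> down to \<open>1/4\<close>.\<close>

definition dual_mat :: "complex mat" where
  "dual_mat = sym_mat (1 / 4) (1 / 4) (1 / 4) 0 0 0 (1 / 4) 0"

text \<open>Every dominator of \<open>rho_v\<^sup>\<Gamma>\<close> has diagonal entries at least 1/4
  at 01, 10, 02, 20, and \<Gamma> keeps diagonals, so 1/4 is the best possible norm. With 1/4 also
  at 00, the Schur condition 2 (1/4)(1/4) = 1/4 (1/4 + 1/4) of the block on 00, 11, 22 is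
  tight.\<close>

lemma dual_pow_dominates:
  "dominates (pdim n) (bip_power 3 3 dual_mat n) (partial_transpose (3 ^ n) (3 ^ n) (rho_pow n))"
proof -
  have "dominates (3 * 3) dual_mat (partial_transpose 3 3 rho_v)"
    unfolding dual_mat_def rho_v_partial_transpose
    by (simp, rule sym_mat_dominates) (simp_all add: power2_eq_square)
  from bip_power_dominates[OF this, of n] show ?thesis by (simp only: partial_transpose_bip_power)
qed

lemma dual_pow_partial_transpose:
  "dominates (pdim n) (complex_of_real ((1 / 4) ^ n) \<cdot>\<^sub>m 1\<^sub>m (pdim n))
    (partial_transpose (3 ^ n) (3 ^ n) (bip_power 3 3 dual_mat n))"
proof -
  have "dominates 9 (complex_of_real (1 / 4) \<cdot>\<^sub>m 1\<^sub>m 9) (partial_transpose 3 3 dual_mat)"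
    unfolding dual_mat_def sym_mat_partial_transpose sym_mat_scalar by (rule sym_mat_dominates) simp_all
  then have "dominates (3 * 3) (complex_of_real (1 / 4) \<cdot>\<^sub>m 1\<^sub>m (3 * 3)) (partial_transpose 3 3 dual_mat)" by simp
  from bip_power_dominates[OF this, of n] show ?thesis
    by (simp only: bip_power_smult[OF one_carrier_mat] bip_power_one of_real_power partial_transpose_bip_power)
qed

text \<open>The image of the identity under the one-copy preparation of \<open>rho_v\<close> from a Bell pair by
  local isometries.\<close>

definition mixed_mat :: "complex mat" where
  "mixed_mat = sym_mat 1 (1 / 2) (1 / 2) 0 0 0 0 0"

lemma mixed_pow_dominates: "dominates (pdim n) (bip_power 3 3 mixed_mat n) (rho_pow n)"
  by (rule bip_power_dominates) (simp add: mixed_mat_def rho_v_eq sym_mat_dominates)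

lemma mixed_pow_trace: "mat_trace (bip_power 3 3 mixed_mat n) = of_nat (2 ^ n * 2 ^ n)"
proof -
  have "mixed_mat \<in> carrier_mat (3 * 3) (3 * 3)" by (simp add: mixed_mat_def)
  then have "mat_trace (bip_power 3 3 mixed_mat n) = mat_trace mixed_mat ^ n" by (rule mat_trace_bip_power)
  also have "\<dots> = 4 ^ n" by (simp add: mixed_mat_def sym_mat_trace)
  finally show ?thesis by (simp flip: power_mult_distrib)
qed

lemma mixed_pow_partial_transpose:
  "partial_transpose (3 ^ n) (3 ^ n) (bip_power 3 3 mixed_mat n) = bip_power 3 3 mixed_mat n"
  unfolding partial_transpose_bip_power by (simp add: mixed_mat_def sym_mat_partial_transpose)

lemma mixed_pow_dominates_pt:
  "dominates (pdim n) (bip_power 3 3 mixed_mat n)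
    (complex_of_real (real (2 ^ n)) \<cdot>\<^sub>m partial_transpose (3 ^ n) (3 ^ n) (rho_pow n))"
proof -
  have "dominates 9 mixed_mat (complex_of_real 2 \<cdot>\<^sub>m partial_transpose 3 3 rho_v)"
    unfolding mixed_mat_def rho_v_partial_transpose sym_mat_smult
    by (rule sym_mat_dominates) (simp_all add: power2_eq_square)
  then have "dominates (3 * 3) mixed_mat (complex_of_real 2 \<cdot>\<^sub>m partial_transpose 3 3 rho_v)" by simp
  from bip_power_dominates[OF this, of n] show ?thesis
    by (simp add: bip_power_smult[OF partial_transpose_carrier] partial_transpose_bip_power)
qed

section \<open>Regularized relative entropies\<close>

lemma log_tau_power: "- log 2 ((1 / tau) ^ n) = real n * log 2 tau"
  using tau_bounds by (simp add: log_nat_power log_divide)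

text \<open>Positivity of \<sigma> lets a dominator replace the state; after \<Gamma> the trace-norm
  constraint meets the scalar bound on the transposed dominator. Of the resulting product,
  \<open>(1 / 2) ^ n\<close> is the eigenvalue of the flat state and \<open>(1 / tau) ^ n\<close>
  the overlap with its support.\<close>

lemma rains_bound_ge: "ereal (real n * log 2 tau) \<le> rains_bound (3 ^ n) (3 ^ n) (rho_pow n)"
  unfolding rains_bound_def
proof (rule INF_greatest, clarify)
  fix \<sigma> assume \<sigma>: "psd_mat (pdim n) \<sigma>" "trace_norm (partial_transpose (3 ^ n) (3 ^ n) \<sigma>) \<le> 1"
  let ?pt = "partial_transpose (3 ^ n) (3 ^ n)" and ?F = "bip_power 3 3 (flip_mat (1 / 2)) n"
  have "Re (trace_pair (pdim n) (rho_pow n) \<sigma>) \<le> Re (trace_pair (pdim n) ?F \<sigma>)"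
    using dominates_trace_pair[OF rho_pow_le_flip psd_mat_dominates_self[OF \<sigma>(1)]] by linarith
  also have "\<dots> = Re (trace_pair (pdim n) (?pt \<sigma>) (?pt ?F))"
    by (simp add: trace_pair_partial_transpose trace_pair_commute)
  also have "\<dots> \<le> (1 / 2 * (1 / tau)) ^ n * trace_norm (?pt \<sigma>)"
  proof -
    have "hermitian (pdim n) (?pt \<sigma>)"
      unfolding hermitian_def
    proof (intro conjI allI impI)
      fix i j assume ij: "i < pdim n" "j < pdim n"
      have h: "\<sigma> $$ (b, a) = cnj (\<sigma> $$ (a, b))" if "a < pdim n" "b < pdim n" for a b
        using psd_mat_hermitian[OF \<sigma>(1)] that unfolding hermitian_def by blast
      show "?pt \<sigma> $$ (j, i) = cnj (?pt \<sigma> $$ (i, j))"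
        unfolding partial_transpose_index[OF ij] partial_transpose_index[OF ij(2,1)]
        by (rule h) (use ij in \<open>simp_all add: partial_transpose_index_less\<close>)
    qed simp
    from trace_pair_le_trace_norm[OF this flip_pow_partial_transpose[of "1 / 2" n]]
    show ?thesis by simp
  qed
  also have "\<dots> \<le> (1 / 2 * (1 / tau)) ^ n"
    using \<sigma>(2) tau_bounds by (intro mult_left_le) simp_all
  also have "\<dots> = (1 / 2) ^ n * (1 / tau) ^ n" by (rule power_mult_distrib)
  finally have "ereal (- log 2 ((1 / tau) ^ n)) \<le> rel_entropy (rho_pow n) \<sigma>"
    using tau_bounds by (intro rel_entropy_flat_ge[OF rho_pow_psd rho_pow_trace rho_pow_mult _ \<sigma>(1)]) simp_all
  then show "ereal (real n * log 2 tau) \<le> rel_entropy (rho_pow n) \<sigma>" by (simp only: log_tau_power)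
qed

lemma rho_v_flat:
  "psd_mat 9 rho_v" "mat_trace rho_v = 1" "rho_v * rho_v = complex_of_real (1 / 2) \<cdot>\<^sub>m rho_v"
  using rho_pow_psd[of 1] rho_pow_trace[of 1] rho_pow_mult[of 1] unfolding bip_power_1[OF rho_v_carrier] by simp_all

lemma rains_bound_rho_v_le: "rains_bound 3 3 rho_v \<le> ereal (log 2 tau)"
proof -
  \<comment> \<open>Dividing \<open>rho_v\<close> by the trace norm of its partial transpose gives a
    Rains operator, at relative entropy equal to the log-negativity.\<close>
  let ?\<sigma> = "sym_mat 0 (1 / (4 * tau)) 0 0 (- 1 / (4 * tau)) 0 0 0"
  have t: "tau > 0" using tau_bounds by simp
  have \<sigma>: "?\<sigma> = complex_of_real (1 / tau) \<cdot>\<^sub>m rho_v" unfolding rho_v_eq sym_mat_smult by (simp add: mult.commute)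
  have psd: "psd_mat 9 ?\<sigma>" using t by (simp add: sym_mat_psd)
  have "rel_entropy rho_v ?\<sigma> = ereal (log 2 (1 / 2) - log 2 (1 / (2 * tau)))"
  proof (rule rel_entropy_flat_eq[OF rho_v_flat _ psd_mat_hermitian[OF psd]])
    show "?\<sigma> * ?\<sigma> = complex_of_real (1 / (2 * tau)) \<cdot>\<^sub>m ?\<sigma>" "rho_v * ?\<sigma> = complex_of_real (1 / (2 * tau)) \<cdot>\<^sub>m rho_v"
      unfolding rho_v_eq sym_mat_mult sym_mat_smult using t by simp_all
  qed (use t in simp_all)
  moreover have "log 2 (1 / 2) - log 2 (1 / (2 * tau)) = log 2 tau"
    using t by (simp add: log_divide log_mult)
  moreover have "trace_norm (partial_transpose 3 3 ?\<sigma>) \<le> 1"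
  proof -
    have "dominates (3 * 3) (complex_of_real (1 / tau) \<cdot>\<^sub>m abs_pt_mat) (complex_of_real (1 / tau) \<cdot>\<^sub>m partial_transpose 3 3 rho_v)"
      using t by (intro dominates_smult[OF abs_pt_mat_dominates]) simp
    from trace_norm_le_dominates[OF this]
    have "trace_norm (partial_transpose 3 3 ?\<sigma>) \<le> Re (mat_trace (complex_of_real (1 / tau) \<cdot>\<^sub>m abs_pt_mat))"
      unfolding \<sigma> partial_transpose_smult[OF rho_v_carrier] .
    also have "\<dots> = 1"
      unfolding mat_trace_smult[OF dominates_carrier(1)[OF abs_pt_mat_dominates]] abs_pt_mat_trace using t by simp
    finally show ?thesis .
  qed
  ultimately show ?thesis
    unfolding rains_bound_def using psd by (intro INF_lower2[of ?\<sigma>]) simp_all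
qed

lemma regularized_rains_rho_v: "regularized_rains 3 3 rho_v = ereal (log 2 tau)"
proof (rule antisym)
  \<comment> \<open>The lower bound is linear in the number of copies, so a single copy already
    attains the infimum.\<close>
  have "regularized_rains 3 3 rho_v \<le> rains_bound (3 ^ 1) (3 ^ 1) (rho_pow 1) / ereal (real 1)"
    unfolding regularized_rains_def by (rule INF_lower) simp
  also have "\<dots> = rains_bound 3 3 rho_v"
    unfolding bip_power_1[OF rho_v_carrier] by (simp add: one_ereal_def[symmetric])
  also have "\<dots> \<le> ereal (log 2 tau)" by (rule rains_bound_rho_v_le)
  finally show "regularized_rains 3 3 rho_v \<le> ereal (log 2 tau)" .
  show "ereal (log 2 tau) \<le> regularized_rains 3 3 rho_v"
    unfolding regularized_rains_def
  proof (rule INF_greatest)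
    fix n :: nat assume n: "n \<in> {1..}"
    then have "ereal (log 2 tau) = ereal (real n * log 2 tau) / ereal (real n)" by simp
    also have "\<dots> \<le> rains_bound (3 ^ n) (3 ^ n) (rho_pow n) / ereal (real n)"
      using n by (intro ereal_divide_right_mono rains_bound_ge) simp
    finally show "ereal (log 2 tau) \<le> rains_bound (3 ^ n) (3 ^ n) (rho_pow n) / ereal (real n)" .
  qed
qed

text \<open>Positivity of \<open>\<sigma>\<^sup>\<Gamma>\<close> lets \<open>Y\<close> replace the
  transposed state, and positivity of \<sigma> then bounds \<open>Y\<^sup>\<Gamma>\<close> by a
  scalar. The bound \<open>(1 / 4) ^ n\<close> splits into the eigenvalue \<open>(1 / 2) ^ n\<close>
  of the state and an overlap \<open>(1 / 2) ^ n\<close>.\<close>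

lemma ppt_rel_entropy_ge: "ereal (real n) \<le> ppt_rel_entropy (3 ^ n) (3 ^ n) (rho_pow n)"
  unfolding ppt_rel_entropy_def
proof (rule INF_greatest, clarify)
  fix \<sigma>
  let ?pt = "partial_transpose (3 ^ n) (3 ^ n)" and ?Y = "bip_power 3 3 dual_mat n"
  assume \<sigma>: "psd_mat (pdim n) \<sigma>" "psd_mat (pdim n) (?pt \<sigma>)" "mat_trace \<sigma> = 1"
  have "Re (trace_pair (pdim n) (rho_pow n) \<sigma>) = Re (trace_pair (pdim n) (?pt (rho_pow n)) (?pt \<sigma>))"
    by (simp add: trace_pair_partial_transpose)
  also have "\<dots> \<le> Re (trace_pair (pdim n) ?Y (?pt \<sigma>))"
    using dominates_trace_pair[OF dual_pow_dominates psd_mat_dominates_self[OF \<sigma>(2)]] by linarith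
  also have "\<dots> = Re (trace_pair (pdim n) (?pt ?Y) \<sigma>)"
    by (simp add: trace_pair_partial_transpose_swap)
  also have "\<dots> \<le> Re (trace_pair (pdim n) (complex_of_real ((1 / 4) ^ n) \<cdot>\<^sub>m 1\<^sub>m (pdim n)) \<sigma>)"
    using dominates_trace_pair[OF dual_pow_partial_transpose psd_mat_dominates_self[OF \<sigma>(1)]] by linarith
  also have "\<dots> = (1 / 4) ^ n"
    unfolding trace_pair_smult_left[OF one_carrier_mat] trace_pair_one_left[OF psd_mat_carrier[OF \<sigma>(1)]] \<sigma>(3)
    by (simp del: of_real_power of_real_divide)
  also have "\<dots> = (1 / 2) ^ n * (1 / 2 :: real) ^ n" by (simp flip: power_mult_distrib)
  finally have "ereal (- log 2 ((1 / 2) ^ n)) \<le> rel_entropy (rho_pow n) \<sigma>"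
    by (intro rel_entropy_flat_ge[OF rho_pow_psd rho_pow_trace rho_pow_mult _ \<sigma>(1)]) simp_all
  then show "ereal (real n) \<le> rel_entropy (rho_pow n) \<sigma>"
    by (simp add: log_nat_power log_divide)
qed

lemma ppt_rel_entropy_rho_v_le: "ppt_rel_entropy 3 3 rho_v \<le> ereal 1"
proof -
  \<comment> \<open>The uniform mixture of the product states 01, 10, 02, 20: \<open>rho_v\<close>
    with its coherences removed.\<close>
  let ?\<sigma> = "sym_mat 0 (1 / 4) 0 0 0 0 0 0"
  have psd: "psd_mat 9 ?\<sigma>" by (simp add: sym_mat_psd)
  have "rel_entropy rho_v ?\<sigma> = ereal (log 2 (1 / 2) - log 2 (1 / 4))"
  proof (rule rel_entropy_flat_eq[OF rho_v_flat _ psd_mat_hermitian[OF psd]])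
    show "?\<sigma> * ?\<sigma> = complex_of_real (1 / 4) \<cdot>\<^sub>m ?\<sigma>" "rho_v * ?\<sigma> = complex_of_real (1 / 4) \<cdot>\<^sub>m rho_v"
      unfolding rho_v_eq sym_mat_mult sym_mat_smult by simp_all
  qed simp_all
  moreover have "log 2 (1 / 2) - log 2 (1 / 4) = (1 :: real)"
  proof -
    have "log 2 (4 :: real) = 2" using log_nat_power[of 2 2 2] by simp
    then show ?thesis by (simp add: log_divide)
  qed
  moreover have "psd_mat (3 * 3) (partial_transpose 3 3 ?\<sigma>)" "mat_trace ?\<sigma> = 1"
    using psd by (simp_all add: sym_mat_partial_transpose sym_mat_trace)
  ultimately show ?thesis
    unfolding ppt_rel_entropy_def using psd by (intro INF_lower2[of ?\<sigma>]) simp_all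
qed

lemma regularized_ppt_rel_entropy_rho_v: "regularized_ppt_rel_entropy 3 3 rho_v = ereal 1"
proof (rule antisym)
  have "regularized_ppt_rel_entropy 3 3 rho_v \<le> ppt_rel_entropy (3 ^ 1) (3 ^ 1) (rho_pow 1) / ereal (real 1)"
    unfolding regularized_ppt_rel_entropy_def by (rule INF_lower) simp
  also have "\<dots> = ppt_rel_entropy 3 3 rho_v"
    unfolding bip_power_1[OF rho_v_carrier] by (simp add: one_ereal_def[symmetric])
  also have "\<dots> \<le> ereal 1" by (rule ppt_rel_entropy_rho_v_le)
  finally show "regularized_ppt_rel_entropy 3 3 rho_v \<le> ereal 1" .
  show "ereal 1 \<le> regularized_ppt_rel_entropy 3 3 rho_v"
    unfolding regularized_ppt_rel_entropy_def
  proof (rule INF_greatest)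
    fix n :: nat assume n: "n \<in> {1..}"
    then have "ereal 1 = ereal (real n) / ereal (real n)" by simp
    also have "\<dots> \<le> ppt_rel_entropy (3 ^ n) (3 ^ n) (rho_pow n) / ereal (real n)"
      using n by (intro ereal_divide_right_mono ppt_rel_entropy_ge) simp
    finally show "ereal 1 \<le> ppt_rel_entropy (3 ^ n) (3 ^ n) (rho_pow n) / ereal (real n)" .
  qed
qed

section \<open>Operational quantities\<close>

lemma INF_eq_zeroI:
  fixes f :: "'a \<Rightarrow> real"
  assumes "x \<in> S" "f x = 0" "\<And>y. y \<in> S \<Longrightarrow> 0 \<le> f y"
  shows "(INF y\<in>S. f y) = 0"
  using assms by (intro cInf_eq_minimum) force+

lemma INF_tendsto_zeroD:
  fixes f :: "nat \<Rightarrow> 'a \<Rightarrow> real"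
  assumes "(\<lambda>n. INF x\<in>S n. f n x) \<longlonglongrightarrow> 0" "\<And>n. S n \<noteq> {}" "0 < \<epsilon>"
  obtains N where "\<And>n. N \<le> n \<Longrightarrow> \<exists>x\<in>S n. f n x < \<epsilon>"
proof -
  have "eventually (\<lambda>n. (INF x\<in>S n. f n x) < \<epsilon>) sequentially"
    using assms(1,3) by (rule order_tendstoD)
  then obtain N where "\<And>n. N \<le> n \<Longrightarrow> (INF x\<in>S n. f n x) < \<epsilon>"
    by (auto simp: eventually_sequentially)
  then have "\<exists>x\<in>S n. f n x < \<epsilon>" if "N \<le> n" for n
    using cInf_lessD[of "f n ` S n" \<epsilon>] assms(2) that by blast
  then show ?thesis by (rule that)
qed

text \<open>After division by n, the bounded errors from rounding and from a constant fidelity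
  disappear.\<close>

lemma rate_leI:
  assumes "\<And>n :: nat. N \<le> n \<Longrightarrow> real n * a \<le> real n * b + c"
  shows "a \<le> (b :: real)"
proof (rule ccontr)
  assume "\<not> a \<le> b"
  then have ab: "0 < a - b" by simp
  obtain m :: nat where m: "c / (a - b) < real m" using reals_Archimedean2 by blast
  have "c / (a - b) < real (max m N)" using m by simp
  then have "c < real (max m N) * (a - b)" using ab by (simp add: pos_divide_less_eq)
  moreover have "real (max m N) * a \<le> real (max m N) * b + c" by (rule assms) simp
  ultimately show False by (simp add: algebra_simps)
qed

lemma power_nat_floor_le:
  assumes "0 \<le> x"
  shows "2 ^ nat \<lfloor>x\<rfloor> \<le> (2 :: real) powr x"
proof -
  have "(2 :: real) ^ nat \<lfloor>x\<rfloor> = 2 powr real (nat \<lfloor>x\<rfloor>)" by (simp add: powr_realpow)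
  also have "\<dots> \<le> 2 powr x" using assms by (intro powr_mono) auto
  finally show ?thesis .
qed

lemma powr_log_tau: "2 powr (log 2 tau * real n) = tau ^ n"
  using tau_bounds by (simp add: powr_powr[symmetric] powr_realpow)

text \<open>The bound \<open>c\<close> on \<open>Z\<close> is kept explicit for the cost: there
  \<open>Z\<close> is the state itself, whose overlaps are exponentially small, and its equally
  small norm makes a constant trace distance informative.\<close>

lemma trace_pair_close:
  assumes "A \<in> carrier_mat D D" "B \<in> carrier_mat D D" "hermitian D A" "hermitian D B"
    and "dominates D (complex_of_real c \<cdot>\<^sub>m 1\<^sub>m D) Z" "0 < c" "trace_norm (A - B) < \<epsilon>"
  shows "\<bar>Re (trace_pair D A Z) - Re (trace_pair D B Z)\<bar> < c * \<epsilon>"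
proof -
  have "hermitian D (A - B)"
    unfolding hermitian_def
  proof (intro conjI allI impI minus_carrier_mat)
    fix i j assume ij: "i < D" "j < D"
    then have "A $$ (j, i) = cnj (A $$ (i, j))" "B $$ (j, i) = cnj (B $$ (i, j))"
      using assms(3,4) unfolding hermitian_def by blast+
    then show "(A - B) $$ (j, i) = cnj ((A - B) $$ (i, j))" using assms(1,2) ij by simp
  qed (fact assms)
  from trace_pair_le_trace_norm[OF this assms(5)]
  have "\<bar>Re (trace_pair D A Z) - Re (trace_pair D B Z)\<bar> \<le> c * trace_norm (A - B)"
    by (simp add: trace_pair_diff_left[OF assms(1,2)])
  also have "\<dots> < c * \<epsilon>" using assms(6,7) by simp
  finally show ?thesis .
qed

text \<open>The rate is attained with zero error for all large n: rounding down keeps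
  \<open>2 ^ k\<close> at most \<open>tau ^ n\<close>, which is the dimension the test
  allows.\<close>

lemma distillable_entanglement_ge: "ereal (log 2 tau) \<le> distillable_entanglement 3 3 rho_v"
  unfolding distillable_entanglement_def
proof (rule Sup_upper, intro CollectI exI conjI)
  let ?k = "\<lambda>n. nat \<lfloor>log 2 tau * real n\<rfloor>"
  have l0: "0 < log 2 tau" using tau_bounds by simp
  then show "0 \<le> log 2 tau" by simp
  \<comment> \<open>From \<open>N\<close> on at least one ebit is demanded, as
    \<open>exact_distillation\<close> requires.\<close>
  obtain N where N: "1 / log 2 tau < real N" using reals_Archimedean2 by blast
  have "(INF \<Lambda>\<in>ppt_operations (3 ^ n) (3 ^ n) (2 ^ ?k n) (2 ^ ?k n).
      trace_norm (\<Lambda> (rho_pow n) - ebits (?k n))) = 0" if n: "N \<le> n" for n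
  proof -
    have "1 / log 2 tau < real n" using N n by linarith
    then have "1 < log 2 tau * real n" using l0 by (simp add: pos_divide_less_eq mult.commute)
    then have k: "0 < ?k n" by linarith
    have "2 ^ ?k n \<le> tau ^ n"
      using power_nat_floor_le[of "log 2 tau * real n"] l0 by (simp add: powr_log_tau)
    then have le: "(1 * (1 / tau)) ^ n \<le> 1 / real (2 ^ ?k n)"
      using tau_bounds by (simp add: power_one_over frac_le)
    have d: "dominates (pdim n) (complex_of_real (1 / real (2 ^ ?k n)) \<cdot>\<^sub>m 1\<^sub>m (pdim n))
        (partial_transpose (3 ^ n) (3 ^ n) (bip_power 3 3 (flip_mat 1) n))"
      by (rule dominates_scalar_mono[OF flip_pow_partial_transpose[OF zero_le_one] le])
    have "psd_mat (pdim n) (1\<^sub>m (pdim n) - bip_power 3 3 (flip_mat 1) n)"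
      using flip_pow_le_one by (simp add: dominates_def)
    from exact_distillation[OF refl k flip_pow_psd this d bip_power_carrier flip_pow_trace_pair rho_pow_trace]
    obtain \<Lambda> where \<Lambda>: "\<Lambda> \<in> ppt_operations (3 ^ n) (3 ^ n) (2 ^ ?k n) (2 ^ ?k n)" "\<Lambda> (rho_pow n) = ebits (?k n)"
      by blast
    show ?thesis
    proof (rule INF_eq_zeroI[OF \<Lambda>(1)])
      show "trace_norm (\<Lambda> (rho_pow n) - ebits (?k n)) = 0"
        unfolding \<Lambda>(2) by (rule trace_norm_diff_self[OF ebits_carrier])
    qed (use minus_carrier_mat[OF ebits_carrier] trace_norm_nonneg in blast)
  qed
  then show "(\<lambda>n. INF \<Lambda>\<in>ppt_operations (3 ^ n) (3 ^ n) (2 ^ ?k n) (2 ^ ?k n).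
      trace_norm (\<Lambda> (rho_pow n) - ebits (?k n))) \<longlonglongrightarrow> 0"
    by (intro tendsto_eventually) (auto simp: eventually_sequentially)
qed simp

text \<open>An output within trace distance 1/2 of the target has fidelity above 1/2 with it, while
  the log-negativity bound caps the fidelity at \<open>tau ^ n / 2 ^ k\<close>.\<close>

lemma distillable_entanglement_le: "distillable_entanglement 3 3 rho_v \<le> ereal (log 2 tau)"
  unfolding distillable_entanglement_def
proof (rule Sup_least, clarify)
  fix r :: real
  let ?k = "\<lambda>n. nat \<lfloor>r * real n\<rfloor>"
  assume r: "0 \<le> r" and lim: "(\<lambda>n. INF \<Lambda>\<in>ppt_operations (3 ^ n) (3 ^ n) (2 ^ ?k n) (2 ^ ?k n).
      trace_norm (\<Lambda> (rho_pow n) - ebits (?k n))) \<longlonglongrightarrow> 0"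
  obtain N where N: "\<And>n. N \<le> n \<Longrightarrow> \<exists>\<Lambda>\<in>ppt_operations (3 ^ n) (3 ^ n) (2 ^ ?k n) (2 ^ ?k n).
      trace_norm (\<Lambda> (rho_pow n) - ebits (?k n)) < 1 / 2"
    using INF_tendsto_zeroD[OF lim ppt_operations_nonempty, of "1 / 2"] by auto
  \<comment> \<open>One unit of the slack comes from the fidelity 1/2, the other from rounding
    \<open>r * real n\<close> down.\<close>
  have "real n * r \<le> real n * log 2 tau + 2" if "N \<le> n" for n
  proof -
    let ?K = "2 ^ ?k n :: nat" and ?D = "2 ^ ?k n * 2 ^ ?k n :: nat"
    obtain \<Lambda> where \<Lambda>: "\<Lambda> \<in> ppt_operations (3 ^ n) (3 ^ n) ?K ?K"
        "trace_norm (\<Lambda> (rho_pow n) - ebits (?k n)) < 1 / 2"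
      using N \<open>N \<le> n\<close> by blast
    have psd: "psd_mat ?D (\<Lambda> (rho_pow n))"
      by (rule completely_positive_psd[OF ppt_operationsD(1)[OF \<Lambda>(1)] rho_pow_psd])
    have G: "dominates (pdim n) (bip_power 3 3 abs_pt_mat n) (partial_transpose (3 ^ n) (3 ^ n) (rho_pow n))"
      unfolding partial_transpose_bip_power by (rule bip_power_dominates[OF abs_pt_mat_dominates])
    have "dominates ?D (complex_of_real 1 \<cdot>\<^sub>m 1\<^sub>m ?D) (ebits (?k n))"
    proof -
      have "complex_of_real 1 \<cdot>\<^sub>m 1\<^sub>m ?D = 1\<^sub>m ?D" by (intro eq_matI) auto
      then show ?thesis by (simp only: ebits_le_one)
    qed
    then have "\<bar>Re (trace_pair ?D (\<Lambda> (rho_pow n)) (ebits (?k n))) - 1\<bar> < 1 * (1 / 2)"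
      using trace_pair_close[OF psd_mat_carrier[OF psd] ebits_carrier psd_mat_hermitian[OF psd]
          psd_mat_hermitian[OF ebits_psd] _ _ \<Lambda>(2), of 1 "ebits (?k n)"]
      by (simp add: ebits_trace_pair)
    then have "1 / 2 < Re (trace_pair ?D (\<Lambda> (rho_pow n)) (ebits (?k n)))" by linarith
    moreover have "Re (trace_pair ?D (\<Lambda> (rho_pow n)) (ebits (?k n))) \<le> 1 / 2 ^ ?k n * Re (mat_trace (bip_power 3 3 abs_pt_mat n))"
      by (rule ppt_operations_distill_le[OF \<Lambda>(1) bip_power_carrier G ebits_partial_transpose])
    moreover have "Re (mat_trace (bip_power 3 3 abs_pt_mat n)) = tau ^ n"
      unfolding mat_trace_bip_power[OF dominates_carrier(1)[OF abs_pt_mat_dominates]] abs_pt_mat_trace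
      by (simp flip: of_real_power)
    ultimately have "1 / 2 < 1 / 2 ^ ?k n * tau ^ n" by (simp only: less_le_trans)
    then have "2 ^ ?k n < 2 * tau ^ n" by (simp add: field_simps)
    then have "log 2 (2 ^ ?k n) < log 2 (2 * tau ^ n)"
      using tau_bounds by (subst log_less_cancel_iff) simp_all
    then have "real (?k n) < 1 + real n * log 2 tau"
      using tau_bounds by (simp add: log_mult log_nat_power)
    moreover have "r * real n < real (?k n) + 1" using r by linarith
    ultimately show ?thesis by (simp add: mult.commute)
  qed
  then have "r \<le> log 2 tau" by (rule rate_leI)
  then show "ereal r \<le> ereal (log 2 tau)" by simp
qed

lemma entanglement_cost_le: "entanglement_cost 3 3 rho_v \<le> ereal 1"
  unfolding entanglement_cost_def
proof (rule Inf_lower, intro CollectI exI conjI)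
  let ?k = "\<lambda>n. nat \<lfloor>1 * real n\<rfloor>"
  \<comment> \<open>The case of zero copies is left out because \<open>exact_dilution\<close> starts
    from at least one ebit.\<close>
  have "(INF \<Lambda>\<in>ppt_operations (2 ^ ?k n) (2 ^ ?k n) (3 ^ n) (3 ^ n).
      trace_norm (rho_pow n - \<Lambda> (ebits (?k n)))) = 0" if n: "1 \<le> n" for n
  proof -
    have k: "?k n = n" by simp
    have "0 < n" using n by simp
    from exact_dilution[OF refl this rho_pow_psd rho_pow_trace mixed_pow_dominates mixed_pow_trace
        mixed_pow_partial_transpose mixed_pow_dominates_pt]
    obtain \<Lambda> where \<Lambda>: "\<Lambda> \<in> ppt_operations (2 ^ n) (2 ^ n) (3 ^ n) (3 ^ n)" "\<Lambda> (ebits n) = rho_pow n"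
      by blast
    show ?thesis
      unfolding k
    proof (rule INF_eq_zeroI[OF \<Lambda>(1)])
      show "trace_norm (rho_pow n - \<Lambda> (ebits n)) = 0"
        unfolding \<Lambda>(2) by (rule trace_norm_diff_self[OF bip_power_carrier])
      fix \<Lambda>' assume "\<Lambda>' \<in> ppt_operations (2 ^ n) (2 ^ n) (3 ^ n) (3 ^ n)"
      then show "0 \<le> trace_norm (rho_pow n - \<Lambda>' (ebits n))"
        using ppt_operationsD(3) ebits_carrier by (intro trace_norm_nonneg minus_carrier_mat) blast
    qed
  qed
  then show "(\<lambda>n. INF \<Lambda>\<in>ppt_operations (2 ^ ?k n) (2 ^ ?k n) (3 ^ n) (3 ^ n).
      trace_norm (rho_pow n - \<Lambda> (ebits (?k n)))) \<longlonglongrightarrow> 0"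
    by (intro tendsto_eventually) (auto simp: eventually_sequentially intro!: exI[of _ 1])
qed simp_all

text \<open>Overlaps with the target state are compared: the target itself has
  \<open>(1 / 2) ^ n\<close>, an approximation more than half of that, but a state prepared from k
  ebits at most \<open>2 ^ k / 4 ^ n\<close>.\<close>

lemma entanglement_cost_ge: "ereal 1 \<le> entanglement_cost 3 3 rho_v"
  unfolding entanglement_cost_def
proof (rule Inf_greatest, clarify)
  fix r :: real
  let ?k = "\<lambda>n. nat \<lfloor>r * real n\<rfloor>"
  assume r: "0 \<le> r" and lim: "(\<lambda>n. INF \<Lambda>\<in>ppt_operations (2 ^ ?k n) (2 ^ ?k n) (3 ^ n) (3 ^ n).
      trace_norm (rho_pow n - \<Lambda> (ebits (?k n)))) \<longlonglongrightarrow> 0"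
  obtain N where N: "\<And>n. N \<le> n \<Longrightarrow> \<exists>\<Lambda>\<in>ppt_operations (2 ^ ?k n) (2 ^ ?k n) (3 ^ n) (3 ^ n).
      trace_norm (rho_pow n - \<Lambda> (ebits (?k n))) < 1 / 2"
    using INF_tendsto_zeroD[OF lim ppt_operations_nonempty, of "1 / 2"] by auto
  have "real n * 1 \<le> real n * r + 1" if "N \<le> n" for n
  proof -
    let ?K = "2 ^ ?k n :: nat"
    obtain \<Lambda> where \<Lambda>: "\<Lambda> \<in> ppt_operations ?K ?K (3 ^ n) (3 ^ n)"
        "trace_norm (rho_pow n - \<Lambda> (ebits (?k n))) < 1 / 2"
      using N \<open>N \<le> n\<close> by blast
    have psd: "psd_mat (pdim n) (\<Lambda> (ebits (?k n)))"
      by (rule completely_positive_psd[OF ppt_operationsD(1)[OF \<Lambda>(1)] ebits_psd])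
    have "trace_pair (3 * 3) rho_v rho_v = complex_of_real (1 / 2)"
      unfolding rho_v_eq using sym_mat_trace_pair by simp
    then have tp: "trace_pair (pdim n) (rho_pow n) (rho_pow n) = complex_of_real ((1 / 2) ^ n)"
      unfolding trace_pair_bip_power[OF rho_v_carrier] by (simp only: of_real_power)
    have "\<bar>Re (trace_pair (pdim n) (rho_pow n) (rho_pow n)) - Re (trace_pair (pdim n) (\<Lambda> (ebits (?k n))) (rho_pow n))\<bar>
        < (1 / 2) ^ n * (1 / 2)"
      by (rule trace_pair_close[OF bip_power_carrier psd_mat_carrier[OF psd] psd_mat_hermitian[OF rho_pow_psd]
          psd_mat_hermitian[OF psd] rho_pow_le _ \<Lambda>(2)]) simp
    then have "(1 / 2) ^ n * (1 / 2) < Re (trace_pair (pdim n) (\<Lambda> (ebits (?k n))) (rho_pow n))"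
      unfolding tp Re_complex_of_real by linarith
    also have "\<dots> \<le> 1 / 2 ^ ?k n * (1 / 4) ^ n * real (?K * ?K)"
      by (rule ppt_operations_dilute_le[OF \<Lambda>(1) ebits_carrier ebits_partial_transpose _ bip_power_carrier
          dual_pow_dominates dual_pow_partial_transpose]) simp
    also have "\<dots> = (1 / 2) ^ n * ((1 / 2) ^ n * 2 ^ ?k n)"
      by (simp add: field_simps flip: power_mult_distrib)
    finally have "1 / 2 < (1 / 2) ^ n * (2 :: real) ^ ?k n" by simp
    then have "(2 :: real) ^ n < 2 ^ Suc (?k n)" by (simp add: field_simps)
    then have "n < Suc (?k n)" by (simp only: power_strict_increasing_iff)
    moreover have "real (?k n) \<le> r * real n" using r by (simp add: of_nat_nat)
    ultimately show ?thesis by (simp add: mult.commute)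
  qed
  then have "1 \<le> r" by (rule rate_leI)
  then show "ereal 1 \<le> ereal r" by simp
qed

theorem mainTheorem1:
  shows "distillable_entanglement 3 3 rho_v = regularized_rains 3 3 rho_v \<and>
         regularized_rains 3 3 rho_v < regularized_ppt_rel_entropy 3 3 rho_v \<and>
         regularized_ppt_rel_entropy 3 3 rho_v = entanglement_cost 3 3 rho_v"
proof (intro conjI)
  show "distillable_entanglement 3 3 rho_v = regularized_rains 3 3 rho_v"
    unfolding regularized_rains_rho_v
    by (rule antisym[OF distillable_entanglement_le distillable_entanglement_ge])
  have "log 2 tau < log 2 2" using tau_bounds by simp
  then show "regularized_rains 3 3 rho_v < regularized_ppt_rel_entropy 3 3 rho_v"
    unfolding regularized_rains_rho_v regularized_ppt_rel_entropy_rho_v by simp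
  show "regularized_ppt_rel_entropy 3 3 rho_v = entanglement_cost 3 3 rho_v"
    unfolding regularized_ppt_rel_entropy_rho_v
    by (rule antisym[OF entanglement_cost_ge entanglement_cost_le])
qed

end
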